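(* Let $k$ be a field and let $Q$ be a connected quiver. Then there are only finitely many isomorphism classes of (finite dimensional) indecomposable representations of $Q$ over $k$ if and only if the underlying graph of $Q$ is a Dynkin diagram.
   Context: A quiver $Q=(Q_0,Q_1,s,t)$ consists of a finite set $Q_0$ of vertices, a finite set $Q_1$ of arrows and maps $s,t\colon Q_1\to Q_0$ (start and terminus); loops, multiple arrows and oriented cycles are allowed. Its underlying graph is obtained by forgetting the orientation of the arrows, and $Q$ is connected if this graph is connected (in particular non-empty). A representation $X$ of $Q$ over $k$ consists of a $k$-vector space $X_i$ for each $i\in Q_0$ and a linear map $X_\alpha\colon X_{s(\alpha)}\to X_{t(\alpha)}$ for each $\alpha\in Q_1$; a morphism $\phi\colon X\to Y$ is a family of linear maps $\phi_i\colon X_i\to Y_i$ with $Y_\alpha\phi_{s(\alpha)}=\phi_{t(\alpha)}X_\alpha$ for all $\alpha$. Direct sums are taken vertexwise; $X$ is finite dimensional if all $X_i$ are, and indecomposable if $X\ne 0$ and $X=X_1\oplus X_2$ implies $X_1=0$ or $X_2=0$. Dynkin diagrams: $A_n$ ($n\ge1$): a path with $n$ vertices; $D_n$ ($n\ge4$): the tree with one branching vertex and three arms with $1,1,n-3$ further vertices; $E_6,E_7,E_8$: the trees with one branching vertex and three arms with $1,2,2$, respectively $1,2,3$, respectively $1,2,4$ further vertices. *)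

theory Defs
  imports "Graph_Theory.Digraph_Component" "Jordan_Normal_Form.VS_Connect"
begin

text \<open>
  A quiver is a \<^locale>\<open>fin_digraph\<close>: finitely many vertices and arcs, loops and multiple
  arcs allowed, with start map \<^const>\<open>tail\<close> and terminus map \<^const>\<open>head\<close>.
  \<^const>\<open>Digraph_Component.connected\<close> refers to the symmetric closure, i.e. to the
  underlying graph, and includes that there is at least one vertex.
\<close>

subsection \<open>Representations\<close>

text \<open>
  All the vector spaces of one representation have their elements in a common type \<open>'w\<close>;
  the carriers and the operations are arbitrary and may differ from vertex to vertex.
  Values at points outside \<^term>\<open>verts Q\<close> and \<^term>\<open>arcs Q\<close> are irrelevant.
\<close>

record ('v, 'a, 'k, 'w) quiver_rep =
  rep_space :: "'v \<Rightarrow> ('k, 'w) module"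
  rep_map :: "'a \<Rightarrow> 'w \<Rightarrow> 'w"

definition representation ::
    "'k ring \<Rightarrow> ('v, 'a) pre_digraph \<Rightarrow> ('v, 'a, 'k, 'w) quiver_rep \<Rightarrow> bool" where
  "representation K Q X \<longleftrightarrow>
     (\<forall>i\<in>verts Q. vectorspace K (rep_space X i)) \<and>
     (\<forall>\<alpha>\<in>arcs Q. linear_map K (rep_space X (tail Q \<alpha>)) (rep_space X (head Q \<alpha>)) (rep_map X \<alpha>))"

definition fin_dim_rep ::
    "'k ring \<Rightarrow> ('v, 'a) pre_digraph \<Rightarrow> ('v, 'a, 'k, 'w) quiver_rep \<Rightarrow> bool" where
  "fin_dim_rep K Q X \<longleftrightarrow> (\<forall>i\<in>verts Q. vectorspace.fin_dim K (rep_space X i))"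

definition zero_rep :: "('v, 'a) pre_digraph \<Rightarrow> ('v, 'a, 'k, 'w) quiver_rep \<Rightarrow> bool" where
  "zero_rep Q X \<longleftrightarrow> (\<forall>i\<in>verts Q. carrier (rep_space X i) = {\<zero>\<^bsub>rep_space X i\<^esub>})"

definition rep_hom ::
    "'k ring \<Rightarrow> ('v, 'a) pre_digraph \<Rightarrow> ('v, 'a, 'k, 'w) quiver_rep \<Rightarrow>
     ('v, 'a, 'k, 'u) quiver_rep \<Rightarrow> ('v \<Rightarrow> 'w \<Rightarrow> 'u) set" where
  "rep_hom K Q X Y =
     {\<phi>. (\<forall>i\<in>verts Q. linear_map K (rep_space X i) (rep_space Y i) (\<phi> i)) \<and>
         (\<forall>\<alpha>\<in>arcs Q. \<forall>x\<in>carrier (rep_space X (tail Q \<alpha>)).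
            rep_map Y \<alpha> (\<phi> (tail Q \<alpha>) x) = \<phi> (head Q \<alpha>) (rep_map X \<alpha> x))}"

definition rep_iso ::
    "'k ring \<Rightarrow> ('v, 'a) pre_digraph \<Rightarrow> ('v, 'a, 'k, 'w) quiver_rep \<Rightarrow>
     ('v, 'a, 'k, 'u) quiver_rep \<Rightarrow> bool" where
  "rep_iso K Q X Y \<longleftrightarrow>
     (\<exists>\<phi>\<in>rep_hom K Q X Y.
        \<forall>i\<in>verts Q. bij_betw (\<phi> i) (carrier (rep_space X i)) (carrier (rep_space Y i)))"

definition rep_direct_sum ::
    "('v, 'a, 'k, 'w) quiver_rep \<Rightarrow> ('v, 'a, 'k, 'u) quiver_rep \<Rightarrow>
     ('v, 'a, 'k, 'w \<times> 'u) quiver_rep" where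
  "rep_direct_sum X Y =
     \<lparr>rep_space = (\<lambda>i. direct_sum (rep_space X i) (rep_space Y i)),
      rep_map = (\<lambda>\<alpha>. map_prod (rep_map X \<alpha>) (rep_map Y \<alpha>))\<rparr>"

text \<open>
  The summands range over representations with elements in the same type \<open>'w\<close> as \<open>X\<close>. This is
  no restriction: a direct summand of \<open>X\<close> is isomorphic to a subrepresentation of \<open>X\<close>.
\<close>

definition indecomposable_rep ::
    "'k ring \<Rightarrow> ('v, 'a) pre_digraph \<Rightarrow> ('v, 'a, 'k, 'w) quiver_rep \<Rightarrow> bool" where
  "indecomposable_rep K Q X \<longleftrightarrow>
     \<not> zero_rep Q X \<and>
     (\<forall>(X1 :: ('v, 'a, 'k, 'w) quiver_rep) (X2 :: ('v, 'a, 'k, 'w) quiver_rep).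
        representation K Q X1 \<and> representation K Q X2 \<and> rep_iso K Q X (rep_direct_sum X1 X2)
        \<longrightarrow> zero_rep Q X1 \<or> zero_rep Q X2)"

definition indecomposables ::
    "'k ring \<Rightarrow> ('v, 'a) pre_digraph \<Rightarrow> ('v, 'a, 'k, 'w) quiver_rep set" where
  "indecomposables K Q =
     {X. representation K Q X \<and> fin_dim_rep K Q X \<and> indecomposable_rep K Q X}"

definition rep_iso_rel ::
    "'k ring \<Rightarrow> ('v, 'a) pre_digraph \<Rightarrow>
     (('v, 'a, 'k, 'w) quiver_rep \<times> ('v, 'a, 'k, 'w) quiver_rep) set" where
  "rep_iso_rel K Q =
     {(X, Y). representation K Q X \<and> representation K Q Y \<and> rep_iso K Q X Y}"

subsection \<open>Dynkin diagrams\<close>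

text \<open>A simple graph is given by its vertex set and its set of two-element edges.\<close>

definition path_graph :: "nat \<Rightarrow> nat set \<times> nat set set" where
  "path_graph n = ({..<n}, {{i, Suc i} | i. Suc i < n})"

text \<open>
  For \<open>p, q, r \<ge> 1\<close>: the tree with branching vertex \<open>p\<close> and arms
  \<open>p-1, \<dots>, 0\<close> and \<open>p+1, \<dots>, p+q\<close> and \<open>p+q+1, \<dots>, p+q+r\<close>.
\<close>

definition star_graph :: "nat \<Rightarrow> nat \<Rightarrow> nat \<Rightarrow> nat set \<times> nat set set" where
  "star_graph p q r =
     ({..p + q + r},
      {{i, Suc i} | i. i < p + q + r \<and> i \<noteq> p + q} \<union> {{p, Suc (p + q)}})"

definition dynkin_diagrams :: "(nat set \<times> nat set set) set" where
  "dynkin_diagrams =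
     {path_graph n | n. n \<ge> 1} \<union>
     {star_graph 1 1 (n - 3) | n. n \<ge> 4} \<union>
     {star_graph 1 2 2, star_graph 1 2 3, star_graph 1 2 4}"

text \<open>
  Isomorphism of the underlying multigraph of \<open>Q\<close> with a simple graph. Bijectivity on the
  arcs rules out multiple arcs; a loop would be sent to a singleton, which is not an edge of
  a simple graph.
\<close>

definition underlying_graph_iso ::
    "('v, 'a) pre_digraph \<Rightarrow> nat set \<times> nat set set \<Rightarrow> bool" where
  "underlying_graph_iso Q G \<longleftrightarrow>
     (\<exists>f. bij_betw f (verts Q) (fst G) \<and>
          bij_betw (\<lambda>\<alpha>. {f (tail Q \<alpha>), f (head Q \<alpha>)}) (arcs Q) (snd G))"

end

theory Submission
  imports Defs
begin

text \<open>
  The proof uses the reflection functors of Bernstein, Gelfand and Ponomarev, which work over every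
  field, finite ones included.

  Let \<open>j\<close> be a source. If \<open>X\<close> is indecomposable and not the simple representation at \<open>j\<close>, then
  the map from \<open>X j\<close> to the direct sum of the spaces at the heads of the arrows leaving \<open>j\<close> is
  injective: a kernel element would split off a copy of the simple. Replacing \<open>X j\<close> by the
  cokernel gives a representation of the quiver with the arrows at \<open>j\<close> reversed. Both
  representations are determined by the same data away from \<open>j\<close> together with one subspace of the
  direct sum, so that endomorphisms and isomorphisms correspond. Hence the new representation is
  indecomposable, the passage loses no isomorphism classes, and the dimension vector undergoes the
  simple reflection \<open>s\<^sub>j\<close>; see \<open>reflection_exists\<close>, \<open>reflection_indec\<close> and
  \<open>reflection_reflects_iso\<close>.

  A Dynkin diagram has a positive definite Tits form (complete squares along the arms of the star)
  and, being a tree, a topological order of its vertices. Reflecting once at each vertex in this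
  order restores the quiver and acts on dimension vectors by a Coxeter transformation. It has
  finite orbits and fixes only \<open>0\<close>, so it moves every non-zero dimension vector out of the
  positive cone at some time. Dimension vectors of representations cannot leave the cone;
  therefore every indecomposable becomes simple at a source before that. It follows that its
  dimension vector is one of the finitely many with Tits form \<open>1\<close>, and that it is determined by
  this vector up to isomorphism; see \<open>pos_def_indec\<close>.

  Conversely there are two ways to obtain infinitely many indecomposables. If some arrow can be deleted
  without disconnecting the quiver, put identities on all the other arrows and a nilpotent Jordan
  block of arbitrary size on this one (\<open>removable_arc_imp_infinite\<close>). If the quiver contains a
  Euclidean tree, the imaginary root \<open>\<delta>\<close> of the tree defines a linear form, the defect, that
  reflections preserve and that is positive on the simple at a sink but negative on the
  simple at a source. So reflecting the former never produces the latter, the process never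
  stops, and it yields infinitely many dimension vectors (\<open>radical_vector_imp_infinite\<close>). A
  quiver of finite type is therefore a tree without Euclidean subtrees. A largest star with three
  arms inside it, where empty arms are allowed, is everything, since any further neighbour would
  enlarge the star or create a \<open>D\<close>-tilde; and the lengths of the arms are bounded by
  \<open>E\<^sub>6\<close>-, \<open>E\<^sub>7\<close>- and \<open>E\<^sub>8\<close>-tilde (\<open>spanning_star_exists\<close>, \<open>finite_imp_dynkin\<close>).

  All of this is carried out for representations by matrices. Choosing bases
  (\<open>matrix_form_exists\<close>), storing coordinate vectors in the given type
  (\<open>matrix_rep_realized\<close>) and splitting idempotents translate the result to arbitrary
  representations.
\<close>

section \<open>Matrices as endomorphisms of the space of sequences\<close>

text \<open>
  All matrices live in one ring, the linear endomorphisms of the sequences over \<open>k\<close>. An \<open>m\<close> by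
  \<open>n\<close> matrix is an element \<open>f\<close> with \<open>e\<^sub>m f = f = f e\<^sub>n\<close>, where \<open>e\<^sub>n\<close> is the projection to the first \<open>n\<close>
  coordinates. So matrices of all formats can be added, multiplied and summed over arrows with the
  usual ring laws, and no dimensions occur in the types.
\<close>

typedef (overloaded) 'k endo =
  "{f :: (nat \<Rightarrow> 'k::field) \<Rightarrow> nat \<Rightarrow> 'k.
      (\<forall>u v. f (\<lambda>n. u n + v n) = (\<lambda>n. f u n + f v n)) \<and>
      (\<forall>c v. f (\<lambda>n. c * v n) = (\<lambda>n. c * f v n))}"
  morphisms app Endo
  by (rule exI[of _ id]) auto

lemma app_add: "app f (\<lambda>n. u n + v n) = (\<lambda>n. app f u n + app f v n)"
  using app[of f] by simp

lemma app_scale: "app f (\<lambda>n. c * v n) = (\<lambda>n. c * app f v n)"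
  using app[of f] by simp

lemma app_zero [simp]: "app f (\<lambda>_. 0) = (\<lambda>_. 0)"
  using app_scale[of f 0 "\<lambda>_. 0"] by simp

lemma app_minus: "app f (\<lambda>n. u n - v n) = (\<lambda>n. app f u n - app f v n)"
  using app_add[of f u "\<lambda>n. - 1 * v n"] app_scale[of f "- 1" v] by simp

lemma endo_eqI: "(\<And>v. app f v = app g v) \<Longrightarrow> f = g"
  by (metis app_inverse ext)

instantiation endo :: (field) ring_1
begin

definition "0 = Endo (\<lambda>_ _. 0)"
definition "1 = Endo id"
definition "f + g = Endo (\<lambda>v n. app f v n + app g v n)"
definition "f - g = Endo (\<lambda>v n. app f v n - app g v n)"
definition "- f = Endo (\<lambda>v n. - app f v n)"
definition "f * g = Endo (app f \<circ> app g)"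

lemma app_zero_endo [simp]: "app 0 v = (\<lambda>_. 0)"
  by (simp add: zero_endo_def Endo_inverse)

lemma app_one_endo [simp]: "app 1 v = v"
  by (simp add: one_endo_def Endo_inverse)

lemma app_plus_endo [simp]: "app (f + g) v = (\<lambda>n. app f v n + app g v n)"
  by (simp add: plus_endo_def Endo_inverse app_add app_scale algebra_simps)

lemma app_minus_endo [simp]: "app (f - g) v = (\<lambda>n. app f v n - app g v n)"
  by (simp add: minus_endo_def Endo_inverse app_add app_scale algebra_simps)

lemma app_uminus_endo [simp]: "app (- f) v = (\<lambda>n. - app f v n)"
  by (simp add: uminus_endo_def Endo_inverse app_add app_scale algebra_simps)

lemma app_times_endo [simp]: "app (f * g) v = app f (app g v)"
  by (simp add: times_endo_def Endo_inverse app_add app_scale)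

instance
proof
  show "(0::'a endo) \<noteq> 1"
  proof
    assume "(0::'a endo) = 1"
    then have "app 0 (\<lambda>_. 1::'a) = app 1 (\<lambda>_. 1)" by simp
    then show False by (simp add: fun_eq_iff)
  qed
qed (auto intro!: endo_eqI simp: app_add algebra_simps)

end

definition trunc :: "nat \<Rightarrow> 'k::field endo" where
  "trunc m = Endo (\<lambda>v n. if n < m then v n else 0)"

definition shift_right :: "nat \<Rightarrow> 'k::field endo" where
  "shift_right k = Endo (\<lambda>v n. if n < k then 0 else v (n - k))"

definition shift_left :: "nat \<Rightarrow> 'k::field endo" where
  "shift_left k = Endo (\<lambda>v n. v (n + k))"

text \<open>
  The rank one matrix with column \<open>x\<close> and \<open>p\<close>-th unit row.
\<close>

definition outer :: "(nat \<Rightarrow> 'k) \<Rightarrow> nat \<Rightarrow> 'k::field endo" where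
  "outer x p = Endo (\<lambda>v n. v p * x n)"

definition unit_at :: "nat \<Rightarrow> nat \<Rightarrow> 'k::field" where
  "unit_at p n = (if n = p then 1 else 0)"

definition skip_at :: "nat \<Rightarrow> 'k::field endo" where
  "skip_at p = Endo (\<lambda>v n. if n < p then v n else v (Suc n))"

definition insert_zero_at :: "nat \<Rightarrow> 'k::field endo" where
  "insert_zero_at p = Endo (\<lambda>v n. if n < p then v n else if n = p then 0 else v (n - 1))"

lemma app_trunc [simp]: "app (trunc m) v = (\<lambda>n. if n < m then v n else 0)"
  by (simp add: trunc_def Endo_inverse fun_eq_iff)

lemma app_shift_right [simp]: "app (shift_right k) v = (\<lambda>n. if n < k then 0 else v (n - k))"
  by (simp add: shift_right_def Endo_inverse fun_eq_iff)

lemma app_shift_left [simp]: "app (shift_left k) v = (\<lambda>n. v (n + k))"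
  by (simp add: shift_left_def Endo_inverse fun_eq_iff)

lemma app_outer [simp]: "app (outer x p) v = (\<lambda>n. v p * x n)"
  by (simp add: outer_def Endo_inverse fun_eq_iff algebra_simps)

lemma app_skip_at [simp]: "app (skip_at p) v = (\<lambda>n. if n < p then v n else v (Suc n))"
  by (simp add: skip_at_def Endo_inverse fun_eq_iff)

lemma app_insert_zero_at [simp]:
  "app (insert_zero_at p) v = (\<lambda>n. if n < p then v n else if n = p then 0 else v (n - 1))"
  by (simp add: insert_zero_at_def Endo_inverse fun_eq_iff)

lemma trunc_trunc: "trunc m * trunc n = trunc (min m n)"
  by (rule endo_eqI) auto

lemma trunc_idem [simp]: "trunc m * trunc m = trunc m"
  by (simp add: trunc_trunc)

lemma trunc_0 [simp]: "trunc 0 = 0"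
  by (rule endo_eqI) simp

lemma trunc_Suc: "trunc (Suc n) = trunc n + outer (unit_at n) n"
  by (rule endo_eqI) (auto simp: unit_at_def fun_eq_iff less_Suc_eq)

lemma trunc_eq_0_iff: "(trunc n :: 'k::field endo) = 0 \<longleftrightarrow> n = 0"
proof
  assume "(trunc n :: 'k endo) = 0"
  then have "app (trunc n) (\<lambda>_. 1 :: 'k) 0 = app 0 (\<lambda>_. 1) 0" by simp
  then show "n = 0" by (auto split: if_splits)
qed simp

lemma mult_outer: "f * outer x p = outer (app f x) p"
proof (rule endo_eqI)
  fix v show "app (f * outer x p) v = app (outer (app f x) p) v"
    using app_scale[of f "v p" x] by simp
qed

text \<open>
  The \<open>m\<close> by \<open>n\<close> matrices, that is, the linear maps from \<open>k\<^sup>n\<close> to \<open>k\<^sup>m\<close>.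
\<close>

definition homs :: "nat \<Rightarrow> nat \<Rightarrow> 'k::field endo set" where
  "homs m n = {f. trunc m * f = f \<and> f * trunc n = f}"

lemma homsI: "trunc m * f = f \<Longrightarrow> f * trunc n = f \<Longrightarrow> f \<in> homs m n"
  by (simp add: homs_def)

lemma homs_left: "f \<in> homs m n \<Longrightarrow> trunc m * f = f"
  and homs_right: "f \<in> homs m n \<Longrightarrow> f * trunc n = f"
  by (simp_all add: homs_def)

lemma homs_left': "f \<in> homs m n \<Longrightarrow> trunc m * (f * g) = f * g"
  by (simp add: homs_def flip: mult.assoc)

lemma trunc_in_homs [simp]: "trunc n \<in> homs n n"
  and zero_in_homs [simp]: "0 \<in> homs m n"
  by (simp_all add: homs_def)

lemma homs_mult: "f \<in> homs l m \<Longrightarrow> g \<in> homs m n \<Longrightarrow> f * g \<in> homs l n"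
  by (simp add: homs_def mult.assoc) (simp add: mult.assoc[symmetric])

lemma homs_mult_gen: "f \<in> homs l m' \<Longrightarrow> g \<in> homs m n \<Longrightarrow> f * g \<in> homs l n"
  by (simp add: homs_def mult.assoc) (simp add: mult.assoc[symmetric])

lemma homs_add: "f \<in> homs m n \<Longrightarrow> g \<in> homs m n \<Longrightarrow> f + g \<in> homs m n"
  and homs_diff: "f \<in> homs m n \<Longrightarrow> g \<in> homs m n \<Longrightarrow> f - g \<in> homs m n"
  by (simp_all add: homs_def algebra_simps)

lemma homs_sum: "(\<And>a. a \<in> S \<Longrightarrow> f a \<in> homs m n) \<Longrightarrow> (\<Sum>a\<in>S. f a) \<in> homs m n"
  by (induction S rule: infinite_finite_induct) (auto intro: homs_add)

lemma homs_0_right: "f \<in> homs m 0 \<longleftrightarrow> f = 0"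
  and homs_0_left: "f \<in> homs 0 n \<longleftrightarrow> f = 0"
  by (auto simp: homs_def)

lemma homs_app: "f \<in> homs m n \<Longrightarrow> r \<ge> m \<Longrightarrow> app f v r = 0"
  using fun_cong[OF arg_cong[OF homs_left, of f m n "\<lambda>g. app g v"], of r] by simp

lemma homs_app_trunc: "f \<in> homs m n \<Longrightarrow> app f (\<lambda>r. if r < n then v r else 0) = app f v"
  using arg_cong[OF homs_right, of f m n "\<lambda>g. app g v"] by simp

text \<open>
  The cokernel of an injective matrix, in split form. The proof is Gauss elimination, one column at a
  time: if the first \<open>n\<close> columns are already complemented by \<open>R\<close>, the class of the next column
  in the cokernel is non-zero and has a pivot \<open>p\<close>; this column replaces the \<open>p\<close>-th column
  of \<open>R\<close>.
\<close>

lemma injective_split: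
  assumes "F \<in> homs N n" and "\<And>x. app F x = (\<lambda>_. 0) \<Longrightarrow> app (trunc n) x = (\<lambda>_. 0)"
  shows "\<exists>m P B R. N = n + m \<and> P \<in> homs n N \<and> B \<in> homs m N \<and> R \<in> homs N m \<and>
           P * F = trunc n \<and> B * F = 0 \<and> B * R = trunc m \<and> F * P + R * B = (trunc N :: 'k::field endo)"
  using assms
proof (induction n arbitrary: F)
  case 0
  then have "F = 0" by (simp add: homs_0_right)
  then show ?case
    by (intro exI[of _ N] exI[of _ 0] exI[of _ "trunc N"]) auto
next
  case (Suc n)
  define G where "G = F * trunc n"
  define f where "f = app F (unit_at n)"
  have G: "G \<in> homs N n"
    using Suc.prems(1) unfolding G_def by (metis homs_mult_gen trunc_in_homs)
  have F: "F = G + outer f n"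
    using homs_right[OF Suc.prems(1)] by (simp add: trunc_Suc G_def f_def distrib_left mult_outer)
  have "app (trunc n) x = (\<lambda>_. 0)" if "app G x = (\<lambda>_. 0)" for x
  proof -
    have "app F (app (trunc n) x) = (\<lambda>_. 0)" using that by (simp add: G_def)
    from Suc.prems(2)[OF this] show ?thesis by (auto simp: fun_eq_iff split: if_splits)
  qed
  from Suc.IH[OF G this] obtain m P B R where
    N: "N = n + m" and P: "P \<in> homs n N" and B: "B \<in> homs m N" and R: "R \<in> homs N m"
    and PG: "P * G = trunc n" and BG: "B * G = 0" and BR: "B * R = trunc m"
    and GP: "G * P + R * B = trunc N" by blast
  define b where "b = app B f"
  have f: "app (trunc N) f = f"
    using homs_left[OF Suc.prems(1)] by (simp add: f_def flip: app_times_endo)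
  have "b \<noteq> (\<lambda>_. 0)"
  proof
    assume "b = (\<lambda>_. 0)"
    then have "app (G * P) f = f"
      using arg_cong[OF GP, of "\<lambda>g. app g f"] f by (simp add: b_def)
    define x where "x = (\<lambda>r. unit_at n r - app (trunc n) (app P f) r)"
    have "app F x = (\<lambda>_. 0)"
      using \<open>app (G * P) f = f\<close> unfolding x_def app_minus
      by (simp add: f_def[symmetric]) (simp add: G_def)
    from Suc.prems(2)[OF this] have "app (trunc (Suc n)) x n = 0" by simp
    then show False by (simp add: x_def unit_at_def)
  qed
  then obtain p where p: "b p \<noteq> 0" by (auto simp: fun_eq_iff)
  have b0: "b r = 0" if "r \<ge> m" for r
    using B that unfolding b_def by (rule homs_app)
  have "p < m" using p b0[of p] by (meson not_le)
  then obtain m' where m: "m = Suc m'" by (cases m) auto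
  \<comment> \<open>\<open>W\<close> projects the cokernel to the line of the new column \<open>b\<close> along the coordinates
    other than \<open>p\<close>; \<open>V\<close> lifts it to the new coordinate.\<close>
  define V where "V = outer (\<lambda>r. unit_at n r / b p) p"
  define W where "W = outer (\<lambda>r. b r / b p) p"
  define D :: "'k endo" where "D = trunc m' * skip_at p"
  define I :: "'k endo" where "I = insert_zero_at p * trunc m'"
  have W: "W = B * F * V"
    unfolding W_def V_def F distrib_left BG
    by (rule endo_eqI) (simp add: mult_outer b_def[symmetric] unit_at_def)
  have Vb: "V * outer b n = outer (unit_at n) n"
    unfolding V_def mult_outer using p by (intro arg_cong2[of _ _ _ _ outer]) auto
  then have FVb: "F * (V * outer b n) = outer f n"
    by (simp add: mult_outer f_def)
  have Wb: "W * outer b n = outer b n"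
    unfolding W_def mult_outer using p by (intro arg_cong2[of _ _ _ _ outer]) auto
  have BF: "B * F = outer b n"
    by (simp add: F distrib_left BG mult_outer b_def)
  have PF: "P * F = trunc n + P * outer f n"
    by (simp add: F distrib_left PG)
  have DI: "D * (trunc m * I) = trunc m'"
    unfolding D_def I_def m using \<open>p < m\<close> m
    by (intro endo_eqI) (auto simp: fun_eq_iff)
  have WI: "W * (trunc m * I) = 0"
    unfolding W_def I_def by (rule endo_eqI) auto
  have ID: "I * (D * ((1 - W) * trunc m)) = (1 - W) * trunc m"
  proof (rule endo_eqI, rule ext)
    fix v :: "nat \<Rightarrow> 'k" and r
    define w where "w = app ((1 - W) * trunc m) v"
    have w: "w r = 0" if "r = p \<or> r \<ge> m" for r
      using that p b0 \<open>p < m\<close> by (auto simp: w_def W_def)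
    have "app (I * D) w r = w r"
      using w[of r] m \<open>p < m\<close> by (auto simp: I_def D_def)
    then show "app (I * (D * ((1 - W) * trunc m))) v r = app ((1 - W) * trunc m) v r"
      by (simp only: w_def app_times_endo)
  qed
  have B': "B = trunc m * B" and R': "R = R * trunc m"
    using B R by (simp_all add: homs_def)
  have RBFP: "R * B = trunc N - F * P"
    using GP homs_left[OF P] by (simp add: G_def mult.assoc algebra_simps)
  show ?case
  proof (intro exI conjI)
    show "N = Suc n + m'" using N m by simp
    let ?P = "P - P * F * V * B + V * B" and ?B = "D * (1 - W) * B" and ?R = "R * I"
    have tV: "trunc (Suc n) * V = V"
      unfolding V_def mult_outer by (intro arg_cong2[of _ _ _ _ outer]) (auto simp: unit_at_def)
    have tP: "trunc (Suc n) * P = P"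
      using homs_left[OF P] by (metis min.absorb2 lessI less_imp_le mult.assoc trunc_trunc)
    show "?P \<in> homs (Suc n) N"
      using tV tP homs_right[OF P] homs_right[OF B]
      by (auto simp: homs_def distrib_left distrib_right left_diff_distrib right_diff_distrib mult.assoc
          simp flip: mult.assoc[of "trunc (Suc n)"])
    have "trunc m' * D = D" by (simp add: D_def flip: mult.assoc)
    then show "?B \<in> homs m' N"
      using homs_right[OF B] by (auto simp: homs_def mult.assoc simp flip: mult.assoc[of "trunc m'"])
    have "I * trunc m' = I" by (simp add: I_def mult.assoc)
    then show "?R \<in> homs N m'"
      using homs_left'[OF R] by (auto simp: homs_def mult.assoc)
    show "?P * F = trunc (Suc n)"
    proof -
      have "?P * F = P * F - P * (F * (V * (B * F))) + V * (B * F)"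
        by (simp add: distrib_right left_diff_distrib mult.assoc)
      then show ?thesis unfolding BF FVb by (simp add: Vb PF trunc_Suc)
    qed
    show "?B * F = 0"
      by (simp add: mult.assoc BF left_diff_distrib Wb)
    show "?B * ?R = trunc m'"
    proof -
      have "?B * ?R = D * (1 - W) * (B * R) * I" by (simp add: mult.assoc)
      also have "\<dots> = D * (trunc m * I) - D * (W * (trunc m * I))"
        by (simp add: BR mult.assoc left_diff_distrib right_diff_distrib)
      finally show ?thesis by (simp add: DI WI)
    qed
    show "F * ?P + ?R * ?B = trunc N"
    proof -
      have "?R * ?B = R * (I * (D * ((1 - W) * trunc m))) * B"
        by (subst B') (simp add: mult.assoc)
      also have "\<dots> = R * trunc m * B - R * W * trunc m * B"
        unfolding ID by (simp add: left_diff_distrib right_diff_distrib mult.assoc)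
      also have "\<dots> = R * B - R * B * F * V * B"
        using B' R' by (simp add: W mult.assoc)
      also have "\<dots> = trunc N - F * P - (trunc N * F - F * P * F) * V * B"
        unfolding RBFP by (simp add: algebra_simps)
      finally show ?thesis
        using homs_left[OF Suc.prems(1)] by (simp add: algebra_simps)
    qed
  qed
qed

corollary injective_le:
  assumes "F \<in> homs N n" "P \<in> homs n N" "P * F = (trunc n :: 'k::field endo)"
  shows "n \<le> N"
proof -
  have "app (trunc n) x = (\<lambda>_. 0)" if "app F x = (\<lambda>_. 0)" for x
    using arg_cong[OF assms(3), of "\<lambda>g. app g x"] that by simp
  from injective_split[OF assms(1) this] show ?thesis by auto
qed

lemma coproduct_exists:
  fixes n :: "'a \<Rightarrow> nat"
  assumes "finite S"
  shows "\<exists>\<iota> \<pi>. (\<forall>a\<in>S. \<iota> a \<in> homs (\<Sum>a\<in>S. n a) (n a) \<and> \<pi> a \<in> homs (n a) (\<Sum>a\<in>S. n a)) \<and>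
     (\<forall>a\<in>S. \<forall>b\<in>S. \<pi> a * \<iota> b = (if a = b then trunc (n a) else (0::'k::field endo))) \<and>
     (\<Sum>a\<in>S. \<iota> a * \<pi> a) = trunc (\<Sum>a\<in>S. n a)"
  using assms
proof (induction S)
  case empty
  then show ?case by simp
next
  case (insert c S)
  define N where "N = (\<Sum>a\<in>S. n a)"
  from insert.IH obtain \<iota> \<pi> :: "'a \<Rightarrow> 'k endo" where
    \<iota>: "\<And>a. a \<in> S \<Longrightarrow> \<iota> a \<in> homs N (n a)" and \<pi>: "\<And>a. a \<in> S \<Longrightarrow> \<pi> a \<in> homs (n a) N" and
    orth: "\<And>a b. a \<in> S \<Longrightarrow> b \<in> S \<Longrightarrow> \<pi> a * \<iota> b = (if a = b then trunc (n a) else 0)" and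
    sum: "(\<Sum>a\<in>S. \<iota> a * \<pi> a) = trunc N"
    unfolding N_def by blast
  let ?k = "n c"
  let ?S = "shift_right ?k :: 'k endo" and ?T = "shift_left ?k :: 'k endo"
  have TS: "?T * ?S = 1" by (rule endo_eqI) simp
  have tS: "trunc ?k * ?S = 0" and Tt: "?T * trunc ?k = 0" by (rule endo_eqI; auto)+
  have SN: "trunc (?k + N) * ?S = ?S * trunc N" and TN: "?T * trunc (?k + N) = trunc N * ?T"
    by (rule endo_eqI; auto simp: fun_eq_iff add.commute)+
  \<comment> \<open>The new summand takes the first coordinates, and the old ones are shifted.\<close>
  have full: "trunc ?k + ?S * trunc N * ?T = trunc (?k + N)"
    by (rule endo_eqI) (auto simp: fun_eq_iff)
  define \<iota>' where "\<iota>' a = (if a = c then trunc ?k else ?S * \<iota> a)" for a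
  define \<pi>' where "\<pi>' a = (if a = c then trunc ?k else \<pi> a * ?T)" for a
  have N: "(\<Sum>a\<in>insert c S. n a) = ?k + N" using insert by (simp add: N_def)
  show ?case unfolding N
  proof (rule exI[of _ \<iota>'], rule exI[of _ \<pi>'], intro conjI ballI)
    fix a assume a: "a \<in> insert c S"
    show "\<iota>' a \<in> homs (?k + N) (n a)"
    proof (cases "a = c")
      case False
      then have "a \<in> S" using a by simp
      have "trunc (?k + N) * (?S * \<iota> a) = ?S * \<iota> a"
        using homs_left[OF \<iota>[OF \<open>a \<in> S\<close>]] SN by (metis mult.assoc)
      then show ?thesis using False homs_right[OF \<iota>[OF \<open>a \<in> S\<close>]]
        by (simp add: \<iota>'_def homs_def mult.assoc)
    qed (simp add: \<iota>'_def homs_def trunc_trunc)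
    show "\<pi>' a \<in> homs (n a) (?k + N)"
    proof (cases "a = c")
      case False
      then have "a \<in> S" using a by simp
      have "\<pi> a * ?T * trunc (?k + N) = \<pi> a * ?T"
        using homs_right[OF \<pi>[OF \<open>a \<in> S\<close>]] TN by (metis mult.assoc)
      then show ?thesis using False homs_left'[OF \<pi>[OF \<open>a \<in> S\<close>]]
        by (simp add: \<pi>'_def homs_def)
    qed (simp add: \<pi>'_def homs_def trunc_trunc)
    fix b assume b: "b \<in> insert c S"
    have "\<pi> a * ?T * (?S * \<iota> b) = \<pi> a * \<iota> b"
      using TS by (metis mult.assoc mult_1)
    moreover have "trunc ?k * (?S * \<iota> b) = 0"
      using tS by (metis mult.assoc mult_zero_left)
    moreover have "\<pi> a * ?T * trunc ?k = 0"
      using Tt by (metis mult.assoc mult_zero_right)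
    ultimately show "\<pi>' a * \<iota>' b = (if a = b then trunc (n a) else 0)"
      using a b orth by (auto simp: \<iota>'_def \<pi>'_def)
  next
    have "(\<Sum>a\<in>insert c S. \<iota>' a * \<pi>' a) = trunc ?k + (\<Sum>a\<in>S. \<iota>' a * \<pi>' a)"
      using insert by (simp add: \<iota>'_def \<pi>'_def)
    also have "(\<Sum>a\<in>S. \<iota>' a * \<pi>' a) = (\<Sum>a\<in>S. ?S * (\<iota> a * \<pi> a) * ?T)"
      using insert by (intro sum.cong) (auto simp: \<iota>'_def \<pi>'_def mult.assoc)
    also have "\<dots> = ?S * trunc N * ?T"
      by (simp add: sum[symmetric] sum_distrib_left sum_distrib_right)
    finally show "(\<Sum>a\<in>insert c S. \<iota>' a * \<pi>' a) = trunc (?k + N)" by (simp add: full)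
  qed
qed

section \<open>Matrix representations\<close>

lemma arc_ends: "fin_digraph Q \<Longrightarrow> a \<in> arcs Q \<Longrightarrow> tail Q a \<in> verts Q \<and> head Q a \<in> verts Q"
  by (simp add: fin_digraph_def wf_digraph_def)

definition matrix_rep :: "('v, 'a) pre_digraph \<Rightarrow> ('v \<Rightarrow> nat) \<Rightarrow> ('a \<Rightarrow> 'k::field endo) \<Rightarrow> bool" where
  "matrix_rep Q d A \<longleftrightarrow> (\<forall>a\<in>arcs Q. A a \<in> homs (d (head Q a)) (d (tail Q a)))"

definition matrix_hom :: "('v, 'a) pre_digraph \<Rightarrow> ('v \<Rightarrow> nat) \<Rightarrow> ('a \<Rightarrow> 'k::field endo) \<Rightarrow>
    ('v \<Rightarrow> nat) \<Rightarrow> ('a \<Rightarrow> 'k endo) \<Rightarrow> ('v \<Rightarrow> 'k endo) \<Rightarrow> bool" where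
  "matrix_hom Q d A d' A' \<phi> \<longleftrightarrow>
     (\<forall>i\<in>verts Q. \<phi> i \<in> homs (d' i) (d i)) \<and>
     (\<forall>a\<in>arcs Q. A' a * \<phi> (tail Q a) = \<phi> (head Q a) * A a)"

definition matrix_iso :: "('v, 'a) pre_digraph \<Rightarrow> ('v \<Rightarrow> nat) \<Rightarrow> ('a \<Rightarrow> 'k::field endo) \<Rightarrow>
    ('v \<Rightarrow> nat) \<Rightarrow> ('a \<Rightarrow> 'k endo) \<Rightarrow> bool" where
  "matrix_iso Q d A d' A' \<longleftrightarrow>
     (\<exists>\<phi> \<psi>. matrix_hom Q d A d' A' \<phi> \<and> matrix_hom Q d' A' d A \<psi> \<and>
       (\<forall>i\<in>verts Q. \<psi> i * \<phi> i = trunc (d i) \<and> \<phi> i * \<psi> i = trunc (d' i)))"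

text \<open>
  Indecomposability in terms of idempotent endomorphisms, which is how it is transferred by
  reflections.
\<close>

definition matrix_indec :: "('v, 'a) pre_digraph \<Rightarrow> ('v \<Rightarrow> nat) \<Rightarrow> ('a \<Rightarrow> 'k::field endo) \<Rightarrow> bool" where
  "matrix_indec Q d A \<longleftrightarrow> matrix_rep Q d A \<and> (\<exists>i\<in>verts Q. d i \<noteq> 0) \<and>
     (\<forall>\<phi>. matrix_hom Q d A d A \<phi> \<and> (\<forall>i\<in>verts Q. \<phi> i * \<phi> i = \<phi> i) \<longrightarrow>
        (\<forall>i\<in>verts Q. \<phi> i = 0) \<or> (\<forall>i\<in>verts Q. \<phi> i = trunc (d i)))"

lemma matrix_hom_trunc:
  assumes "matrix_rep Q d A"
  shows "matrix_hom Q d A d A (\<lambda>i. trunc (d i))"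
  using assms by (auto simp: matrix_hom_def matrix_rep_def homs_left homs_right)

lemma matrix_hom_mult:
  assumes "matrix_hom Q d A d' A' \<phi>" "matrix_hom Q d' A' d'' A'' \<psi>"
  shows "matrix_hom Q d A d'' A'' (\<lambda>i. \<psi> i * \<phi> i)"
  unfolding matrix_hom_def
proof (intro conjI ballI)
  fix a assume a: "a \<in> arcs Q"
  then have "A'' a * \<psi> (tail Q a) = \<psi> (head Q a) * A' a" "A' a * \<phi> (tail Q a) = \<phi> (head Q a) * A a"
    using assms by (auto simp: matrix_hom_def)
  then show "A'' a * (\<psi> (tail Q a) * \<phi> (tail Q a)) = \<psi> (head Q a) * \<phi> (head Q a) * A a"
    by (metis mult.assoc)
qed (use assms in \<open>auto simp: matrix_hom_def intro: homs_mult\<close>)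

lemma matrix_iso_dim: "matrix_iso Q d A d' A' \<Longrightarrow> i \<in> verts Q \<Longrightarrow> d i = d' i"
  unfolding matrix_iso_def matrix_hom_def by (meson injective_le le_antisym)

section \<open>Reflection at a source\<close>

definition source :: "('v, 'a) pre_digraph \<Rightarrow> 'v \<Rightarrow> bool" where
  "source Q j \<longleftrightarrow> j \<in> verts Q \<and> (\<forall>a\<in>arcs Q. head Q a \<noteq> j)"

text \<open>
  Only members of \<open>arcs Q\<close> are reversed, so that flipping at every vertex once gives back
  the same record.
\<close>

definition flip :: "'v \<Rightarrow> ('v, 'a) pre_digraph \<Rightarrow> ('v, 'a) pre_digraph" where
  "flip j Q = Q\<lparr>
     tail := (\<lambda>a. if a \<in> arcs Q \<and> (tail Q a = j \<or> head Q a = j) then head Q a else tail Q a),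
     head := (\<lambda>a. if a \<in> arcs Q \<and> (tail Q a = j \<or> head Q a = j) then tail Q a else head Q a)\<rparr>"

lemma verts_flip [simp]: "verts (flip j Q) = verts Q"
  and arcs_flip [simp]: "arcs (flip j Q) = arcs Q"
  by (simp_all add: flip_def)

lemma fin_digraph_flip: "fin_digraph Q \<Longrightarrow> fin_digraph (flip j Q)"
  unfolding fin_digraph_def fin_digraph_axioms_def wf_digraph_def by (auto simp: flip_def)

lemma tail_flip_source: "source Q j \<Longrightarrow> a \<in> arcs Q \<Longrightarrow>
    tail (flip j Q) a = (if tail Q a = j then head Q a else tail Q a)"
  and head_flip_source: "source Q j \<Longrightarrow> a \<in> arcs Q \<Longrightarrow>
    head (flip j Q) a = (if tail Q a = j then j else head Q a)"
  by (auto simp: flip_def source_def)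

abbreviation out :: "('v, 'a) pre_digraph \<Rightarrow> 'v \<Rightarrow> 'a set" where
  "out Q j \<equiv> {a \<in> arcs Q. tail Q a = j}"

text \<open>
  For a source \<open>j\<close> with outgoing arrows \<open>a\<close>: the maps \<open>A a\<close> out of the space at \<open>j\<close> and the maps
  \<open>B a\<close> into a space of dimension \<open>m\<close> form a short exact sequence
  \<open>0 \<rightarrow> X j \<rightarrow> \<Oplus>\<^sub>a X (head Q a) \<rightarrow> k\<^sup>m \<rightarrow> 0\<close>, and \<open>P\<close>, \<open>R\<close> are a splitting. With the splitting in
  hand, everything about the reflection is a calculation in the matrix ring.
\<close>

definition split_exact :: "('v, 'a) pre_digraph \<Rightarrow> 'v \<Rightarrow> ('v \<Rightarrow> nat) \<Rightarrow> nat \<Rightarrow>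
    ('a \<Rightarrow> 'k::field endo) \<Rightarrow> ('a \<Rightarrow> 'k endo) \<Rightarrow> ('a \<Rightarrow> 'k endo) \<Rightarrow> ('a \<Rightarrow> 'k endo) \<Rightarrow> bool" where
  "split_exact Q j d m A P B R \<longleftrightarrow>
     (\<forall>a\<in>out Q j. A a \<in> homs (d (head Q a)) (d j) \<and> P a \<in> homs (d j) (d (head Q a)) \<and>
        B a \<in> homs m (d (head Q a)) \<and> R a \<in> homs (d (head Q a)) m) \<and>
     (\<Sum>a\<in>out Q j. P a * A a) = trunc (d j) \<and>
     (\<Sum>a\<in>out Q j. B a * R a) = trunc m \<and>
     (\<Sum>a\<in>out Q j. B a * A a) = 0 \<and>
     (\<forall>a\<in>out Q j. \<forall>b\<in>out Q j. A a * P b + R a * B b = (if a = b then trunc (d (head Q a)) else 0))"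

text \<open>
  \<open>(d', B)\<close> arises from \<open>(d, A)\<close> by replacing the space at the source \<open>j\<close> by the cokernel of the
  outgoing maps.
\<close>

definition reflection :: "('v, 'a) pre_digraph \<Rightarrow> 'v \<Rightarrow> ('v \<Rightarrow> nat) \<Rightarrow> ('a \<Rightarrow> 'k::field endo) \<Rightarrow>
    ('v \<Rightarrow> nat) \<Rightarrow> ('a \<Rightarrow> 'k endo) \<Rightarrow> bool" where
  "reflection Q j d A d' B \<longleftrightarrow> (\<forall>i. i \<noteq> j \<longrightarrow> d' i = d i) \<and>
     (\<forall>a\<in>arcs Q - out Q j. B a = A a) \<and> (\<exists>P R. split_exact Q j d (d' j) A P B R)"

lemma split_exactD:
  assumes "split_exact Q j d m A P B R"
  shows "a \<in> out Q j \<Longrightarrow> A a \<in> homs (d (head Q a)) (d j)"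
    and "a \<in> out Q j \<Longrightarrow> P a \<in> homs (d j) (d (head Q a))"
    and "a \<in> out Q j \<Longrightarrow> B a \<in> homs m (d (head Q a))"
    and "a \<in> out Q j \<Longrightarrow> R a \<in> homs (d (head Q a)) m"
    and "(\<Sum>a\<in>out Q j. P a * A a) = trunc (d j)"
    and "(\<Sum>a\<in>out Q j. B a * R a) = trunc m"
    and "(\<Sum>a\<in>out Q j. B a * A a) = 0"
    and "a \<in> out Q j \<Longrightarrow> b \<in> out Q j \<Longrightarrow>
      A a * P b + R a * B b = (if a = b then trunc (d (head Q a)) else 0)"
  using assms unfolding split_exact_def by blast+

text \<open>
  A morphism is determined at the source by its values elsewhere, because the outgoing maps are jointly
  injective.
\<close>

lemma hom_at_source:
  assumes "split_exact Q j d m A P B R" "split_exact Q j e n A' P' B' R'"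
    and "matrix_hom Q d A e A' \<psi>" "source Q j"
  shows "\<psi> j = (\<Sum>a\<in>out Q j. P' a * \<psi> (head Q a) * A a)"
proof -
  have "\<psi> j = (\<Sum>a\<in>out Q j. P' a * A' a) * \<psi> j"
    using homs_left[of "\<psi> j" "e j" "d j"] split_exactD(5)[OF assms(2)] assms(3,4)
    by (simp add: matrix_hom_def source_def)
  also have "\<dots> = (\<Sum>a\<in>out Q j. P' a * \<psi> (head Q a) * A a)"
    unfolding sum_distrib_right
    using assms(3) by (intro sum.cong) (auto simp: matrix_hom_def mult.assoc)
  finally show ?thesis .
qed

text \<open>
  Dually, at the sink that \<open>j\<close> becomes, the incoming maps are jointly surjective.
\<close>

lemma hom_at_sink:
  assumes "split_exact Q j d m A P B R" "split_exact Q j e n A' P' B' R'"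
    and "matrix_hom (flip j Q) d' B e' B' \<phi>" "source Q j" "d' j = m"
  shows "\<phi> j = (\<Sum>a\<in>out Q j. B' a * \<phi> (head Q a) * R a)"
proof -
  have "\<phi> j = \<phi> j * (\<Sum>a\<in>out Q j. B a * R a)"
    using homs_right[of "\<phi> j" "e' j" m] split_exactD(6)[OF assms(1)] assms(3-5)
    by (auto simp: matrix_hom_def source_def)
  also have "\<dots> = (\<Sum>a\<in>out Q j. \<phi> j * B a * R a)"
    by (simp add: sum_distrib_left mult.assoc)
  also have "\<dots> = (\<Sum>a\<in>out Q j. B' a * \<phi> (head Q a) * R a)"
    using assms(3,4)
    by (intro sum.cong) (auto simp: matrix_hom_def tail_flip_source head_flip_source)
  finally show ?thesis .
qed

text \<open>
  A morphism of the reflected representations maps the kernel of the incoming maps to the kernel. But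
  this kernel is the image of the original outgoing maps, so the morphism induces a map there; the
  splitting gives the formula for it.
\<close>

lemma reflect_hom_back:
  assumes fin: "fin_digraph Q" and src: "source Q j"
    and r1: "reflection Q j d A d' B" and r2: "reflection Q j e A' e' B'"
    and hom: "matrix_hom (flip j Q) d' B e' B' \<phi>"
  obtains \<psi> where "matrix_hom Q d A e A' \<psi>" "\<And>i. i \<noteq> j \<Longrightarrow> \<psi> i = \<phi> i"
proof -
  from r1 r2 obtain P R P' R' where
    s1: "split_exact Q j d (d' j) A P B R" and s2: "split_exact Q j e (e' j) A' P' B' R'"
    unfolding reflection_def by blast
  have d: "d' i = d i" "e' i = e i" if "i \<noteq> j" for i
    using r1 r2 that unfolding reflection_def by auto
  have same: "B a = A a" "B' a = A' a" if "a \<in> arcs Q" "tail Q a \<noteq> j" for a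
    using r1 r2 that unfolding reflection_def by auto
  have hd: "head Q a \<noteq> j" "head Q a \<in> verts Q" if "a \<in> arcs Q" for a
    using src fin that by (auto simp: source_def fin_digraph_def wf_digraph_def)
  have finO: "finite (out Q j)" using fin by (simp add: fin_digraph.finite_arcs)
  let ?O = "out Q j"
  define \<psi> where "\<psi> = \<phi>(j := \<Sum>a\<in>?O. P' a * \<phi> (head Q a) * A a)"
  have \<phi>: "\<phi> i \<in> homs (e i) (d i)" if "i \<in> verts Q" "i \<noteq> j" for i
    using hom d that unfolding matrix_hom_def by auto
  have com: "B' a * \<phi> (head Q a) = \<phi> j * B a" if "a \<in> ?O" for a
    using hom that src unfolding matrix_hom_def by (auto simp: tail_flip_source head_flip_source)
  have "matrix_hom Q d A e A' \<psi>"
    unfolding matrix_hom_def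
  proof (intro conjI ballI)
    fix i assume i: "i \<in> verts Q"
    show "\<psi> i \<in> homs (e i) (d i)"
    proof (cases "i = j")
      case True
      have "P' a * \<phi> (head Q a) * A a \<in> homs (e j) (d j)" if "a \<in> ?O" for a
        using split_exactD(2)[OF s2 that] split_exactD(1)[OF s1 that] \<phi>[of "head Q a"] hd that
        by (intro homs_mult) auto
      then show ?thesis using True by (auto simp: \<psi>_def intro: homs_sum)
    qed (use \<phi> i in \<open>simp add: \<psi>_def\<close>)
  next
    fix b assume b: "b \<in> arcs Q"
    show "A' b * \<psi> (tail Q b) = \<psi> (head Q b) * A b"
    proof (cases "tail Q b = j")
      case False
      then show ?thesis using hom b hd[OF b] src same[OF b]
        by (auto simp: \<psi>_def matrix_hom_def tail_flip_source head_flip_source)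
    next
      case True
      then have bO: "b \<in> ?O" using b by simp
      have "A' b * \<psi> j = (\<Sum>a\<in>?O. (A' b * P' a) * (\<phi> (head Q a) * A a))"
        by (simp add: \<psi>_def sum_distrib_left mult.assoc)
      also have "\<dots> = (\<Sum>a\<in>?O. (if a = b then \<phi> (head Q b) * A b else 0) - R' b * (\<phi> j * (B a * A a)))"
      proof (rule sum.cong[OF refl])
        fix a assume a: "a \<in> ?O"
        have "A' b * P' a = (if b = a then trunc (e (head Q b)) else 0) - R' b * B' a"
          using split_exactD(8)[OF s2 bO a] by (simp add: eq_diff_eq)
        moreover have "R' b * B' a * (\<phi> (head Q a) * A a) = R' b * (\<phi> j * (B a * A a))"
          by (simp only: mult.assoc mult.assoc[symmetric, of "B' a"] com[OF a])
        moreover have "trunc (e (head Q b)) * (\<phi> (head Q b) * A b) = \<phi> (head Q b) * A b"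
          using \<phi>[of "head Q b"] hd[OF b] by (simp add: homs_left')
        ultimately show "A' b * P' a * (\<phi> (head Q a) * A a) =
            (if a = b then \<phi> (head Q b) * A b else 0) - R' b * (\<phi> j * (B a * A a))"
          by (auto simp: left_diff_distrib)
      qed
      also have "\<dots> = \<phi> (head Q b) * A b - R' b * (\<phi> j * (\<Sum>a\<in>?O. B a * A a))"
        using bO finO by (simp add: sum_subtractf sum_distrib_left)
      also have "\<dots> = \<phi> (head Q b) * A b"
        using s1 by (simp add: split_exact_def)
      finally show ?thesis using True hd[OF b] by (simp add: \<psi>_def)
    qed
  qed
  then show ?thesis using that by (simp add: \<psi>_def)
qed

lemma hom_eq_if_eq_off_source:
  assumes "source Q j" "fin_digraph Q" "reflection Q j d A d' B" "reflection Q j e A' e' B'"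
    and "matrix_hom Q d A e A' \<psi>" "matrix_hom Q d A e A' \<psi>'"
    and "\<And>i. i \<in> verts Q \<Longrightarrow> i \<noteq> j \<Longrightarrow> \<psi> i = \<psi>' i" "i \<in> verts Q"
  shows "\<psi> i = \<psi>' i"
proof (cases "i = j")
  case True
  from assms(3,4) obtain P R P' R' where
    s1: "split_exact Q j d (d' j) A P B R" and s2: "split_exact Q j e (e' j) A' P' B' R'"
    unfolding reflection_def by blast
  have "\<psi> (head Q a) = \<psi>' (head Q a)" if "a \<in> out Q j" for a
    using that assms(1,2,7) by (auto simp: source_def fin_digraph_def wf_digraph_def)
  then show ?thesis unfolding True
      hom_at_source[OF s1 s2 assms(5,1)] hom_at_source[OF s1 s2 assms(6,1)] by simp
qed (use assms in auto)

theorem reflection_reflects_iso: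
  assumes "fin_digraph Q" "source Q j" "matrix_rep Q d A" "matrix_rep Q e A'"
    and "reflection Q j d A d' B" "reflection Q j e A' e' B'"
    and "matrix_iso (flip j Q) d' B e' B'"
  shows "matrix_iso Q d A e A'"
proof -
  from assms(7) obtain \<phi> \<psi> where
    \<phi>: "matrix_hom (flip j Q) d' B e' B' \<phi>" and \<psi>: "matrix_hom (flip j Q) e' B' d' B \<psi>" and
    inv: "\<And>i. i \<in> verts Q \<Longrightarrow> \<psi> i * \<phi> i = trunc (d' i) \<and> \<phi> i * \<psi> i = trunc (e' i)"
    unfolding matrix_iso_def by auto
  obtain \<phi>1 where \<phi>1: "matrix_hom Q d A e A' \<phi>1" "\<And>i. i \<noteq> j \<Longrightarrow> \<phi>1 i = \<phi> i"
    using reflect_hom_back[OF assms(1,2,5,6) \<phi>] by blast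
  obtain \<psi>1 where \<psi>1: "matrix_hom Q e A' d A \<psi>1" "\<And>i. i \<noteq> j \<Longrightarrow> \<psi>1 i = \<psi> i"
    using reflect_hom_back[OF assms(1,2,6,5) \<psi>] by blast
  have d: "d' i = d i" "e' i = e i" if "i \<noteq> j" for i
    using assms(5,6) that unfolding reflection_def by auto
  have "\<psi>1 i * \<phi>1 i = trunc (d i)" if "i \<in> verts Q" for i
    by (rule hom_eq_if_eq_off_source[OF assms(2,1,5,5) matrix_hom_mult[OF \<phi>1(1) \<psi>1(1)]
          matrix_hom_trunc[OF assms(3)] _ that]) (simp add: \<phi>1(2) \<psi>1(2) inv d)
  moreover have "\<phi>1 i * \<psi>1 i = trunc (e i)" if "i \<in> verts Q" for i
    by (rule hom_eq_if_eq_off_source[OF assms(2,1,6,6) matrix_hom_mult[OF \<psi>1(1) \<phi>1(1)]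
          matrix_hom_trunc[OF assms(4)] _ that]) (simp add: \<phi>1(2) \<psi>1(2) inv d)
  ultimately show ?thesis unfolding matrix_iso_def using \<phi>1(1) \<psi>1(1) by blast
qed

text \<open>
  An idempotent of the reflected representation is pulled back to an idempotent of the original one,
  which is \<open>0\<close> or \<open>1\<close>; then so is the given one away from \<open>j\<close>, and hence also at \<open>j\<close>.
\<close>

lemma reflection_indec:
  assumes "fin_digraph Q" "source Q j" "matrix_indec Q d A" "reflection Q j d A d' B"
  shows "matrix_indec (flip j Q) d' B"
proof -
  from assms(4) obtain P R where s: "split_exact Q j d (d' j) A P B R"
    unfolding reflection_def by blast
  have d: "d' i = d i" if "i \<noteq> j" for i
    using assms(4) that unfolding reflection_def by auto
  have rep: "matrix_rep Q d A" using assms(3) by (simp add: matrix_indec_def)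
  have hd: "head Q a \<noteq> j" "head Q a \<in> verts Q" "tail Q a \<in> verts Q" if "a \<in> arcs Q" for a
    using assms(1,2) that by (auto simp: source_def fin_digraph_def wf_digraph_def)
  have "matrix_rep (flip j Q) d' B"
    unfolding matrix_rep_def arcs_flip
  proof
    fix a assume a: "a \<in> arcs Q"
    show "B a \<in> homs (d' (head (flip j Q) a)) (d' (tail (flip j Q) a))"
    proof (cases "tail Q a = j")
      case True
      then show ?thesis using a s hd[OF a] assms(2) d
        by (simp add: split_exact_def tail_flip_source head_flip_source)
    next
      case False
      then have "B a = A a" using a assms(4) by (auto simp: reflection_def)
      then show ?thesis using False a rep hd[OF a] assms(2) d
        by (simp add: matrix_rep_def tail_flip_source head_flip_source)
    qed
  qed
  moreover have "\<exists>i\<in>verts Q. d' i \<noteq> 0"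
  proof (rule ccontr)
    assume "\<not> ?thesis"
    then have 0: "d i = 0" if "i \<in> verts Q" "i \<noteq> j" for i using d that by auto
    have "(\<Sum>a\<in>out Q j. P a * A a) = 0"
    proof (rule sum.neutral, rule ballI)
      fix a assume a: "a \<in> out Q j"
      then have "A a = 0" using rep 0 hd[of a] by (auto simp: matrix_rep_def homs_0_left)
      then show "P a * A a = 0" by simp
    qed
    then have "d j = 0" using s unfolding split_exact_def by (metis trunc_eq_0_iff)
    then show False using 0 assms(3) by (metis matrix_indec_def)
  qed
  moreover have "(\<forall>i\<in>verts Q. \<phi> i = 0) \<or> (\<forall>i\<in>verts Q. \<phi> i = trunc (d' i))"
    if \<phi>: "matrix_hom (flip j Q) d' B d' B \<phi>" and idem: "\<forall>i\<in>verts Q. \<phi> i * \<phi> i = \<phi> i" for \<phi>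
  proof -
    obtain \<psi> where \<psi>: "matrix_hom Q d A d A \<psi>" "\<And>i. i \<noteq> j \<Longrightarrow> \<psi> i = \<phi> i"
      using reflect_hom_back[OF assms(1,2,4,4) \<phi>] by blast
    have "\<psi> i * \<psi> i = \<psi> i" if "i \<in> verts Q" for i
      by (rule hom_eq_if_eq_off_source[OF assms(2,1,4,4) matrix_hom_mult[OF \<psi>(1) \<psi>(1)] \<psi>(1) _ that])
        (simp add: \<psi>(2) idem)
    then have "(\<forall>i\<in>verts Q. \<psi> i = 0) \<or> (\<forall>i\<in>verts Q. \<psi> i = trunc (d i))"
      using assms(3) \<psi>(1) unfolding matrix_indec_def by blast
    then show ?thesis
    proof
      assume 0: "\<forall>i\<in>verts Q. \<psi> i = 0"
      have "\<phi> j = 0"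
        unfolding hom_at_sink[OF s s \<phi> assms(2) refl]
        using 0 hd \<psi>(2) by (intro sum.neutral) (auto simp flip: \<psi>(2))
      then show ?thesis using 0 \<psi>(2) by metis
    next
      assume 1: "\<forall>i\<in>verts Q. \<psi> i = trunc (d i)"
      have "\<phi> j = (\<Sum>a\<in>out Q j. B a * R a)"
        unfolding hom_at_sink[OF s s \<phi> assms(2) refl]
      proof (rule sum.cong[OF refl])
        fix a assume a: "a \<in> out Q j"
        have "\<phi> (head Q a) = trunc (d (head Q a))" using 1 a hd[of a] \<psi>(2) by force
        then show "B a * \<phi> (head Q a) * R a = B a * R a"
          using split_exactD(3)[OF s a] by (simp add: homs_right)
      qed
      also have "\<dots> = trunc (d' j)" using s by (simp add: split_exact_def)
      finally show ?thesis using 1 \<psi>(2) d by metis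
    qed
  qed
  ultimately show ?thesis unfolding matrix_indec_def by simp
qed

text \<open>
  A common kernel vector \<open>x\<close> of the outgoing maps spans a direct summand: the rank one projection to
  \<open>x\<close> at \<open>j\<close>, extended by \<open>0\<close>, is an idempotent endomorphism. If it is the identity, the representation
  is the simple one at \<open>j\<close>.
\<close>

lemma indec_source_injective:
  assumes "fin_digraph Q" "source Q j" "matrix_indec Q d (A :: 'a \<Rightarrow> 'k::field endo)"
    and ne: "\<not> (d j = 1 \<and> (\<forall>i\<in>verts Q. i \<noteq> j \<longrightarrow> d i = 0))"
    and x: "app (trunc (d j)) x = x" "\<And>a. a \<in> out Q j \<Longrightarrow> app (A a) x = (\<lambda>_. 0)"
  shows "x = (\<lambda>_. 0)"
proof (rule ccontr)
  assume "x \<noteq> (\<lambda>_. 0)"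
  then obtain p where p: "x p \<noteq> 0" by (auto simp: fun_eq_iff)
  then have "p < d j" using fun_cong[OF x(1), of p] by (auto split: if_splits)
  \<comment> \<open>The projection to the line of \<open>x\<close> along the coordinates other than \<open>p\<close>.\<close>
  define e where "e = outer (\<lambda>n. x n / x p) p"
  define \<phi> where "\<phi> = (\<lambda>i. if i = j then e else 0)"
  have hd: "head Q a \<noteq> j" "head Q a \<in> verts Q" if "a \<in> arcs Q" for a
    using assms(1,2) that by (auto simp: source_def fin_digraph_def wf_digraph_def)
  have j: "j \<in> verts Q" using assms(2) by (simp add: source_def)
  have e: "e \<in> homs (d j) (d j)"
  proof (rule homsI)
    show "trunc (d j) * e = e" unfolding e_def mult_outer
      using x(1) by (intro arg_cong2[of _ _ _ _ outer] ext) (auto simp: fun_eq_iff split: if_splits)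
    show "e * trunc (d j) = e" unfolding e_def
      using \<open>p < d j\<close> by (intro endo_eqI) auto
  qed
  have "matrix_hom Q d A d A \<phi>"
    unfolding matrix_hom_def
  proof (intro conjI ballI)
    show "\<phi> i \<in> homs (d i) (d i)" for i using e by (auto simp: \<phi>_def)
    fix a assume a: "a \<in> arcs Q"
    show "A a * \<phi> (tail Q a) = \<phi> (head Q a) * A a"
    proof (cases "tail Q a = j")
      case True
      have "(\<lambda>n. x n / x p) = (\<lambda>n. (1 / x p) * x n)" by simp
      then have "app (A a) (\<lambda>n. x n / x p) = (\<lambda>_. 0)"
        using x(2)[of a] True a by (simp only: app_scale) simp
      then have "A a * e = 0" by (auto intro!: endo_eqI simp: e_def mult_outer)
      then show ?thesis using True hd[OF a] by (simp add: \<phi>_def)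
    qed (use hd[OF a] in \<open>simp add: \<phi>_def\<close>)
  qed
  moreover have "e * e = e" using p by (auto intro!: endo_eqI simp: e_def)
  then have "\<forall>i\<in>verts Q. \<phi> i * \<phi> i = \<phi> i" by (simp add: \<phi>_def)
  ultimately have "(\<forall>i\<in>verts Q. \<phi> i = 0) \<or> (\<forall>i\<in>verts Q. \<phi> i = trunc (d i))"
    using assms(3) unfolding matrix_indec_def by blast
  moreover have "e \<noteq> 0"
  proof
    assume "e = 0"
    then have "app e (unit_at p) p = 0" by simp
    then show False using p by (simp add: e_def unit_at_def)
  qed
  ultimately have 1: "\<forall>i\<in>verts Q. \<phi> i = trunc (d i)" using j by (auto simp: \<phi>_def)
  have "d i = 0" if "i \<in> verts Q" "i \<noteq> j" for i
    using 1 that by (auto simp: \<phi>_def simp flip: trunc_eq_0_iff[where 'k = 'k])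
  moreover have "d j = 1"
  proof (rule ccontr)
    assume "d j \<noteq> 1"
    define q where "q = (if p = 0 then 1 else 0::nat)"
    have "q < d j" "q \<noteq> p" using \<open>p < d j\<close> \<open>d j \<noteq> 1\<close> by (auto simp: q_def)
    have "e = trunc (d j)" using 1 j by (auto simp: \<phi>_def)
    then have "app e (unit_at q) q = app (trunc (d j)) (unit_at q) q" by simp
    then show False using \<open>q < d j\<close> \<open>q \<noteq> p\<close> by (simp add: e_def unit_at_def)
  qed
  ultimately show False using ne by blast
qed

theorem reflection_exists:
  assumes "fin_digraph Q" "source Q j" "matrix_indec Q d (A :: 'a \<Rightarrow> 'k::field endo)"
    and ne: "\<not> (d j = 1 \<and> (\<forall>i\<in>verts Q. i \<noteq> j \<longrightarrow> d i = 0))"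
  obtains m B where "d j + m = (\<Sum>a\<in>out Q j. d (head Q a))" "reflection Q j d A (d(j := m)) B"
proof -
  let ?O = "out Q j"
  let ?N = "\<Sum>a\<in>?O. d (head Q a)"
  have finO: "finite ?O" using assms(1) by (simp add: fin_digraph.finite_arcs)
  have rep: "A a \<in> homs (d (head Q a)) (d j)" if "a \<in> ?O" for a
    using assms(3) that by (auto simp: matrix_indec_def matrix_rep_def)
  obtain \<iota> \<pi> :: "'a \<Rightarrow> 'k endo" where
    \<iota>: "\<And>a. a \<in> ?O \<Longrightarrow> \<iota> a \<in> homs ?N (d (head Q a))" and
    \<pi>: "\<And>a. a \<in> ?O \<Longrightarrow> \<pi> a \<in> homs (d (head Q a)) ?N" and
    orth: "\<And>a b. a \<in> ?O \<Longrightarrow> b \<in> ?O \<Longrightarrow> \<pi> a * \<iota> b = (if a = b then trunc (d (head Q a)) else 0)" and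
    sum: "(\<Sum>a\<in>?O. \<iota> a * \<pi> a) = trunc ?N"
    using coproduct_exists[OF finO, of "\<lambda>a. d (head Q a)"] by blast
  define F where "F = (\<Sum>a\<in>?O. \<iota> a * A a)"
  have F: "F \<in> homs ?N (d j)"
    unfolding F_def using \<iota> rep by (blast intro: homs_sum homs_mult)
  have \<pi>F: "\<pi> a * F = A a" if a: "a \<in> ?O" for a
  proof -
    have "\<pi> a * F = (\<Sum>b\<in>?O. (\<pi> a * \<iota> b) * A b)" by (simp add: F_def sum_distrib_left mult.assoc)
    also have "\<dots> = (\<Sum>b\<in>?O. if b = a then A a else 0)"
      by (rule sum.cong) (use orth[OF a] homs_left[OF rep[OF a]] in auto)
    finally show ?thesis using a finO by simp
  qed
  have "app (trunc (d j)) x = (\<lambda>_. 0)" if "app F x = (\<lambda>_. 0)" for x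
  proof (rule indec_source_injective[OF assms])
    fix a assume a: "a \<in> ?O"
    have "app (A a) (app (trunc (d j)) x) = app (A a) x"
      using rep[OF a] by (simp add: homs_app_trunc)
    also have "\<dots> = app (\<pi> a) (app F x)" using \<pi>F[OF a] by (metis app_times_endo)
    finally show "app (A a) (app (trunc (d j)) x) = (\<lambda>_. 0)" by (simp add: that)
  qed auto
  from injective_split[OF F this] obtain m P B R where
    N: "?N = d j + m" and P: "P \<in> homs (d j) ?N" and B: "B \<in> homs m ?N" and R: "R \<in> homs ?N m" and
    eqs: "P * F = trunc (d j)" "B * F = 0" "B * R = trunc m" "F * P + R * B = trunc ?N"
    by blast
  define B' where "B' a = (if a \<in> ?O then B * \<iota> a else A a)" for a
  have "split_exact Q j d m A (\<lambda>a. P * \<iota> a) B' (\<lambda>a. \<pi> a * R)"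
    unfolding split_exact_def
  proof (intro conjI ballI)
    fix a assume a: "a \<in> ?O"
    show "A a \<in> homs (d (head Q a)) (d j)" by (rule rep[OF a])
    show "P * \<iota> a \<in> homs (d j) (d (head Q a))" using P \<iota>[OF a] by (rule homs_mult)
    show "B' a \<in> homs m (d (head Q a))" using homs_mult[OF B \<iota>[OF a]] a by (simp add: B'_def)
    show "\<pi> a * R \<in> homs (d (head Q a)) m" using \<pi>[OF a] R by (rule homs_mult)
    fix b assume b: "b \<in> ?O"
    have "A a * (P * \<iota> b) + \<pi> a * R * B' b = \<pi> a * (F * P + R * B) * \<iota> b"
      using b by (simp add: B'_def \<pi>F[OF a, symmetric] distrib_left distrib_right mult.assoc)
    also have "\<dots> = \<pi> a * \<iota> b" using \<pi>[OF a] by (simp add: eqs homs_right)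
    finally show "A a * (P * \<iota> b) + \<pi> a * R * B' b = (if a = b then trunc (d (head Q a)) else 0)"
      using orth[OF a b] by simp
  next
    have "(\<Sum>a\<in>?O. P * \<iota> a * A a) = P * F" by (simp add: F_def sum_distrib_left mult.assoc)
    then show "(\<Sum>a\<in>?O. P * \<iota> a * A a) = trunc (d j)" by (simp add: eqs)
    have "(\<Sum>a\<in>?O. B' a * (\<pi> a * R)) = B * (\<Sum>a\<in>?O. \<iota> a * \<pi> a) * R"
      by (simp add: B'_def sum_distrib_left sum_distrib_right mult.assoc)
    also have "\<dots> = trunc m" unfolding sum using B by (simp add: homs_right eqs)
    finally show "(\<Sum>a\<in>?O. B' a * (\<pi> a * R)) = trunc m" .
    have "(\<Sum>a\<in>?O. B' a * A a) = B * F"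
      by (simp add: B'_def F_def sum_distrib_left mult.assoc)
    then show "(\<Sum>a\<in>?O. B' a * A a) = 0" by (simp add: eqs)
  qed
  then have "reflection Q j d A (d(j := m)) B'"
    unfolding reflection_def by (auto simp: B'_def)
  then show ?thesis using that N by simp
qed

section \<open>Dimension vectors and the Tits form\<close>

definition neighbour_sum :: "('v, 'a) pre_digraph \<Rightarrow> 'v \<Rightarrow> ('v \<Rightarrow> int) \<Rightarrow> int" where
  "neighbour_sum Q j x = (\<Sum>a\<in>arcs Q.
     (if tail Q a = j then x (head Q a) else 0) + (if head Q a = j then x (tail Q a) else 0))"

text \<open>
  The simple reflection \<open>s\<^sub>j\<close>. The neighbours are counted with both orientations, so it depends on
  the underlying graph only.
\<close>

definition reflect :: "('v, 'a) pre_digraph \<Rightarrow> 'v \<Rightarrow> ('v \<Rightarrow> int) \<Rightarrow> 'v \<Rightarrow> int" where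
  "reflect Q j x = x(j := neighbour_sum Q j x - x j)"

text \<open>
  The symmetric bilinear form with \<open>bilin Q x x = 2 * tits_form Q x\<close>.
\<close>

definition bilin :: "('v, 'a) pre_digraph \<Rightarrow> ('v \<Rightarrow> int) \<Rightarrow> ('v \<Rightarrow> int) \<Rightarrow> int" where
  "bilin Q x y = (\<Sum>i\<in>verts Q. 2 * (x i * y i)) -
     (\<Sum>a\<in>arcs Q. x (tail Q a) * y (head Q a) + x (head Q a) * y (tail Q a))"

definition tits_form :: "('v, 'a) pre_digraph \<Rightarrow> ('v \<Rightarrow> int) \<Rightarrow> int" where
  "tits_form Q x = (\<Sum>i\<in>verts Q. x i * x i) - (\<Sum>a\<in>arcs Q. x (tail Q a) * x (head Q a))"

definition unit_vec_at :: "'v \<Rightarrow> 'v \<Rightarrow> int" where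
  "unit_vec_at j i = (if i = j then 1 else 0)"

definition loopless :: "('v, 'a) pre_digraph \<Rightarrow> bool" where
  "loopless Q \<longleftrightarrow> (\<forall>a\<in>arcs Q. tail Q a \<noteq> head Q a)"

definition pos_def :: "('v, 'a) pre_digraph \<Rightarrow> bool" where
  "pos_def Q \<longleftrightarrow> (\<forall>x. (\<exists>i\<in>verts Q. x i \<noteq> 0) \<longrightarrow> tits_form Q x > 0)"

lemma neighbour_sum_flip [simp]: "neighbour_sum (flip i Q) j x = neighbour_sum Q j x"
  unfolding neighbour_sum_def arcs_flip by (rule sum.cong) (auto simp: flip_def)

lemma reflect_flip [simp]: "reflect (flip i Q) = reflect Q"
  by (simp add: reflect_def fun_eq_iff)

lemma loopless_flip [simp]: "loopless (flip i Q) = loopless Q"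
  unfolding loopless_def arcs_flip by (rule ball_cong) (simp_all add: flip_def eq_commute)

lemma tits_form_flip [simp]: "tits_form (flip i Q) x = tits_form Q x"
  unfolding tits_form_def arcs_flip verts_flip
  by (intro arg_cong2[of _ _ _ _ minus] refl sum.cong) (auto simp: flip_def mult.commute)

lemma tits_form_add: "tits_form Q (\<lambda>i. x i + y i) = tits_form Q x + tits_form Q y + bilin Q x y"
  unfolding tits_form_def bilin_def
  by (simp add: algebra_simps sum.distrib sum_subtractf sum_distrib_left)

lemma tits_form_diff: "tits_form Q (\<lambda>i. x i - y i) = tits_form Q x + tits_form Q y - bilin Q x y"
  unfolding tits_form_def bilin_def
  by (simp add: algebra_simps sum.distrib sum_subtractf sum_distrib_left)

lemma tits_form_scale: "tits_form Q (\<lambda>i. c * x i) = c\<^sup>2 * tits_form Q x"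
  unfolding tits_form_def
  by (simp add: algebra_simps power2_eq_square sum_distrib_left right_diff_distrib)

lemma bilin_scale_right: "bilin Q x (\<lambda>i. c * y i) = c * bilin Q x y"
  unfolding bilin_def by (simp add: algebra_simps sum_distrib_left right_diff_distrib sum.distrib)

lemma tits_form_cong:
  assumes "fin_digraph Q" "\<And>i. i \<in> verts Q \<Longrightarrow> x i = y i"
  shows "tits_form Q x = tits_form Q y"
  using assms unfolding tits_form_def fin_digraph_def wf_digraph_def by simp

lemma tits_form_unit:
  assumes "fin_digraph Q" "j \<in> verts Q" "\<forall>a\<in>arcs Q. \<not> (tail Q a = j \<and> head Q a = j)"
  shows "tits_form Q (unit_vec_at j) = 1"
proof -
  have "(\<Sum>a\<in>arcs Q. unit_vec_at j (tail Q a) * unit_vec_at j (head Q a)) = 0"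
    using assms(3) by (intro sum.neutral) (auto simp: unit_vec_at_def)
  then show ?thesis
    using assms by (simp add: tits_form_def unit_vec_at_def fin_digraph.finite_verts if_distrib
        cong: if_cong)
qed

lemma bilin_unit:
  assumes "fin_digraph Q" "j \<in> verts Q"
  shows "bilin Q x (unit_vec_at j) = 2 * x j - neighbour_sum Q j x"
proof -
  have "(\<Sum>i\<in>verts Q. 2 * (x i * unit_vec_at j i)) = (\<Sum>i\<in>verts Q. if i = j then 2 * x j else 0)"
    by (rule sum.cong) (auto simp: unit_vec_at_def)
  also have "\<dots> = 2 * x j" using assms by (simp add: fin_digraph.finite_verts)
  moreover have "(\<Sum>a\<in>arcs Q. x (tail Q a) * unit_vec_at j (head Q a) + x (head Q a) * unit_vec_at j (tail Q a))
     = neighbour_sum Q j x"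
    unfolding neighbour_sum_def by (rule sum.cong) (auto simp: unit_vec_at_def)
  ultimately show ?thesis by (simp add: bilin_def)
qed

lemma tits_form_reflect:
  assumes "fin_digraph Q" "loopless Q" "j \<in> verts Q"
  shows "tits_form Q (reflect Q j x) = tits_form Q x"
proof -
  define c where "c = neighbour_sum Q j x - 2 * x j"
  have "reflect Q j x = (\<lambda>i. x i + c * unit_vec_at j i)"
    by (auto simp: reflect_def c_def unit_vec_at_def)
  moreover have "tits_form Q (unit_vec_at j) = 1"
    using assms by (intro tits_form_unit) (auto simp: loopless_def)
  ultimately have "tits_form Q (reflect Q j x) = tits_form Q x + c\<^sup>2 + c * (2 * x j - neighbour_sum Q j x)"
    by (simp add: tits_form_add tits_form_scale bilin_scale_right bilin_unit[OF assms(1,3)])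
  then show ?thesis by (simp add: c_def power2_eq_square algebra_simps)
qed

lemma neighbour_sum_upd:
  assumes "loopless Q"
  shows "neighbour_sum Q j (x(j := c)) = neighbour_sum Q j x"
  unfolding neighbour_sum_def using assms by (intro sum.cong) (auto simp: loopless_def)

lemma reflect_reflect [simp]: "loopless Q \<Longrightarrow> reflect Q j (reflect Q j x) = x"
  by (simp add: reflect_def neighbour_sum_upd)

lemma neighbour_sum_add:
  "neighbour_sum Q j (\<lambda>i. x i + y i) = neighbour_sum Q j x + neighbour_sum Q j y"
  unfolding neighbour_sum_def sum.distrib[symmetric] by (rule sum.cong) auto

lemma reflect_add: "reflect Q j (\<lambda>i. x i + y i) = (\<lambda>i. reflect Q j x i + reflect Q j y i)"
  by (auto simp: reflect_def neighbour_sum_add)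

lemma reflect_zero: "reflect Q j (\<lambda>_. 0) = (\<lambda>_. 0)"
  by (auto simp: reflect_def neighbour_sum_def)

text \<open>
  A common fixed vector of the simple reflections is orthogonal to all unit vectors, hence to
  itself.
\<close>

lemma fixed_imp_tits_form_0:
  assumes "fin_digraph Q" "\<And>j. j \<in> verts Q \<Longrightarrow> reflect Q j s = s"
  shows "tits_form Q s = 0"
proof -
  have n: "neighbour_sum Q j s = 2 * s j" if "j \<in> verts Q" for j
    using fun_cong[OF assms(2)[OF that], of j] by (simp add: reflect_def)
  have wf: "finite (verts Q)" "\<And>a. a \<in> arcs Q \<Longrightarrow> tail Q a \<in> verts Q \<and> head Q a \<in> verts Q"
    using assms(1) by (auto simp: fin_digraph_def fin_digraph_axioms_def wf_digraph_def)
  have "(\<Sum>j\<in>verts Q. 2 * (s j * s j)) = (\<Sum>j\<in>verts Q. s j * neighbour_sum Q j s)"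
    by (rule sum.cong) (auto simp: n)
  also have "\<dots> = (\<Sum>a\<in>arcs Q. \<Sum>j\<in>verts Q. (if tail Q a = j then s j * s (head Q a) else 0) +
       (if head Q a = j then s j * s (tail Q a) else 0))"
    unfolding neighbour_sum_def sum_distrib_left
    by (subst sum.swap) (intro sum.cong, auto)
  also have "\<dots> = (\<Sum>a\<in>arcs Q. 2 * (s (tail Q a) * s (head Q a)))"
    using wf by (intro sum.cong) (auto simp: sum.distrib)
  finally show ?thesis by (simp add: tits_form_def flip: sum_distrib_left)
qed

text \<open>
  Reduce modulo \<open>N = 4 * \<bar>m\<bar> + 1\<close>. Two different vectors \<open>x\<close>, \<open>y\<close> of level \<open>m\<close> with the same
  residues differ by \<open>N\<close> times a non-zero integral vector, so the form is at least \<open>N\<^sup>2\<close> on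
  \<open>x - y\<close>; the parallelogram law bounds it by \<open>4 * m\<close>. So the level set embeds into the finite set
  of residues.
\<close>

lemma finite_tits_form_level:
  assumes "fin_digraph Q" "pos_def Q"
  shows "finite {x. (\<forall>i. i \<notin> verts Q \<longrightarrow> x i = 0) \<and> tits_form Q x = m}" (is "finite ?L")
proof -
  define N where "N = 4 * \<bar>m\<bar> + 1"
  have "N > 0" by (simp add: N_def)
  \<comment> \<open>The restriction makes residue vectors members of a finite set of functions.\<close>
  let ?r = "\<lambda>x. \<lambda>i\<in>verts Q. x i mod N"
  have nonneg: "tits_form Q x \<ge> 0" for x
  proof (cases "\<exists>i\<in>verts Q. x i \<noteq> 0")
    case False
    then have "tits_form Q x = tits_form Q (\<lambda>_. 0)" by (intro tits_form_cong assms) auto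
    then show ?thesis by (simp add: tits_form_def)
  qed (use assms(2) in \<open>auto simp: pos_def_def intro: less_imp_le\<close>)
  have "inj_on ?r ?L"
  proof (rule inj_onI, rule ccontr)
    fix x y assume x: "x \<in> ?L" and y: "y \<in> ?L" and r: "?r x = ?r y" and ne: "x \<noteq> y"
    define z where "z i = (x i - y i) div N" for i
    have z: "x i - y i = N * z i" for i
    proof (cases "i \<in> verts Q")
      case True
      then have "x i mod N = y i mod N" using fun_cong[OF r, of i] by simp
      then show ?thesis unfolding z_def by (simp add: mod_eq_dvd_iff)
    qed (use x y in \<open>auto simp: z_def\<close>)
    obtain i where i: "x i \<noteq> y i" using ne by auto
    then have "i \<in> verts Q" using x y by (metis (mono_tags, lifting) mem_Collect_eq)
    moreover have "z i \<noteq> 0" using z[of i] i by auto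
    ultimately have "tits_form Q z \<ge> 1" using assms(2) by (fastforce simp: pos_def_def)
    then have "N\<^sup>2 \<le> N\<^sup>2 * tits_form Q z" using mult_left_mono[of 1 "tits_form Q z" "N\<^sup>2"] by simp
    also have "\<dots> = tits_form Q (\<lambda>i. x i - y i)"
      unfolding z by (simp add: tits_form_scale)
    also have "\<dots> \<le> tits_form Q (\<lambda>i. x i - y i) + tits_form Q (\<lambda>i. x i + y i)" using nonneg by simp
    also have "\<dots> = 4 * m" using x y by (simp add: tits_form_add tits_form_diff)
    also have "\<dots> < N" by (simp add: N_def)
    also have "\<dots> \<le> N\<^sup>2" using \<open>N > 0\<close> by (simp add: power2_eq_square)
    finally show False by simp
  qed
  moreover have "?r ` ?L \<subseteq> (\<Pi>\<^sub>E i\<in>verts Q. {0..<N})"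
    using \<open>N > 0\<close> by auto
  then have "finite (?r ` ?L)"
    by (rule finite_subset) (use assms(1) in \<open>auto intro: finite_PiE simp: fin_digraph.finite_verts\<close>)
  ultimately show ?thesis using finite_imageD by blast
qed

section \<open>Sequences of reflections at sources\<close>

fun admissible :: "('v, 'a) pre_digraph \<Rightarrow> 'v list \<Rightarrow> bool" where
  "admissible Q [] = True"
| "admissible Q (j # js) = (source Q j \<and> admissible (flip j Q) js)"

lemma admissible_append: "admissible Q (us @ vs) \<longleftrightarrow> admissible Q us \<and> admissible (fold flip us Q) vs"
  by (induction us arbitrary: Q) auto

definition topological_order :: "('v, 'a) pre_digraph \<Rightarrow> 'v list \<Rightarrow> bool" where
  "topological_order Q vs \<longleftrightarrow> distinct vs \<and> set vs = verts Q \<and> loopless Q \<and>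
     sorted_wrt (\<lambda>u v. \<not> (\<exists>a\<in>arcs Q. tail Q a = v \<and> head Q a = u)) vs"

text \<open>
  The result of flipping at all vertices of \<open>U\<close>: arrows inside \<open>U\<close> are reversed twice.
\<close>

definition flip_set :: "'v set \<Rightarrow> ('v, 'a) pre_digraph \<Rightarrow> ('v, 'a) pre_digraph" where
  "flip_set U Q = Q\<lparr>
     tail := (\<lambda>a. if a \<in> arcs Q \<and> (tail Q a \<in> U) \<noteq> (head Q a \<in> U) then head Q a else tail Q a),
     head := (\<lambda>a. if a \<in> arcs Q \<and> (tail Q a \<in> U) \<noteq> (head Q a \<in> U) then tail Q a else head Q a)\<rparr>"

lemma flip_flip_set: "j \<notin> U \<Longrightarrow> flip j (flip_set U Q) = flip_set (insert j U) Q"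
  by (rule pre_digraph.equality) (auto simp: flip_def flip_set_def fun_eq_iff)

lemma fold_flip: "distinct vs \<Longrightarrow> set vs \<inter> U = {} \<Longrightarrow>
    fold flip vs (flip_set U Q) = flip_set (U \<union> set vs) Q"
  by (induction vs arbitrary: U) (auto simp: flip_flip_set)

lemma fold_flip_topological_order:
  assumes "fin_digraph Q" "topological_order Q vs"
  shows "fold flip vs Q = Q"
proof -
  have "flip_set {} Q = Q" by (rule pre_digraph.equality) (auto simp: flip_set_def)
  moreover have "flip_set (verts Q) Q = Q"
    using assms(1) by (intro pre_digraph.equality)
      (auto simp: flip_set_def fun_eq_iff fin_digraph_def wf_digraph_def)
  ultimately show ?thesis
    using fold_flip[of vs "{}" Q] assms(2) by (simp add: topological_order_def)
qed

text \<open>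
  When \<open>j\<close> is reached, the arrows from earlier vertices to \<open>j\<close> have been reversed once and those from
  \<open>j\<close> to later vertices not at all, so all of them leave \<open>j\<close>.
\<close>

lemma admissible_topological_order:
  assumes "fin_digraph Q" "topological_order Q vs"
  shows "admissible Q vs"
proof -
  note wf = arc_ends[OF assms(1)]
  have "admissible (flip_set (set us) Q) ws" if "us @ ws = vs" for us ws
    using that
  proof (induction ws arbitrary: us)
    case (Cons j ws)
    have vs: "distinct (us @ j # ws)" "set (us @ j # ws) = verts Q" "loopless Q"
      "sorted_wrt (\<lambda>u v. \<not> (\<exists>a\<in>arcs Q. tail Q a = v \<and> head Q a = u)) (us @ j # ws)"
      using assms(2) Cons.prems by (auto simp: topological_order_def)
    have "source (flip_set (set us) Q) j"
      unfolding source_def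
    proof (intro conjI ballI)
      show "j \<in> verts (flip_set (set us) Q)" using vs by (auto simp: flip_set_def)
      fix a assume "a \<in> arcs (flip_set (set us) Q)"
      then have a: "a \<in> arcs Q" by (simp add: flip_set_def)
      have "head Q a \<notin> set us" if "tail Q a = j"
        using vs(4) a that by (auto simp: sorted_wrt_append)
      moreover have "tail Q a \<in> set us" if "head Q a = j"
      proof -
        have "tail Q a \<noteq> j" using vs(3) a that by (auto simp: loopless_def)
        moreover have "tail Q a \<notin> set ws" using vs(4) a that by (auto simp: sorted_wrt_append)
        ultimately show ?thesis using wf[OF a] vs(2) by auto
      qed
      ultimately show "head (flip_set (set us) Q) a \<noteq> j"
        using vs(1,3) a by (auto simp: flip_set_def loopless_def)
    qed
    moreover have "admissible (flip j (flip_set (set us) Q)) ws"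
      using Cons.IH[of "us @ [j]"] Cons.prems flip_flip_set[of j "set us" Q] vs(1) by auto
    ultimately show ?case by simp
  qed simp
  from this[of "[]"] have "admissible (flip_set {} Q) vs" by simp
  moreover have "flip_set {} Q = Q" by (rule pre_digraph.equality) (auto simp: flip_set_def)
  ultimately show ?thesis by simp
qed

lemma admissible_power:
  assumes "fin_digraph Q" "topological_order Q vs"
  shows "admissible Q (concat (replicate t vs)) \<and> fold flip (concat (replicate t vs)) Q = Q"
  using assms by (induction t)
    (simp_all add: admissible_append fold_flip_topological_order admissible_topological_order)

lemma fold_concat_replicate: "fold f (concat (replicate t vs)) = (fold f vs ^^ t)"
proof (induction t)
  case (Suc t)
  show ?case by (simp only: replicate_Suc concat.simps fold_append Suc funpow_Suc_right)
qed simp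

section \<open>The Coxeter transformation of a positive definite form\<close>

lemma fold_reflect_tits_form:
  assumes "fin_digraph Q" "loopless Q" "set js \<subseteq> verts Q"
  shows "tits_form Q (fold (reflect Q) js x) = tits_form Q x"
  using assms by (induction js arbitrary: x) (auto simp: tits_form_reflect)

lemma fold_reflect_off: "i \<notin> set js \<Longrightarrow> fold (reflect Q) js x i = x i"
  by (induction js arbitrary: x) (auto simp: reflect_def)

lemma fold_reflect_inj: "loopless Q \<Longrightarrow> fold (reflect Q) js x = fold (reflect Q) js y \<Longrightarrow> x = y"
proof (induction js arbitrary: x y)
  case (Cons j js)
  then have "reflect Q j x = reflect Q j y" by simp
  then show ?case using Cons.prems(1) by (metis reflect_reflect)
qed simp

lemma fold_reflect_add:
  "fold (reflect Q) js (\<lambda>i. x i + y i) = (\<lambda>i. fold (reflect Q) js x i + fold (reflect Q) js y i)"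
  by (induction js arbitrary: x y) (simp_all add: reflect_add)

lemma fold_reflect_sum:
  "fold (reflect Q) js (\<lambda>i. \<Sum>t<n. x t i) = (\<lambda>i. \<Sum>t<n::nat. fold (reflect Q) js (x t) i)"
proof (induction n)
  case 0
  then show ?case by (induction js) (simp_all add: reflect_zero)
qed (simp add: fold_reflect_add)

text \<open>
  Each reflection changes one coordinate, and different reflections change different coordinates. So
  nothing can cancel.
\<close>

lemma fold_reflect_fixed:
  assumes "distinct js" "fold (reflect Q) js s = s" "j \<in> set js"
  shows "reflect Q j s = s"
  using assms
proof (induction js)
  case (Cons k js)
  have "reflect Q k s k = s k"
    using Cons.prems fold_reflect_off[of k js Q "reflect Q k s"] by simp
  then have "reflect Q k s = s" by (auto simp: reflect_def)
  then show ?case using Cons by auto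
qed simp

lemma funpow_inj_cancel:
  assumes "inj f" "(f ^^ s) x = (f ^^ t) x" "s < t"
  shows "(f ^^ (t - s)) x = x"
proof -
  have "(f ^^ s) ((f ^^ (t - s)) x) = (f ^^ s) x"
    using assms(2,3) by (metis funpow_add le_add_diff_inverse less_imp_le o_apply)
  then show ?thesis using inj_fn[OF assms(1), of s] by (simp add: inj_eq)
qed

text \<open>
  The orbit of \<open>x\<close> under the Coxeter transformation lies in a level set of the form, so it is finite
  and, by injectivity, periodic. The sum over a period is fixed by every simple reflection and
  therefore \<open>0\<close>. As \<open>x\<close> itself contributes something positive, some other member of the orbit
  has a negative coordinate.
\<close>

lemma coxeter_leaves_positive_cone:
  assumes Q: "fin_digraph Q" "topological_order Q vs" "pos_def Q"
    and x: "\<And>i. i \<notin> verts Q \<Longrightarrow> x i = 0" "\<exists>i\<in>verts Q. x i > 0"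
  shows "\<exists>t. \<exists>i\<in>verts Q. fold (reflect Q) (concat (replicate t vs)) x i < 0"
proof (rule ccontr)
  assume neg: "\<not> ?thesis"
  let ?c = "fold (reflect Q) vs"
  have vs: "distinct vs" "set vs = verts Q" "loopless Q"
    using Q(2) by (auto simp: topological_order_def)
  have inj: "inj ?c" using fold_reflect_inj[OF vs(3)] by (meson injI)
  have nonneg: "(?c ^^ t) x i \<ge> 0" if "i \<in> verts Q" for t i
    using neg that unfolding fold_concat_replicate by (meson not_le)
  let ?L = "{y. (\<forall>i. i \<notin> verts Q \<longrightarrow> y i = 0) \<and> tits_form Q y = tits_form Q x}"
  have step: "?c y \<in> ?L" if "y \<in> ?L" for y
    using that fold_reflect_tits_form[OF Q(1) vs(3), of vs] vs(2) by (auto simp: fold_reflect_off)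
  have "(?c ^^ t) x \<in> ?L" for t
    by (induction t) (use x(1) step in auto)
  then have "finite (range (\<lambda>t. (?c ^^ t) x))"
    using finite_tits_form_level[OF Q(1,3)] by (meson finite_subset image_subsetI)
  then obtain s t where st: "s < t" "(?c ^^ s) x = (?c ^^ t) x"
    using range_inj_infinite by (metis (mono_tags, lifting) injI linorder_neqE_nat)
  define h where "h = t - s"
  have h: "(?c ^^ h) x = x" "h > 0"
    using funpow_inj_cancel[OF inj st(2,1)] st(1) by (auto simp: h_def)
  \<comment> \<open>The sum over one period.\<close>
  define S where "S = (\<lambda>i. \<Sum>t<h. (?c ^^ t) x i)"
  have "?c S = (\<lambda>i. \<Sum>t<h. (?c ^^ Suc t) x i)"
    unfolding S_def by (simp add: fold_reflect_sum)
  also have "\<dots> = S"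
  proof
    fix i
    have "(\<Sum>t<h. (?c ^^ Suc t) x i) + (?c ^^ 0) x i = (\<Sum>t<Suc h. (?c ^^ t) x i)"
      by (subst sum.lessThan_Suc_shift) simp
    then show "(\<Sum>t<h. (?c ^^ Suc t) x i) = S i" by (simp add: S_def h)
  qed
  finally have "reflect Q j S = S" if "j \<in> verts Q" for j
    using fold_reflect_fixed[OF vs(1)] vs(2) that by blast
  then have "tits_form Q S = 0" by (rule fixed_imp_tits_form_0[OF Q(1)])
  then have S0: "S i = 0" if "i \<in> verts Q" for i
    using Q(3) that by (force simp: pos_def_def)
  obtain i where i: "i \<in> verts Q" "x i > 0" using x(2) by blast
  have "x i = (?c ^^ 0) x i" by simp
  also have "\<dots> \<le> S i"
    unfolding S_def by (rule member_le_sum) (use h(2) nonneg i(1) in auto)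
  finally show False using S0[OF i(1)] i(2) by simp
qed

section \<open>Indecomposables of a quiver with positive definite form\<close>

lemma neighbour_sum_source:
  assumes "fin_digraph Q" "source Q j"
  shows "neighbour_sum Q j x = (\<Sum>a\<in>out Q j. x (head Q a))"
proof -
  have "neighbour_sum Q j x = (\<Sum>a\<in>arcs Q. if tail Q a = j then x (head Q a) else 0)"
    unfolding neighbour_sum_def using assms(2) by (intro sum.cong) (auto simp: source_def)
  then show ?thesis using assms(1) by (simp add: sum.inter_filter fin_digraph.finite_arcs)
qed

lemma reflection_exists':
  assumes "fin_digraph Q" "source Q j" "matrix_indec Q d (A :: 'a \<Rightarrow> 'k::field endo)"
    and "\<not> (d j = 1 \<and> (\<forall>i\<in>verts Q. i \<noteq> j \<longrightarrow> d i = 0))"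
  obtains d' B where "(\<lambda>i. int (d' i)) = reflect Q j (\<lambda>i. int (d i))" "reflection Q j d A d' B"
    "matrix_indec (flip j Q) d' B"
proof -
  obtain m B where m: "d j + m = (\<Sum>a\<in>out Q j. d (head Q a))" and r: "reflection Q j d A (d(j := m)) B"
    using reflection_exists[OF assms] by blast
  have "int m = (\<Sum>a\<in>out Q j. int (d (head Q a))) - int (d j)"
    using arg_cong[OF m, of int] by simp
  then have "(\<lambda>i. int ((d(j := m)) i)) = reflect Q j (\<lambda>i. int (d i))"
    by (auto simp: reflect_def neighbour_sum_source[OF assms(1,2)])
  then show ?thesis using that r reflection_indec[OF assms(1-3) r] by blast
qed

lemma simple_at_source_unique:
  assumes "fin_digraph Q" "source Q j" "matrix_rep Q d A" "matrix_rep Q d A'"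
    and "\<forall>i\<in>verts Q. i \<noteq> j \<longrightarrow> d i = 0"
  shows "matrix_iso Q d A d A'"
proof -
  have 0: "A a = 0 \<and> A' a = 0" if "a \<in> arcs Q" for a
  proof -
    have "d (head Q a) = 0"
      using assms(1,2,5) that by (auto simp: source_def fin_digraph_def wf_digraph_def)
    then show ?thesis using assms(3,4) that by (auto simp: matrix_rep_def homs_0_left)
  qed
  have "matrix_hom Q d A d A' (\<lambda>i. trunc (d i))" "matrix_hom Q d A' d A (\<lambda>i. trunc (d i))"
    using 0 by (auto simp: matrix_hom_def)
  then show ?thesis unfolding matrix_iso_def by fastforce
qed

text \<open>
  Reflect along the list. As long as no simple at the current source is met, the reflections exist
  and all dimension vectors stay non-negative, contrary to the hypothesis. So a simple is met, and
  both claims hold for it and travel back along the reflections.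
\<close>

lemma indec_of_negative_reflection:
  assumes "fin_digraph Q" "loopless Q" "admissible Q js" "matrix_indec Q d (A :: 'a \<Rightarrow> 'k::field endo)"
    and "\<exists>i\<in>verts Q. fold (reflect Q) js (\<lambda>i. int (d i)) i < 0"
  shows "tits_form Q (\<lambda>i. int (d i)) = 1 \<and> (\<forall>A'. matrix_indec Q d A' \<longrightarrow> matrix_iso Q d A d A')"
  using assms
proof (induction js arbitrary: Q d A)
  case (Cons j js)
  have src: "source Q j" and adm: "admissible (flip j Q) js" using Cons.prems by auto
  then have j: "j \<in> verts Q" by (simp add: source_def)
  have rep: "matrix_indec Q d A' \<Longrightarrow> matrix_rep Q d A'" for A' :: "'a \<Rightarrow> 'k endo"
    by (simp add: matrix_indec_def)
  show ?case
  proof (cases "d j = 1 \<and> (\<forall>i\<in>verts Q. i \<noteq> j \<longrightarrow> d i = 0)")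
    case True
    then have "tits_form Q (\<lambda>i. int (d i)) = tits_form Q (unit_vec_at j)"
      by (intro tits_form_cong[OF Cons.prems(1)]) (auto simp: unit_vec_at_def)
    also have "\<dots> = 1"
      using Cons.prems(1,2) j by (intro tits_form_unit) (auto simp: loopless_def)
    finally show ?thesis
      using simple_at_source_unique[OF Cons.prems(1) src rep[OF Cons.prems(4)] rep] True by blast
  next
    case False
    obtain d' B where d': "(\<lambda>i. int (d' i)) = reflect Q j (\<lambda>i. int (d i))" and
      r: "reflection Q j d A d' B" and indec: "matrix_indec (flip j Q) d' B"
      using reflection_exists'[OF Cons.prems(1) src Cons.prems(4) False] by blast
    have IH: "tits_form (flip j Q) (\<lambda>i. int (d' i)) = 1"
      "\<And>B'. matrix_indec (flip j Q) d' B' \<Longrightarrow> matrix_iso (flip j Q) d' B d' B'"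
      using Cons.IH[OF fin_digraph_flip[OF Cons.prems(1)] _ adm indec] Cons.prems(2,5)
      by (auto simp: d')
    have "matrix_iso Q d A d A'" if A': "matrix_indec Q d A'" for A'
    proof -
      obtain d'' B' where d'': "(\<lambda>i. int (d'' i)) = reflect Q j (\<lambda>i. int (d i))" and
        r': "reflection Q j d A' d'' B'" and indec': "matrix_indec (flip j Q) d'' B'"
        using reflection_exists'[OF Cons.prems(1) src A' False] by blast
      have "d'' = d'" using d' d'' by (metis (no_types, lifting) fun_cong of_nat_eq_iff ext)
      then show ?thesis
        using reflection_reflects_iso[OF Cons.prems(1) src rep[OF Cons.prems(4)] rep[OF A'] r r'] IH(2) indec'
        by blast
    qed
    moreover have "tits_form Q (\<lambda>i. int (d i)) = 1"
      using IH(1) by (simp add: d' tits_form_reflect[OF Cons.prems(1,2) j])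
    ultimately show ?thesis by blast
  qed
qed auto

text \<open>
  Dimension vectors are normalized to be \<open>0\<close> outside the quiver, so that counting these functions counts
  dimension vectors.
\<close>

definition indec_dims :: "'k::field itself \<Rightarrow> ('v, 'a) pre_digraph \<Rightarrow> ('v \<Rightarrow> nat) set" where
  "indec_dims _ Q = {d. (\<forall>i. i \<notin> verts Q \<longrightarrow> d i = 0) \<and> (\<exists>A :: 'a \<Rightarrow> 'k endo. matrix_indec Q d A)}"

theorem pos_def_indec:
  assumes "fin_digraph Q" "topological_order Q vs" "pos_def Q"
  shows "finite (indec_dims TYPE('k::field) Q)"
    and "d \<in> indec_dims TYPE('k) Q \<Longrightarrow> matrix_indec Q d (A :: 'a \<Rightarrow> 'k endo) \<Longrightarrow> matrix_indec Q d A' \<Longrightarrow>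
      matrix_iso Q d A d A'"
proof -
  have main: "tits_form Q (\<lambda>i. int (d i)) = 1 \<and> (\<forall>A'. matrix_indec Q d A' \<longrightarrow> matrix_iso Q d A d A')"
    if A: "matrix_indec Q d A" and d: "\<And>i. i \<notin> verts Q \<Longrightarrow> d i = 0" for d and A :: "'a \<Rightarrow> 'k endo"
  proof -
    have "\<exists>i\<in>verts Q. d i \<noteq> 0" using A by (simp add: matrix_indec_def)
    then obtain t where "\<exists>i\<in>verts Q. fold (reflect Q) (concat (replicate t vs)) (\<lambda>i. int (d i)) i < 0"
      using coxeter_leaves_positive_cone[OF assms, of "\<lambda>i. int (d i)"] d by auto
    then show ?thesis
      using indec_of_negative_reflection[OF assms(1) _ _ A] admissible_power[OF assms(1,2), of t] assms(2)
      by (auto simp: topological_order_def)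
  qed
  show "matrix_iso Q d A d A'"
    if "d \<in> indec_dims TYPE('k) Q" "matrix_indec Q d (A :: 'a \<Rightarrow> 'k endo)" "matrix_indec Q d A'" for d A A'
    using main that by (auto simp: indec_dims_def)
  let ?f = "\<lambda>(d :: 'v \<Rightarrow> nat) i. int (d i)"
  have "?f ` indec_dims TYPE('k) Q \<subseteq> {x. (\<forall>i. i \<notin> verts Q \<longrightarrow> x i = 0) \<and> tits_form Q x = 1}"
    using main by (auto simp: indec_dims_def)
  then have "finite (?f ` indec_dims TYPE('k) Q)"
    by (rule finite_subset) (rule finite_tits_form_level[OF assms(1,3)])
  moreover have "inj_on ?f (indec_dims TYPE('k) Q)"
    by (intro inj_onI ext) (metis (mono_tags) of_nat_eq_iff)
  ultimately show "finite (indec_dims TYPE('k) Q)" using finite_imageD by blast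
qed

section \<open>Infinitely many roots from a radical vector\<close>

text \<open>
  The Euler form of \<open>x\<close> and \<open>\<delta>\<close>, which depends on the orientation. For \<open>\<delta>\<close> in the radical of the
  Tits form, \<open>\<delta>\<close> itself is fixed by all simple reflections; as the Euler form is invariant when both
  vectors are reflected, so is this linear form in \<open>x\<close>.
\<close>

definition defect :: "('v, 'a) pre_digraph \<Rightarrow> ('v \<Rightarrow> int) \<Rightarrow> ('v \<Rightarrow> int) \<Rightarrow> int" where
  "defect Q \<delta> x = (\<Sum>i\<in>verts Q. x i * \<delta> i) - (\<Sum>a\<in>arcs Q. x (tail Q a) * \<delta> (head Q a))"

lemma defect_flip_reflect:
  assumes "fin_digraph Q" "source Q j" "neighbour_sum Q j \<delta> = 2 * \<delta> j"
  shows "defect (flip j Q) \<delta> (reflect Q j x) = defect Q \<delta> x"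
proof -
  have j: "j \<in> verts Q" and hd: "\<And>a. a \<in> arcs Q \<Longrightarrow> head Q a \<noteq> j"
    using assms(2) by (auto simp: source_def)
  have fin: "finite (verts Q)" "finite (arcs Q)"
    using assms(1) by (auto simp: fin_digraph.finite_verts fin_digraph.finite_arcs)
  have n: "neighbour_sum Q j y = (\<Sum>a\<in>arcs Q. if tail Q a = j then y (head Q a) else 0)" for y
    unfolding neighbour_sum_def using hd by (intro sum.cong) auto
  let ?s = "reflect Q j x"
  have verts: "(\<Sum>i\<in>verts Q. y i * \<delta> i) = y j * \<delta> j + (\<Sum>i\<in>verts Q - {j}. y i * \<delta> i)" for y
    using fin j by (simp add: sum.remove)
  have "(\<Sum>a\<in>arcs Q. ?s (tail (flip j Q) a) * \<delta> (head (flip j Q) a)) -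
      (\<Sum>a\<in>arcs Q. x (tail Q a) * \<delta> (head Q a)) =
      (\<Sum>a\<in>arcs Q. \<delta> j * (if tail Q a = j then x (head Q a) else 0) -
         x j * (if tail Q a = j then \<delta> (head Q a) else 0))"
    unfolding sum_subtractf[symmetric]
    by (rule sum.cong) (use hd in \<open>auto simp: tail_flip_source[OF assms(2)] head_flip_source[OF assms(2)] reflect_def\<close>)
  also have "\<dots> = \<delta> j * neighbour_sum Q j x - x j * neighbour_sum Q j \<delta>"
    by (simp add: n sum_subtractf sum_distrib_left)
  also have "\<dots> = \<delta> j * (?s j - x j)"
    by (simp add: assms(3) reflect_def algebra_simps)
  finally show ?thesis
    unfolding defect_def verts arcs_flip verts_flip
    by (simp add: reflect_def algebra_simps)
qed

lemma defect_unit: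
  assumes "fin_digraph Q" "j \<in> verts Q"
  shows "defect Q \<delta> (unit_vec_at j) = \<delta> j - (\<Sum>a\<in>out Q j. \<delta> (head Q a))"
proof -
  have fin: "finite (verts Q)" "finite (arcs Q)"
    using assms(1) by (auto simp: fin_digraph.finite_verts fin_digraph.finite_arcs)
  have "(\<Sum>i\<in>verts Q. unit_vec_at j i * \<delta> i) = (\<Sum>i\<in>verts Q. if i = j then \<delta> j else 0)"
    by (rule sum.cong) (auto simp: unit_vec_at_def)
  moreover have "(\<Sum>a\<in>arcs Q. unit_vec_at j (tail Q a) * \<delta> (head Q a)) =
      (\<Sum>a\<in>arcs Q. if tail Q a = j then \<delta> (head Q a) else 0)"
    by (rule sum.cong) (auto simp: unit_vec_at_def)
  ultimately show ?thesis using fin assms(2) by (simp add: defect_def sum.inter_filter)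
qed

text \<open>
  At a source \<open>j\<close> the simple has defect \<open>\<delta> j - 2 * \<delta> j < 0\<close>. A representation with positive
  defect is therefore never this simple, and it can be reflected as often as one likes.
\<close>

lemma indec_propagates:
  assumes "fin_digraph Q" "admissible Q js" "d \<in> indec_dims TYPE('k::field) Q"
    and "\<forall>i\<in>verts Q. \<delta> i > 0 \<and> neighbour_sum Q i \<delta> = 2 * \<delta> i" "defect Q \<delta> (\<lambda>i. int (d i)) > 0"
  shows "\<exists>d'\<in>indec_dims TYPE('k) (fold flip js Q). (\<lambda>i. int (d' i)) = fold (reflect Q) js (\<lambda>i. int (d i))"
  using assms
proof (induction js arbitrary: Q d)
  case (Cons j js)
  then have src: "source Q j" and adm: "admissible (flip j Q) js" by auto
  then have j: "j \<in> verts Q" by (simp add: source_def)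
  obtain A :: "'b \<Rightarrow> 'k endo" where A: "matrix_indec Q d A" and d0: "\<And>i. i \<notin> verts Q \<Longrightarrow> d i = 0"
    using Cons.prems(3) by (auto simp: indec_dims_def)
  have "\<not> (d j = 1 \<and> (\<forall>i\<in>verts Q. i \<noteq> j \<longrightarrow> d i = 0))"
  proof
    assume *: "d j = 1 \<and> (\<forall>i\<in>verts Q. i \<noteq> j \<longrightarrow> d i = 0)"
    have "(\<lambda>i. int (d i)) = unit_vec_at j"
    proof
      fix i show "int (d i) = unit_vec_at j i"
        using * d0[of i] by (cases "i \<in> verts Q") (auto simp: unit_vec_at_def)
    qed
    then have "defect Q \<delta> (\<lambda>i. int (d i)) = \<delta> j - neighbour_sum Q j \<delta>"
      using defect_unit[OF Cons.prems(1) j, of \<delta>] neighbour_sum_source[OF Cons.prems(1) src, of \<delta>] by simp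
    then show False using Cons.prems(4,5) j by force
  qed
  then obtain d' B where d': "(\<lambda>i. int (d' i)) = reflect Q j (\<lambda>i. int (d i))" and
    B: "matrix_indec (flip j Q) d' (B :: 'b \<Rightarrow> 'k endo)"
    by (rule reflection_exists'[OF Cons.prems(1) src A])
  have "d' i = 0" if "i \<notin> verts Q" for i
  proof -
    have "i \<noteq> j" using j that by blast
    then have "int (d' i) = int (d i)" using fun_cong[OF d', of i] by (simp add: reflect_def)
    then show ?thesis using d0[OF that] by simp
  qed
  then have dims: "d' \<in> indec_dims TYPE('k) (flip j Q)" using B by (auto simp: indec_dims_def)
  have "defect (flip j Q) \<delta> (\<lambda>i. int (d' i)) > 0"
    unfolding d' using defect_flip_reflect[OF Cons.prems(1) src] Cons.prems(4,5) j by simp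
  then show ?case
    using Cons.IH[OF fin_digraph_flip[OF Cons.prems(1)] adm dims] Cons.prems(4) by (simp add: d')
qed auto

lemma simple_indec:
  assumes "j \<in> verts Q" "loopless Q"
  shows "matrix_indec Q (\<lambda>i. if i = j then 1 else 0) (\<lambda>_. 0 :: 'k::field endo)"
  unfolding matrix_indec_def
proof (intro conjI allI impI)
  let ?d = "\<lambda>i. if i = j then 1 else 0 :: nat"
  show "matrix_rep Q ?d (\<lambda>_. 0 :: 'k endo)" by (simp add: matrix_rep_def)
  show "\<exists>i\<in>verts Q. ?d i \<noteq> 0" using assms(1) by auto
  fix \<phi> :: "_ \<Rightarrow> 'k endo"
  assume *: "matrix_hom Q ?d (\<lambda>_. 0) ?d (\<lambda>_. 0) \<phi> \<and> (\<forall>i\<in>verts Q. \<phi> i * \<phi> i = \<phi> i)"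
  then have 0: "\<phi> i = 0" if "i \<in> verts Q" "i \<noteq> j" for i
    using that by (auto simp: matrix_hom_def homs_0_left split: if_splits)
  have h: "\<phi> j \<in> homs 1 1" and idem: "\<phi> j * \<phi> j = \<phi> j"
    using * assms(1) by (auto simp: matrix_hom_def)
  define c where "c = app (\<phi> j) (unit_at 0) 0"
  have \<phi>j: "\<phi> j = outer (\<lambda>n. c * unit_at 0 n) 0"
  proof -
    have "trunc 1 = (outer (unit_at 0) 0 :: 'k endo)" using trunc_Suc[of 0] by simp
    then have "\<phi> j = outer (app (\<phi> j) (unit_at 0)) 0"
      using homs_right[OF h] by (simp add: mult_outer)
    moreover have "app (\<phi> j) (unit_at 0) = (\<lambda>n. c * unit_at 0 n)"
    proof
      fix n show "app (\<phi> j) (unit_at 0) n = c * unit_at 0 n"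
        using homs_app[OF h, of n] by (cases "n = 0") (auto simp: c_def unit_at_def)
    qed
    ultimately show ?thesis by simp
  qed
  have "app (\<phi> j * \<phi> j) (unit_at 0) 0 = app (\<phi> j) (unit_at 0) 0" using idem by simp
  then have "c * c = c" by (simp add: \<phi>j unit_at_def)
  then have "c = 0 \<or> c = 1" by auto
  then show "(\<forall>i\<in>verts Q. \<phi> i = 0) \<or> (\<forall>i\<in>verts Q. \<phi> i = trunc (?d i))"
  proof
    assume "c = 0"
    then have "\<phi> j = 0" unfolding \<phi>j by (intro endo_eqI) simp
    then show ?thesis using 0 by metis
  next
    assume "c = 1"
    moreover have "trunc (Suc 0) = (outer (unit_at 0) 0 :: 'k endo)" by (simp add: trunc_Suc)
    ultimately have "\<phi> j = trunc 1" unfolding \<phi>j by simp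
    then show ?thesis using 0 by auto
  qed
qed

text \<open>
  Start with the simple at the last vertex \<open>k\<close> of the topological order. It is a sink, and the defect
  is \<open>\<delta> k > 0\<close>. If two powers of the Coxeter transformation agreed on the unit vector, it would be
  periodic; undoing the last reflection, the one at \<open>k\<close>, would show that the negative of the unit
  vector is the dimension vector of a representation.
\<close>

theorem radical_vector_imp_infinite:
  assumes "fin_digraph Q" "topological_order Q vs" "verts Q \<noteq> {}"
    and \<delta>: "\<forall>i\<in>verts Q. \<delta> i > 0 \<and> neighbour_sum Q i \<delta> = 2 * \<delta> i"
  shows "infinite (indec_dims TYPE('k::field) Q)"
proof
  assume fin: "finite (indec_dims TYPE('k) Q)"
  have vs: "distinct vs" "set vs = verts Q" "loopless Q"
    "sorted_wrt (\<lambda>u v. \<not> (\<exists>a\<in>arcs Q. tail Q a = v \<and> head Q a = u)) vs"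
    using assms(2) by (auto simp: topological_order_def)
  note wf = arc_ends[OF assms(1)]
  obtain us k where us: "vs = us @ [k]"
    using vs(2) assms(3) by (metis append_butlast_last_id empty_set)
  then have k: "k \<in> verts Q" using vs(2) by auto
  have sink: "tail Q a \<noteq> k" if "a \<in> arcs Q" for a
  proof
    assume *: "tail Q a = k"
    then have "head Q a \<in> set us" using wf[OF that] vs(2,3) that us
      by (metis Un_iff empty_iff empty_set insert_iff list.simps(15) loopless_def set_append)
    then show False using vs(4) * that us by (auto simp: sorted_wrt_append)
  qed
  define e :: "'a \<Rightarrow> nat" where "e i = (if i = k then 1 else 0)" for i
  have e: "(\<lambda>i. int (e i)) = unit_vec_at k" by (auto simp: e_def unit_vec_at_def)
  have e_dims: "e \<in> indec_dims TYPE('k) Q"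
    using simple_indec[OF k vs(3), where 'k = 'k] k by (auto simp: indec_dims_def e_def[abs_def])
  have e_def: "defect Q \<delta> (\<lambda>i. int (e i)) > 0"
  proof -
    have "out Q k = {}" using sink by auto
    then have "(\<Sum>a\<in>out Q k. \<delta> (head Q a)) = 0" by (simp only: sum.empty)
    then show ?thesis using defect_unit[OF assms(1) k, of \<delta>] \<delta> k by (simp add: e)
  qed
  let ?c = "fold (reflect Q) vs"
  have inj: "inj ?c" using fold_reflect_inj[OF vs(3)] by (meson injI)
  have in_dims: "\<exists>d\<in>indec_dims TYPE('k) Q. (\<lambda>i. int (d i)) = (?c ^^ t) (unit_vec_at k)" for t
    using indec_propagates[OF assms(1) _ e_dims \<delta> e_def, of "concat (replicate t vs)"]
      admissible_power[OF assms(1,2), of t] by (simp add: e fold_concat_replicate)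
  have "finite ((\<lambda>d i. int (d i)) ` indec_dims TYPE('k) Q)" using fin by simp
  moreover have "range (\<lambda>t. (?c ^^ t) (unit_vec_at k)) \<subseteq> (\<lambda>d i. int (d i)) ` indec_dims TYPE('k) Q"
  proof (rule image_subsetI)
    fix t
    obtain d where "d \<in> indec_dims TYPE('k) Q" "(\<lambda>i. int (d i)) = (?c ^^ t) (unit_vec_at k)"
      using in_dims[of t] by blast
    then show "(?c ^^ t) (unit_vec_at k) \<in> (\<lambda>d i. int (d i)) ` indec_dims TYPE('k) Q"
      using image_eqI[of "(?c ^^ t) (unit_vec_at k)" "\<lambda>d i. int (d i)" d] by simp
  qed
  ultimately have "finite (range (\<lambda>t. (?c ^^ t) (unit_vec_at k)))"
    by (rule rev_finite_subset)
  then obtain s t where st: "s < t" "(?c ^^ s) (unit_vec_at k) = (?c ^^ t) (unit_vec_at k)"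
    using range_inj_infinite by (metis (mono_tags, lifting) injI linorder_neqE_nat)
  then obtain n where "t - s = Suc n" by (metis Suc_diff_Suc)
  then have per: "(?c ^^ Suc n) (unit_vec_at k) = unit_vec_at k"
    using funpow_inj_cancel[OF inj st(2,1)] by simp
  define y where "y = fold (reflect Q) us ((?c ^^ n) (unit_vec_at k))"
  have "reflect Q k y = unit_vec_at k" using per by (simp add: y_def us)
  then have "y = reflect Q k (unit_vec_at k)" using vs(3) by (metis reflect_reflect)
  moreover have "neighbour_sum Q k (unit_vec_at k) = 0"
    unfolding neighbour_sum_def using vs(3)
    by (intro sum.neutral) (auto simp: unit_vec_at_def loopless_def)
  ultimately have "y k = - 1" by (simp add: reflect_def unit_vec_at_def)
  moreover have "admissible Q (concat (replicate n vs) @ us)"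
    using admissible_power[OF assms(1,2), of n] admissible_topological_order[OF assms(1,2)] us
    by (simp add: admissible_append)
  from indec_propagates[OF assms(1) this e_dims \<delta> e_def]
  obtain d' where "(\<lambda>i. int (d' i)) = y"
    by (auto simp: e fold_concat_replicate y_def)
  then have "y k \<ge> 0" by (metis of_nat_0_le_iff)
  ultimately show False by simp
qed

section \<open>Subquivers\<close>

lemma indec_dims_subquiver:
  assumes "S \<subseteq> verts Q" "F \<subseteq> arcs Q"
  shows "indec_dims TYPE('k::field) (Q\<lparr>verts := S, arcs := F\<rparr>) \<subseteq> indec_dims TYPE('k) Q"
proof
  fix d assume "d \<in> indec_dims TYPE('k) (Q\<lparr>verts := S, arcs := F\<rparr>)"
  then obtain A :: "'b \<Rightarrow> 'k endo" where
    d: "\<And>i. i \<notin> S \<Longrightarrow> d i = 0" and A: "matrix_indec (Q\<lparr>verts := S, arcs := F\<rparr>) d A"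
    by (auto simp: indec_dims_def)
  define A' where "A' a = (if a \<in> F then A a else 0)" for a
  have "matrix_indec Q d A'"
    unfolding matrix_indec_def
  proof (intro conjI allI impI)
    show "matrix_rep Q d A'" using A by (auto simp: matrix_indec_def matrix_rep_def A'_def)
    show "\<exists>i\<in>verts Q. d i \<noteq> 0" using A assms(1) by (auto simp: matrix_indec_def)
    fix \<phi> assume \<phi>: "matrix_hom Q d A' d A' \<phi> \<and> (\<forall>i\<in>verts Q. \<phi> i * \<phi> i = \<phi> i)"
    have off: "\<phi> i = 0" if "i \<in> verts Q" "i \<notin> S" for i
      using \<phi> d[OF that(2)] that(1) by (auto simp: matrix_hom_def homs_0_left)
    have "matrix_hom (Q\<lparr>verts := S, arcs := F\<rparr>) d A d A \<phi> \<and>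
        (\<forall>i\<in>verts (Q\<lparr>verts := S, arcs := F\<rparr>). \<phi> i * \<phi> i = \<phi> i)"
    proof -
      have "A a * \<phi> (tail Q a) = \<phi> (head Q a) * A a" if "a \<in> F" for a
      proof -
        have "A' a * \<phi> (tail Q a) = \<phi> (head Q a) * A' a"
          using \<phi> that assms(2) unfolding matrix_hom_def by blast
        then show ?thesis using that by (simp add: A'_def)
      qed
      then show ?thesis using \<phi> assms(1) by (auto simp: matrix_hom_def)
    qed
    then have "(\<forall>i\<in>S. \<phi> i = 0) \<or> (\<forall>i\<in>S. \<phi> i = trunc (d i))"
      using A unfolding matrix_indec_def by auto
    then show "(\<forall>i\<in>verts Q. \<phi> i = 0) \<or> (\<forall>i\<in>verts Q. \<phi> i = trunc (d i))"
      using off d by (metis trunc_0)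
  qed
  then show "d \<in> indec_dims TYPE('k) Q" using d assms(1) by (auto simp: indec_dims_def)
qed

section \<open>A removable arc gives infinitely many indecomposables\<close>

text \<open>
  Connectedness by the arrows in \<open>F\<close>, stated as an invariance principle instead of with walks.
\<close>

definition linked :: "('v, 'a) pre_digraph \<Rightarrow> 'a set \<Rightarrow> bool" where
  "linked Q F \<longleftrightarrow> (\<forall>P :: 'v \<Rightarrow> bool. (\<forall>b\<in>F. P (tail Q b) = P (head Q b)) \<longrightarrow>
     (\<forall>u\<in>verts Q. \<forall>v\<in>verts Q. P u = P v))"

lemma linkedD:
  assumes "linked Q F" "\<And>b. b \<in> F \<Longrightarrow> f (tail Q b) = f (head Q b)" "u \<in> verts Q" "v \<in> verts Q"
  shows "f u = f v"
proof -
  have "\<forall>b\<in>F. (f (tail Q b) = f v) = (f (head Q b) = f v)" using assms(2) by simp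
  then have "\<forall>u\<in>verts Q. \<forall>w\<in>verts Q. (f u = f v) = (f w = f v)"
    by (rule mp[OF spec[OF assms(1)[unfolded linked_def], of "\<lambda>i. f i = f v"]])
  then show ?thesis using assms(3,4) by blast
qed

definition nilpotent_block :: "nat \<Rightarrow> 'k::field endo" where
  "nilpotent_block n = trunc n * shift_right 1"

lemma nilpotent_block_in_homs: "nilpotent_block n \<in> homs n n"
  by (rule homsI; rule endo_eqI) (auto simp: nilpotent_block_def fun_eq_iff)

lemma app_nilpotent_block:
  "app (nilpotent_block n) v = (\<lambda>r. if r = 0 \<or> r \<ge> n then 0 else v (r - 1))"
  by (auto simp: nilpotent_block_def)

text \<open>
  A matrix that commutes with a nilpotent Jordan block is a polynomial in it. If the constant term is
  \<open>0\<close>, it raises the order of vanishing of every vector at the beginning; an idempotent does this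
  arbitrarily often without changing.
\<close>

lemma commutant_idempotent_zero:
  assumes X: "X \<in> homs n n" "nilpotent_block n * X = X * nilpotent_block n" "X * X = X"
    and n: "n \<ge> 1" and X0: "app X (unit_at 0) 0 = 0"
  shows "X = 0"
proof -
  have NX: "app X (app (nilpotent_block n) v) = app (nilpotent_block n) (app X v)" for v
    using X(2) by (metis app_times_endo)
  have shift: "app X w = app (nilpotent_block n) (app X (\<lambda>r. w (Suc r)))" if "w 0 = 0" for w
  proof -
    have "app X w = app X (\<lambda>r. if r < n then w r else 0)" by (simp add: homs_app_trunc[OF X(1)])
    also have "(\<lambda>r. if r < n then w r else 0) = app (nilpotent_block n) (\<lambda>r. w (Suc r))"
      using that by (auto simp: app_nilpotent_block fun_eq_iff)
    finally show ?thesis by (simp add: NX)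
  qed
  have zero: "app X w 0 = 0" for w
  proof -
    have "w = (\<lambda>r. w 0 * unit_at 0 r + (w r - w 0 * unit_at 0 r))" by simp
    then have "app X w = (\<lambda>r. app X (\<lambda>r. w 0 * unit_at 0 r) r + app X (\<lambda>r. w r - w 0 * unit_at 0 r) r)"
      by (metis app_add)
    then have "app X w 0 = app X (\<lambda>r. w 0 * unit_at 0 r) 0 + app X (\<lambda>r. w r - w 0 * unit_at 0 r) 0"
      by simp
    moreover have "app X (\<lambda>r. w r - w 0 * unit_at 0 r) 0 = 0"
      by (subst shift) (auto simp: unit_at_def app_nilpotent_block)
    ultimately show ?thesis by (simp add: app_scale X0)
  qed
  have raise: "app X w r = 0" if "\<And>r. r < k \<Longrightarrow> w r = 0" "r \<le> k" for w k r
    using that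
  proof (induction k arbitrary: w r)
    case (Suc k)
    have "app X (\<lambda>r. w (Suc r)) s = 0" if "s \<le> k" for s
      by (rule Suc.IH[OF _ that]) (use Suc.prems in auto)
    then show ?case using Suc.prems by (subst shift) (auto simp: app_nilpotent_block)
  qed (simp add: zero)
  have "app X v r = 0" if "r < k" for v r k
    using that
  proof (induction k arbitrary: r)
    case (Suc k)
    have "app X v = app X (app X v)" using X(3) by (metis app_times_endo)
    then show ?case using raise[of k "app X v" r] Suc by simp
  qed simp
  then show ?thesis by (intro endo_eqI) auto
qed

text \<open>
  The constant term of the polynomial is idempotent, hence \<open>0\<close> or \<open>1\<close>; in the second case pass to the
  complementary idempotent.
\<close>

lemma commutant_idempotent:
  fixes X :: "'k::field endo"
  assumes X: "X \<in> homs n n" "nilpotent_block n * X = X * nilpotent_block n" "X * X = X"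
    and n: "n \<ge> 1"
  shows "X = 0 \<or> X = trunc n"
proof -
  define c where "c = app X (unit_at 0) 0"
  have N: "trunc n * nilpotent_block n = (nilpotent_block n * trunc n :: 'k endo)"
    by (simp add: homs_left[OF nilpotent_block_in_homs] homs_right[OF nilpotent_block_in_homs])
  have tX: "trunc n * X = X" "X * trunc n = X" using X(1) by (simp_all add: homs_def)
  have mult: "app X w 0 = c * w 0" for w
  proof -
    have "app X w = app X (\<lambda>r. if r < n then w r else 0)" by (simp add: homs_app_trunc[OF X(1)])
    also have "(\<lambda>r. if r < n then w r else 0) =
        (\<lambda>r. w 0 * unit_at 0 r + app (nilpotent_block n) (\<lambda>r. w (Suc r)) r)"
      using n by (auto simp: app_nilpotent_block fun_eq_iff unit_at_def)
    also have "app X \<dots> = (\<lambda>r. w 0 * app X (unit_at 0) r +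
        app (nilpotent_block n) (app X (\<lambda>r. w (Suc r))) r)"
      using X(2) by (simp add: app_add app_scale) (metis app_times_endo)
    finally show ?thesis by (simp add: app_nilpotent_block c_def)
  qed
  have "app (X * X) (unit_at 0) 0 = c" using X(3) by (simp add: c_def)
  then have "c * c = c" by (simp add: mult unit_at_def)
  then have "c = 0 \<or> c = 1" by auto
  then show ?thesis
  proof
    assume "c = 0"
    then show ?thesis using commutant_idempotent_zero[OF X n] by (simp add: c_def)
  next
    assume "c = 1"
    have "trunc n - X = 0"
    proof (rule commutant_idempotent_zero[OF _ _ _ n])
      show "trunc n - X \<in> homs n n" using X(1) by (intro homs_diff) auto
      show "nilpotent_block n * (trunc n - X) = (trunc n - X) * nilpotent_block n"
        by (simp add: left_diff_distrib right_diff_distrib X(2) N)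
      show "(trunc n - X) * (trunc n - X) = trunc n - X"
        by (simp add: left_diff_distrib right_diff_distrib X(3) tX)
      show "app (trunc n - X) (unit_at 0) 0 = 0"
        using n \<open>c = 1\<close> by (simp add: c_def unit_at_def)
    qed
    then show ?thesis by simp
  qed
qed

text \<open>
  An endomorphism is constant along the arrows with the identity, so it is given by one matrix that commutes
  with the Jordan block.
\<close>

theorem removable_arc_imp_infinite:
  assumes "fin_digraph Q" "a \<in> arcs Q" "linked Q (arcs Q - {a})"
  shows "infinite (indec_dims TYPE('k::field) Q)"
proof -
  note wf = arc_ends[OF assms(1)]
  obtain u where u: "u \<in> verts Q" using wf[OF assms(2)] by blast
  define d where "d n = (\<lambda>i. if i \<in> verts Q then Suc n else 0)" for n
  have "d n \<in> indec_dims TYPE('k) Q" for n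
  proof -
    define A where "A b = (if b = a then nilpotent_block (Suc n) else trunc (Suc n) :: 'k endo)" for b
    have "matrix_indec Q (d n) A"
      unfolding matrix_indec_def
    proof (intro conjI allI impI)
      show "matrix_rep Q (d n) A"
        using wf by (auto simp: matrix_rep_def d_def A_def nilpotent_block_in_homs)
      show "\<exists>i\<in>verts Q. d n i \<noteq> 0" using u by (auto simp: d_def)
      fix \<phi> assume \<phi>: "matrix_hom Q (d n) A (d n) A \<phi> \<and> (\<forall>i\<in>verts Q. \<phi> i * \<phi> i = \<phi> i)"
      have h: "\<phi> i \<in> homs (Suc n) (Suc n)" if "i \<in> verts Q" for i
        using \<phi> that by (auto simp: matrix_hom_def d_def)
      have com: "A b * \<phi> (tail Q b) = \<phi> (head Q b) * A b" if "b \<in> arcs Q" for b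
        using \<phi> that by (auto simp: matrix_hom_def)
      have "\<phi> (tail Q b) = \<phi> (head Q b)" if "b \<in> arcs Q - {a}" for b
        using com[of b] that wf[of b] homs_left[OF h[of "tail Q b"]] homs_right[OF h[of "head Q b"]]
        by (simp add: A_def)
      then have "\<forall>v\<in>verts Q. \<phi> v = \<phi> u"
        using linkedD[OF assms(3), of \<phi>] u by blast
      moreover from this have "nilpotent_block (Suc n) * \<phi> u = \<phi> u * nilpotent_block (Suc n)"
        using com[OF assms(2)] wf[OF assms(2)] by (simp add: A_def)
      then have "\<phi> u = 0 \<or> \<phi> u = trunc (Suc n)"
        using commutant_idempotent[OF h[OF u]] \<phi> u by auto
      ultimately show "(\<forall>i\<in>verts Q. \<phi> i = 0) \<or> (\<forall>i\<in>verts Q. \<phi> i = trunc (d n i))"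
        by (auto simp: d_def)
    qed
    then show ?thesis by (auto simp: indec_dims_def d_def)
  qed
  then have "range d \<subseteq> indec_dims TYPE('k) Q" by blast
  moreover have "inj d"
    by (rule injI) (use u in \<open>auto simp: d_def fun_eq_iff split: if_splits\<close>)
  ultimately show ?thesis using infinite_super range_inj_infinite by blast
qed

section \<open>Trees inside a quiver\<close>

definition adjacent :: "('v, 'a) pre_digraph \<Rightarrow> 'v \<Rightarrow> 'v \<Rightarrow> bool" where
  "adjacent Q u v \<longleftrightarrow> (\<exists>a\<in>arcs Q. {tail Q a, head Q a} = {u, v})"

text \<open>
  Numbering the vertices by \<open>f\<close> such that parents have smaller numbers makes trees inductive: the last
  vertex is a leaf. The arrow \<open>g k\<close> joins \<open>k\<close> to its parent in either direction.
\<close>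

definition tree_in :: "('v, 'a) pre_digraph \<Rightarrow> nat \<Rightarrow> (nat \<Rightarrow> nat) \<Rightarrow> (nat \<Rightarrow> 'v) \<Rightarrow> (nat \<Rightarrow> 'a) \<Rightarrow> bool" where
  "tree_in Q n par f g \<longleftrightarrow> inj_on f {..<n} \<and> f ` {..<n} \<subseteq> verts Q \<and>
     (\<forall>k\<in>{1..<n}. par k < k \<and> g k \<in> arcs Q \<and> {tail Q (g k), head Q (g k)} = {f k, f (par k)})"

abbreviation tree_quiver :: "('v, 'a) pre_digraph \<Rightarrow> nat \<Rightarrow> (nat \<Rightarrow> 'v) \<Rightarrow> (nat \<Rightarrow> 'a) \<Rightarrow> ('v, 'a) pre_digraph" where
  "tree_quiver Q n f g \<equiv> Q\<lparr>verts := f ` {..<n}, arcs := g ` {1..<n}\<rparr>"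

lemma tree_in_inj:
  assumes "tree_in Q n par f g"
  shows "inj_on g {1..<n}"
proof (rule inj_onI)
  fix k l assume k: "k \<in> {1..<n}" and l: "l \<in> {1..<n}" and "g k = g l"
  then have eq: "{f k, f (par k)} = {f l, f (par l)}" using assms unfolding tree_in_def by metis
  have "par k < k" "par l < l" using assms k l unfolding tree_in_def by auto
  moreover have "{k, par k} = {l, par l}"
  proof -
    have "f ` {k, par k} = f ` {l, par l}" using eq by simp
    then show ?thesis using assms k l \<open>par k < k\<close> \<open>par l < l\<close>
      unfolding tree_in_def by (subst (asm) inj_on_image_eq_iff) auto
  qed
  ultimately show "k = l" by (auto simp: doubleton_eq_iff)
qed

lemma tree_quiver_fin_digraph:
  assumes "tree_in Q n par f g"
  shows "fin_digraph (tree_quiver Q n f g)"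
proof -
  have "tail Q (g k) \<in> f ` {..<n} \<and> head Q (g k) \<in> f ` {..<n}" if "k \<in> {1..<n}" for k
  proof -
    have "par k < n" "k < n" using assms that unfolding tree_in_def by fastforce+
    moreover have "{tail Q (g k), head Q (g k)} = {f k, f (par k)}"
      using assms that unfolding tree_in_def by blast
    ultimately show ?thesis by (auto simp: doubleton_eq_iff)
  qed
  then show ?thesis
    unfolding fin_digraph_def fin_digraph_axioms_def wf_digraph_def by auto
qed

text \<open>
  A new leaf goes to the front of the order or to its end, according to the direction of its arrow.
\<close>

lemma tree_topological_order:
  assumes "tree_in Q n par f g"
  shows "\<exists>vs. topological_order (tree_quiver Q n f g) vs"
  using assms
proof (induction n)
  case 0
  then show ?case by (intro exI[of _ "[]"]) (simp add: topological_order_def loopless_def)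
next
  case (Suc n)
  have tree: "tree_in Q n par f g" using Suc.prems by (auto simp: tree_in_def inj_on_def)
  from Suc.IH[OF this] obtain vs where
    vs: "distinct vs" "set vs = f ` {..<n}" "loopless (tree_quiver Q n f g)" and
    sorted: "sorted_wrt (\<lambda>u v. \<not> (\<exists>a\<in>g ` {1..<n}. tail Q a = v \<and> head Q a = u)) vs"
    by (auto simp: topological_order_def)
  have "inj_on f {..<Suc n}" using Suc.prems by (simp add: tree_in_def)
  then have fn: "f n \<notin> set vs" using vs(2) by (simp add: lessThan_Suc)
  have ends: "\<forall>b\<in>g ` {1..<n}. tail Q b \<in> set vs \<and> head Q b \<in> set vs"
    using tree_quiver_fin_digraph[OF tree] vs(2) by (auto simp: fin_digraph_def wf_digraph_def)
  show ?case
  proof (cases "n = 0")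
    case True
    then show ?thesis by (intro exI[of _ "[f 0]"]) (simp add: topological_order_def loopless_def lessThan_Suc)
  next
    case False
    have gn: "{tail Q (g n), head Q (g n)} = {f n, f (par n)}" and par: "par n < n"
      using Suc.prems False unfolding tree_in_def by auto
    then have p: "f (par n) \<in> set vs" using vs(2) by auto
    have arcs: "g ` {1..<Suc n} = insert (g n) (g ` {1..<n})"
      using False by (simp add: atLeastLessThanSuc)
    have verts: "f ` {..<Suc n} = insert (f n) (set vs)" using vs(2) by (simp add: lessThan_Suc)
    have ll: "loopless (tree_quiver Q (Suc n) f g)"
      using vs(3) gn p fn arcs by (auto simp: loopless_def doubleton_eq_iff)
    let ?R = "\<lambda>u v. \<not> (\<exists>a\<in>g ` {1..<Suc n}. tail Q a = v \<and> head Q a = u)"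
    have sorted': "sorted_wrt ?R vs"
    proof (rule sorted_wrt_mono_rel[OF _ sorted])
      fix u v assume "u \<in> set vs" "v \<in> set vs" "\<not> (\<exists>a\<in>g ` {1..<n}. tail Q a = v \<and> head Q a = u)"
      then show "?R u v" using gn fn arcs by (auto simp: doubleton_eq_iff)
    qed
    have "f (par n) \<noteq> f n" using p fn by metis
    then consider "tail Q (g n) = f n" "head Q (g n) \<noteq> f n" | "head Q (g n) = f n" "tail Q (g n) \<noteq> f n"
      using gn by (auto simp: doubleton_eq_iff)
    then show ?thesis
    proof cases
      case 1
      have "?R (f n) v" if "v \<in> set vs" for v
        unfolding arcs using 1 that fn ends by (metis insertE)
      then have "topological_order (tree_quiver Q (Suc n) f g) (f n # vs)"
        using vs fn ll sorted' verts by (simp add: topological_order_def)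
      then show ?thesis by blast
    next
      case 2
      have "?R v (f n)" if "v \<in> set vs" for v
        unfolding arcs using 2 that fn ends by (metis insertE)
      then have "topological_order (tree_quiver Q (Suc n) f g) (vs @ [f n])"
        using vs fn ll sorted' verts by (simp add: topological_order_def sorted_wrt_append)
      then show ?thesis by blast
    qed
  qed
qed

text \<open>
  On the subquiver carried by the tree, \<open>\<delta>\<close> lies in the radical of the Tits form. The indecomposables of the
  subquiver are extended by \<open>0\<close>.
\<close>

theorem radical_tree_imp_infinite:
  fixes \<delta> :: "nat \<Rightarrow> int"
  assumes tree: "tree_in Q n par f g" and "n > 0" and "\<And>i. i < n \<Longrightarrow> \<delta> i > 0"
    and \<delta>: "\<And>i. i < n \<Longrightarrow> 2 * \<delta> i = (\<Sum>k\<in>{1..<n}.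
      (if par k = i then \<delta> k else 0) + (if k = i then \<delta> (par k) else 0))"
  shows "infinite (indec_dims TYPE('k::field) Q)"
proof -
  let ?T = "tree_quiver Q n f g"
  obtain vs where vs: "topological_order ?T vs" using tree_topological_order[OF tree] by blast
  have inj: "inj_on f {..<n}" using tree by (simp add: tree_in_def)
  define \<delta>' where "\<delta>' v = (\<delta> (the_inv_into {..<n} f v))" for v
  have \<delta>': "\<delta>' (f i) = \<delta> i" if "i < n" for i
    using that inj by (simp add: \<delta>'_def the_inv_into_f_f)
  have "neighbour_sum ?T (f i) \<delta>' = 2 * \<delta>' (f i)" if i: "i < n" for i
  proof -
    have "neighbour_sum ?T (f i) \<delta>' = (\<Sum>k\<in>{1..<n}.
       (if tail Q (g k) = f i then \<delta>' (head Q (g k)) else 0) +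
       (if head Q (g k) = f i then \<delta>' (tail Q (g k)) else 0))"
    proof -
      have T: "arcs ?T = g ` {1..<n}" "tail ?T = tail Q" "head ?T = head Q" by simp_all
      show ?thesis
        unfolding neighbour_sum_def T sum.reindex[OF tree_in_inj[OF tree]] o_apply by (rule refl)
    qed
    also have "\<dots> = (\<Sum>k\<in>{1..<n}. (if par k = i then \<delta> k else 0) + (if k = i then \<delta> (par k) else 0))"
    proof (rule sum.cong[OF refl])
      fix k assume k: "k \<in> {1..<n}"
      then have "par k < k" and g: "{tail Q (g k), head Q (g k)} = {f k, f (par k)}"
        using tree by (auto simp: tree_in_def)
      have "k < n" "par k < n" using k \<open>par k < k\<close> by auto
      then have eq: "f k = f i \<longleftrightarrow> k = i" "f (par k) = f i \<longleftrightarrow> par k = i" "f k \<noteq> f (par k)"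
        using inj i \<open>par k < k\<close> by (auto simp: inj_on_eq_iff)
      show "(if tail Q (g k) = f i then \<delta>' (head Q (g k)) else 0) +
          (if head Q (g k) = f i then \<delta>' (tail Q (g k)) else 0) =
          (if par k = i then \<delta> k else 0) + (if k = i then \<delta> (par k) else 0)"
        using g eq \<delta>'[OF \<open>k < n\<close>] \<delta>'[OF \<open>par k < n\<close>] by (auto simp: doubleton_eq_iff)
    qed
    also have "\<dots> = 2 * \<delta>' (f i)" by (simp only: \<delta>[OF i] \<delta>'[OF i])
    finally show ?thesis .
  qed
  then have "\<forall>v\<in>verts ?T. \<delta>' v > 0 \<and> neighbour_sum ?T v \<delta>' = 2 * \<delta>' v"
    using \<delta>' assms(3) by simp
  moreover have "verts ?T \<noteq> {}" using assms(2) by auto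
  ultimately have "infinite (indec_dims TYPE('k) ?T)"
    using radical_vector_imp_infinite[OF tree_quiver_fin_digraph[OF tree] vs] by blast
  moreover have "indec_dims TYPE('k) ?T \<subseteq> indec_dims TYPE('k) Q"
    using tree by (intro indec_dims_subquiver) (auto simp: tree_in_def)
  ultimately show ?thesis using finite_subset by blast
qed

section \<open>Euclidean trees\<close>

lemma adjacent_sym: "adjacent Q u v \<longleftrightarrow> adjacent Q v u"
  by (simp add: adjacent_def insert_commute)

lemma tree_in_exists:
  assumes "inj_on f {..<n}" "f ` {..<n} \<subseteq> verts Q"
    and "\<And>k. 1 \<le> k \<Longrightarrow> k < n \<Longrightarrow> par k < k \<and> adjacent Q (f k) (f (par k))"
  shows "\<exists>g. tree_in Q n par f g"
proof -
  have "\<forall>k\<in>{1..<n}. \<exists>a. a \<in> arcs Q \<and> {tail Q a, head Q a} = {f k, f (par k)}"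
    using assms(3) unfolding adjacent_def Bex_def by (metis atLeastLessThan_iff)
  from bchoice[OF this] show ?thesis using assms(1-3) unfolding tree_in_def by auto
qed

lemma nth_tree_imp_infinite:
  fixes \<delta> :: "nat \<Rightarrow> int"
  assumes "distinct L" "set L \<subseteq> verts Q" "L \<noteq> []"
    and "\<And>k. 1 \<le> k \<Longrightarrow> k < length L \<Longrightarrow> par k < k \<and> adjacent Q (L ! k) (L ! par k)"
    and "\<And>i. i < length L \<Longrightarrow> \<delta> i > 0"
    and "\<And>i. i < length L \<Longrightarrow> 2 * \<delta> i = (\<Sum>k\<in>{1..<length L}.
      (if par k = i then \<delta> k else 0) + (if k = i then \<delta> (par k) else 0))"
  shows "infinite (indec_dims TYPE('k::field) Q)"
proof -
  have "inj_on ((!) L) {..<length L}" using assms(1) by (simp add: inj_on_nth)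
  moreover have "(!) L ` {..<length L} \<subseteq> verts Q" using assms(2) by (auto simp: set_conv_nth)
  ultimately obtain g where "tree_in Q (length L) par ((!) L) g"
    using tree_in_exists[of "(!) L" "length L" Q par] assms(4) by blast
  then show ?thesis using radical_tree_imp_infinite[OF _ _ assms(5,6)] assms(3) by blast
qed

text \<open>
  The path \<open>ps\<close> may consist of one vertex, which is the case of four arms of length one. The radical
  vector is \<open>2\<close> on the path and \<open>1\<close> on the four leaves.
\<close>

lemma D_tilde_imp_infinite:
  assumes d: "distinct (ps @ [a, b, c, e])" and v: "set (ps @ [a, b, c, e]) \<subseteq> verts Q" and "ps \<noteq> []"
    and path: "successively (adjacent Q) ps"
    and ends: "adjacent Q (hd ps) a" "adjacent Q (hd ps) b" "adjacent Q (last ps) c" "adjacent Q (last ps) e"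
  shows "infinite (indec_dims TYPE('k::field) Q)"
proof -
  obtain m where m: "length ps = Suc m" using assms(3) by (cases ps) auto
  define par where "par k = (if k \<le> m then k - 1 else if k \<le> m + 2 then 0 else m)" for k
  define \<delta> where "\<delta> k = (if k \<le> m then 2 else 1 :: int)" for k
  have hd: "hd ps = ps ! 0" "last ps = ps ! m"
    using assms(3) m by (simp_all add: hd_conv_nth last_conv_nth)
  show ?thesis
  proof (rule nth_tree_imp_infinite[OF d v, of par \<delta>])
    fix k assume k: "1 \<le> k" "k < length (ps @ [a, b, c, e])"
    then consider "k \<le> m" | "k = m + 1" | "k = m + 2" | "k = m + 3" | "k = m + 4" using m by force
    then show "par k < k \<and> adjacent Q ((ps @ [a, b, c, e]) ! k) ((ps @ [a, b, c, e]) ! par k)"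
    proof cases
      case 1
      then have "adjacent Q (ps ! (k - 1)) (ps ! Suc (k - 1))"
        using successively_nth[OF path, of "k - 1"] m k(1) 1 by auto
      moreover have "k < length ps" "k - 1 < length ps" using 1 m by auto
      ultimately show ?thesis using 1 k(1)
        by (simp add: par_def nth_append adjacent_sym[of Q "ps ! k"])
    qed (use ends hd m in \<open>auto simp: par_def nth_append adjacent_sym\<close>)
  next
    fix i assume "i < length (ps @ [a, b, c, e])"
    then have i: "i < m + 5" using m by simp
    show "\<delta> i > 0" by (simp add: \<delta>_def)
    let ?g = "\<lambda>k. (if par k = i then \<delta> k else 0) + (if k = i then \<delta> (par k) else 0)"
    have "{1..<length (ps @ [a, b, c, e])} = {1..m} \<union> {m + 1, m + 2, m + 3, m + 4}"
      using m by auto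
    then have "(\<Sum>k\<in>{1..<length (ps @ [a, b, c, e])}. ?g k) =
        (\<Sum>k\<in>{1..m}. ?g k) + (?g (m + 1) + ?g (m + 2) + ?g (m + 3) + ?g (m + 4))"
      by (simp add: sum.union_disjoint)
    also have "(\<Sum>k\<in>{1..m}. ?g k) = (\<Sum>k\<in>{1..m}. (if k = Suc i then 2 else 0) + (if k = i then 2 else 0))"
      by (rule sum.cong) (auto simp: par_def \<delta>_def)
    also have "\<dots> = (if i < m then 2 else 0) + (if 1 \<le> i \<and> i \<le> m then 2 else 0)"
      by (simp add: sum.distrib)
    finally show "2 * \<delta> i = (\<Sum>k\<in>{1..<length (ps @ [a, b, c, e])}. ?g k)"
      using i by (auto simp: par_def \<delta>_def)
  qed simp
qed

section \<open>Stars\<close>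

text \<open>
  Arms may be empty, so that paths are stars. The star need not be an induced subgraph.
\<close>

definition star_in :: "('v, 'a) pre_digraph \<Rightarrow> 'v \<Rightarrow> 'v list \<Rightarrow> 'v list \<Rightarrow> 'v list \<Rightarrow> bool" where
  "star_in Q c xs ys zs \<longleftrightarrow> distinct (c # xs @ ys @ zs) \<and> set (c # xs @ ys @ zs) \<subseteq> verts Q \<and>
     successively (adjacent Q) (c # xs) \<and> successively (adjacent Q) (c # ys) \<and>
     successively (adjacent Q) (c # zs)"

lemma star_in_swap: "star_in Q c xs ys zs \<Longrightarrow> star_in Q c ys xs zs"
  and star_in_swap': "star_in Q c xs ys zs \<Longrightarrow> star_in Q c xs zs ys"
  unfolding star_in_def by auto

lemma successively_take: "successively P xs \<Longrightarrow> successively P (take n xs)"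
  by (metis append_take_drop_id successively_append_iff)

lemma star_in_take:
  assumes "star_in Q c xs ys zs"
  shows "star_in Q c (take p xs) (take q ys) (take r zs)"
proof -
  have "successively (adjacent Q) (c # take n l)" if "successively (adjacent Q) (c # l)" for l n
    using successively_take[OF that, of "Suc n"] by simp
  then show ?thesis using assms unfolding star_in_def
    by (auto dest: in_set_takeD)
qed

text \<open>
  The parent function for the numbering that lists the centre and then the arms one after the other.
\<close>

definition star_parent :: "nat \<Rightarrow> nat \<Rightarrow> nat \<Rightarrow> nat" where
  "star_parent p q k = (if k = p + 1 \<or> k = p + q + 1 then 0 else k - 1)"

lemma star_parent_adjacent:
  assumes "star_in Q c xs ys zs" "1 \<le> k" "k < length (c # xs @ ys @ zs)"
  defines "p \<equiv> length xs" and "q \<equiv> length ys"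
  shows "star_parent p q k < k \<and>
    adjacent Q ((c # xs @ ys @ zs) ! k) ((c # xs @ ys @ zs) ! star_parent p q k)"
proof -
  have arm: "adjacent Q (l ! i) (if i = 0 then c else l ! (i - 1))"
    if "successively (adjacent Q) (c # l)" "i < length l" for l i
    using successively_nth[OF that(1), of i] that(2) by (cases i) (auto simp: adjacent_sym)
  have s: "successively (adjacent Q) (c # xs)" "successively (adjacent Q) (c # ys)"
    "successively (adjacent Q) (c # zs)" using assms(1) by (auto simp: star_in_def)
  consider i where "k = Suc i" "i < p" | i where "k = Suc (p + i)" "i < q" |
    i where "k = Suc (p + q + i)" "i < length zs"
  proof (cases "k \<le> p")
    case True
    then show ?thesis using that(1)[of "k - 1"] assms(2) by simp
  next
    case False
    show ?thesis
    proof (cases "k \<le> p + q")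
      case True
      then show ?thesis using that(2)[of "k - p - 1"] False by simp
    next
      case False
      then show ?thesis using that(3)[of "k - p - q - 1"] assms(3) by (simp add: p_def q_def)
    qed
  qed
  then show ?thesis
  proof cases
    case 1
    then show ?thesis using arm[OF s(1), of i]
      by (cases i) (auto simp: star_parent_def p_def q_def nth_append)
  next
    case 2
    then show ?thesis using arm[OF s(2), of i]
      by (cases i) (auto simp: star_parent_def p_def q_def nth_append)
  next
    case 3
    then show ?thesis using arm[OF s(3), of i]
      by (cases i) (auto simp: star_parent_def p_def q_def nth_append)
  qed
qed

text \<open>
  The radical condition for a list of values in this numbering is a closed statement about numbers, so
  that it can be decided by evaluation.
\<close>

lemma star_imp_infinite:
  fixes ds :: "int list"
  assumes s: "star_in Q c xs ys zs" and p: "length xs = p" and q: "length ys = q"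
    and n: "length (c # xs @ ys @ zs) = length ds" and pos: "list_all (\<lambda>x. x > 0) ds"
    and radical: "list_all (\<lambda>i. 2 * ds ! i = (\<Sum>k\<leftarrow>[1..<length ds].
      (if star_parent p q k = i then ds ! k else 0) +
      (if k = i then ds ! star_parent p q k else 0))) [0..<length ds]"
  shows "infinite (indec_dims TYPE('k::field) Q)"
proof (rule nth_tree_imp_infinite)
  show "distinct (c # xs @ ys @ zs)" "set (c # xs @ ys @ zs) \<subseteq> verts Q" "c # xs @ ys @ zs \<noteq> []"
    using s by (auto simp: star_in_def)
  show "star_parent p q k < k \<and> adjacent Q ((c # xs @ ys @ zs) ! k) ((c # xs @ ys @ zs) ! star_parent p q k)"
    if "1 \<le> k" "k < length (c # xs @ ys @ zs)" for k
    using star_parent_adjacent[OF s that] unfolding p q .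
  show "0 < ds ! i" if "i < length (c # xs @ ys @ zs)" for i
    using that pos unfolding n list_all_length by blast
  show "2 * ds ! i = (\<Sum>k\<in>{1..<length (c # xs @ ys @ zs)}.
      (if star_parent p q k = i then ds ! k else 0) + (if k = i then ds ! star_parent p q k else 0))"
    if "i < length (c # xs @ ys @ zs)" for i
  proof -
    have "i \<in> set [0..<length ds]" using that unfolding n by simp
    then show ?thesis using radical unfolding n list_all_iff interv_sum_list_conv_sum_set_nat set_upt by blast
  qed
qed

lemma E6_tilde_imp_infinite:
  assumes "star_in Q c xs ys zs" "length xs = 2" "length ys = 2" "length zs = 2"
  shows "infinite (indec_dims TYPE('k::field) Q)"
proof (rule star_imp_infinite[OF assms(1-3), of "[3, 2, 1, 2, 1, 2, 1]"])
  show "length (c # xs @ ys @ zs) = length ([3, 2, 1, 2, 1, 2, 1] :: int list)" using assms by simp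
qed code_simp+

lemma E7_tilde_imp_infinite:
  assumes "star_in Q c xs ys zs" "length xs = 1" "length ys = 3" "length zs = 3"
  shows "infinite (indec_dims TYPE('k::field) Q)"
proof (rule star_imp_infinite[OF assms(1-3), of "[4, 2, 3, 2, 1, 3, 2, 1]"])
  show "length (c # xs @ ys @ zs) = length ([4, 2, 3, 2, 1, 3, 2, 1] :: int list)" using assms by simp
qed code_simp+

lemma E8_tilde_imp_infinite:
  assumes "star_in Q c xs ys zs" "length xs = 1" "length ys = 2" "length zs = 5"
  shows "infinite (indec_dims TYPE('k::field) Q)"
proof (rule star_imp_infinite[OF assms(1-3), of "[6, 3, 4, 2, 5, 4, 3, 2, 1]"])
  show "length (c # xs @ ys @ zs) = length ([6, 3, 4, 2, 5, 4, 3, 2, 1] :: int list)" using assms by simp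
qed code_simp+

text \<open>
  If the new neighbour \<open>w\<close> is attached at the end of an arm, the arm grows. If it is attached inside
  an arm while one of the other arms is empty, the star is recentred at the point of attachment.
  Otherwise there are two branching points, and \<open>D\<close>-tilde appears.
\<close>

lemma extend_arm:
  assumes s: "star_in Q c xs ys zs" and v: "v \<in> set xs" and w: "w \<in> verts Q" "w \<notin> set (c # xs @ ys @ zs)"
    and adj: "adjacent Q v w" and fin: "finite (indec_dims TYPE('k::field) Q)"
  shows "\<exists>c' xs' ys' zs'. star_in Q c' xs' ys' zs' \<and>
    length (c # xs @ ys @ zs) < length (c' # xs' @ ys' @ zs')"
proof -
  obtain xs1 xs2 where xs: "xs = xs1 @ v # xs2" using v by (meson split_list)
  have path: "successively (adjacent Q) (c # xs1 @ v # xs2)" using s xs by (simp add: star_in_def)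
  show ?thesis
  proof (cases "xs2 = []")
    case True
    then have "successively (adjacent Q) ((c # xs) @ [w])"
      unfolding successively_append_iff using path adj xs by simp
    then have "star_in Q c (xs @ [w]) ys zs" using s w by (auto simp: star_in_def)
    then show ?thesis by (intro exI[of _ c] exI[of _ "xs @ [w]"] exI[of _ ys] exI[of _ zs]) simp
  next
    case False
    have sp: "successively (adjacent Q) (v # xs2)" "successively (adjacent Q) (c # xs1 @ [v])"
      using path successively_append_iff[of "adjacent Q" "c # xs1" "v # xs2"]
        successively_append_iff[of "adjacent Q" "c # xs1" "[v]"] by auto
    have recentre: "star_in Q v xs2 (rev xs1 @ c # us) [w]"
      if "star_in Q c xs us []" "w \<notin> set (c # xs @ us)" for us
    proof -
      have "successively (adjacent Q) (rev (c # xs1 @ [v]))"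
        unfolding successively_rev using sp(2) by (metis (mono_tags, lifting) adjacent_sym successively_mono)
      then have "successively (adjacent Q) (v # rev xs1 @ [c])" by simp
      moreover have "successively (adjacent Q) (c # us)" using that by (simp add: star_in_def)
      ultimately have "successively (adjacent Q) ((v # rev xs1) @ c # us)"
        unfolding successively_append_iff[of _ "v # rev xs1"]
        using successively_append_iff[of "adjacent Q" "v # rev xs1" "[c]"] by auto
      then show ?thesis using that w(1) adj sp(1) xs by (auto simp: star_in_def)
    qed
    consider "zs = []" | "ys = []" | "ys \<noteq> []" "zs \<noteq> []" by blast
    then show ?thesis
    proof cases
      case 1
      then have "star_in Q v xs2 (rev xs1 @ c # ys) [w]" using recentre[of ys] s w by simp
      then show ?thesis using xs 1
        by (intro exI[of _ v] exI[of _ xs2] exI[of _ "rev xs1 @ c # ys"] exI[of _ "[w]"]) simp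
    next
      case 2
      then have "star_in Q v xs2 (rev xs1 @ c # zs) [w]" using recentre[of zs] star_in_swap'[OF s] w by simp
      then show ?thesis using xs 2
        by (intro exI[of _ v] exI[of _ xs2] exI[of _ "rev xs1 @ c # zs"] exI[of _ "[w]"]) simp
    next
      case 3
      obtain x2 xs2' y ys' z zs' where ls: "xs2 = x2 # xs2'" "ys = y # ys'" "zs = z # zs'"
        using 3 False by (metis neq_Nil_conv)
      have "infinite (indec_dims TYPE('k) Q)"
      proof (rule D_tilde_imp_infinite[of "c # xs1 @ [v]" y z x2 w])
        show "distinct ((c # xs1 @ [v]) @ [y, z, x2, w])" "set ((c # xs1 @ [v]) @ [y, z, x2, w]) \<subseteq> verts Q"
          using s w xs ls by (auto simp: star_in_def)
        show "adjacent Q (hd (c # xs1 @ [v])) y" "adjacent Q (hd (c # xs1 @ [v])) z"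
          using s ls by (auto simp: star_in_def)
        show "adjacent Q (last (c # xs1 @ [v])) x2" "adjacent Q (last (c # xs1 @ [v])) w"
          using sp(1) ls adj by auto
      qed (use sp(2) in auto)
      then show ?thesis using fin by blast
    qed
  qed
qed

lemma extend_star:
  assumes s: "star_in Q c xs ys zs" and v: "v \<in> set (c # xs @ ys @ zs)"
    and w: "w \<in> verts Q" "w \<notin> set (c # xs @ ys @ zs)"
    and adj: "adjacent Q v w" and fin: "finite (indec_dims TYPE('k::field) Q)"
  shows "\<exists>c' xs' ys' zs'. star_in Q c' xs' ys' zs' \<and>
    length (c # xs @ ys @ zs) < length (c' # xs' @ ys' @ zs')"
proof -
  consider "v = c" | "v \<in> set xs" | "v \<in> set ys" | "v \<in> set zs" using v by auto
  then show ?thesis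
  proof cases
    case 1
    consider "xs = []" | "ys = []" | "zs = []" | "xs \<noteq> []" "ys \<noteq> []" "zs \<noteq> []" by blast
    then show ?thesis
    proof cases
      case a: 1
      then have "star_in Q c [w] ys zs" using s w adj 1 by (auto simp: star_in_def)
      then show ?thesis using a by (intro exI[of _ c] exI[of _ "[w]"] exI[of _ ys] exI[of _ zs]) simp
    next
      case a: 2
      then have "star_in Q c xs [w] zs" using s w adj 1 by (auto simp: star_in_def)
      then show ?thesis using a by (intro exI[of _ c] exI[of _ "xs"] exI[of _ "[w]"] exI[of _ zs]) simp
    next
      case a: 3
      then have "star_in Q c xs ys [w]" using s w adj 1 by (auto simp: star_in_def)
      then show ?thesis using a by (intro exI[of _ c] exI[of _ "xs"] exI[of _ ys] exI[of _ "[w]"]) simp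
    next
      case a: 4
      obtain x xs' y ys' z zs' where ls: "xs = x # xs'" "ys = y # ys'" "zs = z # zs'"
        using a by (metis neq_Nil_conv)
      have "infinite (indec_dims TYPE('k) Q)"
        by (rule D_tilde_imp_infinite[of "[c]" x y z w]) (use s w ls adj 1 in \<open>auto simp: star_in_def\<close>)
      then show ?thesis using fin by blast
    qed
  next
    case 2
    then show ?thesis using extend_arm[OF s _ w adj fin] by blast
  next
    case 3
    have "w \<notin> set (c # ys @ xs @ zs)" using w(2) by auto
    moreover have "length (c # ys @ xs @ zs) = length (c # xs @ ys @ zs)" by simp
    ultimately show ?thesis using extend_arm[OF star_in_swap[OF s] 3 w(1) _ adj fin] by metis
  next
    case 4
    have "w \<notin> set (c # zs @ xs @ ys)" using w(2) by auto
    moreover have "length (c # zs @ xs @ ys) = length (c # xs @ ys @ zs)" by simp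
    ultimately show ?thesis
      using extend_arm[OF star_in_swap[OF star_in_swap'[OF s]] 4 w(1) _ adj fin] by metis
  qed
qed

text \<open>
  Take a star with the greatest number of vertices. By connectedness an arrow would lead out of it if it
  were not spanning, and then it could be enlarged.
\<close>

theorem spanning_star_exists:
  assumes Q: "fin_digraph Q" "verts Q \<noteq> {}" "linked Q (arcs Q)"
    and fin: "finite (indec_dims TYPE('k::field) Q)"
  obtains c xs ys zs where "star_in Q c xs ys zs" "set (c # xs @ ys @ zs) = verts Q"
    "length xs \<le> length ys" "length ys \<le> length zs"
proof -
  have wf: "finite (verts Q)" "\<And>a. a \<in> arcs Q \<Longrightarrow> tail Q a \<in> verts Q \<and> head Q a \<in> verts Q"
    using Q(1) by (auto simp: fin_digraph_def fin_digraph_axioms_def wf_digraph_def)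
  let ?P = "\<lambda>n. \<exists>c xs ys zs. star_in Q c xs ys zs \<and> length (c # xs @ ys @ zs) = n"
  obtain v where "v \<in> verts Q" using Q(2) by blast
  then have "star_in Q v [] [] []" by (simp add: star_in_def)
  then have ex: "?P 1" by force
  have bound: "n \<le> card (verts Q)" if "?P n" for n
    using that wf(1) unfolding star_in_def by (metis card_mono distinct_card)
  define n where "n = (GREATEST n. ?P n)"
  have "?P n" unfolding n_def by (rule GreatestI_nat[where b = "card (verts Q)"]) (use ex bound in blast)+
  then obtain c xs ys zs where s: "star_in Q c xs ys zs" and n: "length (c # xs @ ys @ zs) = n"
    by blast
  have max: "m \<le> n" if "?P m" for m
    unfolding n_def by (rule Greatest_le_nat[where b = "card (verts Q)"]) (use that bound in blast)+
  let ?S = "set (c # xs @ ys @ zs)"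
  have span: "?S = verts Q"
  proof (rule ccontr)
    assume "?S \<noteq> verts Q"
    moreover have sub: "?S \<subseteq> verts Q" using s by (simp add: star_in_def)
    ultimately obtain w0 where w0: "w0 \<in> verts Q" "w0 \<notin> ?S" by blast
    have "\<exists>b\<in>arcs Q. (tail Q b \<in> ?S) \<noteq> (head Q b \<in> ?S)"
    proof (rule ccontr)
      assume "\<not> ?thesis"
      then have "\<And>b. b \<in> arcs Q \<Longrightarrow> (tail Q b \<in> ?S) = (head Q b \<in> ?S)" by blast
      moreover have "c \<in> verts Q" using sub by simp
      ultimately have "(c \<in> ?S) = (w0 \<in> ?S)"
        by (rule linkedD[OF Q(3), of "\<lambda>v. v \<in> ?S" c w0]) (assumption | rule w0(1))+
      then show False using w0 by simp
    qed
    then obtain b where b: "b \<in> arcs Q" "(tail Q b \<in> ?S) \<noteq> (head Q b \<in> ?S)" by blast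
    then obtain v w where "v \<in> ?S" "w \<in> verts Q" "w \<notin> ?S" "adjacent Q v w"
    proof (cases "tail Q b \<in> ?S")
      case True
      have "adjacent Q (tail Q b) (head Q b)" using b(1) by (auto simp: adjacent_def)
      then show ?thesis using that[OF True, of "head Q b"] b wf(2) True by blast
    next
      case False
      have "adjacent Q (head Q b) (tail Q b)" using b(1) by (auto simp: adjacent_def)
      then show ?thesis using that[of "head Q b" "tail Q b"] b wf(2) False by blast
    qed
    from extend_star[OF s this fin] max n show False by (metis not_le)
  qed
  have perms: "star_in Q c us vs ws \<Longrightarrow> set (c # us @ vs @ ws) = verts Q \<Longrightarrow> length us \<le> length vs \<Longrightarrow>
      length vs \<le> length ws \<Longrightarrow> thesis" for us vs ws
    using that by blast
  note s' = star_in_swap'[OF s] star_in_swap[OF s] star_in_swap'[OF star_in_swap[OF s]]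
    star_in_swap[OF star_in_swap'[OF s]] star_in_swap'[OF star_in_swap[OF star_in_swap'[OF s]]]
  let ?x = "length xs" and ?y = "length ys" and ?z = "length zs"
  consider "?x \<le> ?y" "?y \<le> ?z" | "?x \<le> ?z" "?z \<le> ?y" | "?y \<le> ?x" "?x \<le> ?z" |
    "?y \<le> ?z" "?z \<le> ?x" | "?z \<le> ?x" "?x \<le> ?y" | "?z \<le> ?y" "?y \<le> ?x" by linarith
  then show ?thesis
  proof cases
    case 1
    show ?thesis by (rule perms[OF s span 1])
  next
    case 2
    show ?thesis by (rule perms[OF s'(1) _ 2]) (use span in auto)
  next
    case 3
    show ?thesis by (rule perms[OF s'(2) _ 3]) (use span in auto)
  next
    case 4
    show ?thesis by (rule perms[OF s'(3) _ 4]) (use span in auto)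
  next
    case 5
    show ?thesis by (rule perms[OF s'(4) _ 5]) (use span in auto)
  next
    case 6
    show ?thesis by (rule perms[OF s'(5) _ 6]) (use span in auto)
  qed
qed

section \<open>The underlying graph of a quiver of finite type\<close>

fun edge_set :: "'v list \<Rightarrow> 'v set set" where
  "edge_set (x # y # l) = insert {x, y} (edge_set (y # l))"
| "edge_set _ = {}"

lemma edge_set_conv_nth: "edge_set l = {{l ! i, l ! Suc i} | i. Suc i < length l}"
proof (induction l rule: edge_set.induct)
  case (1 x y l)
  have "{{(x # y # l) ! i, (x # y # l) ! Suc i} | i. Suc i < length (x # y # l)} =
     insert {x, y} {{(y # l) ! i, (y # l) ! Suc i} | i. Suc i < length (y # l)}" (is "?A = ?B")
  proof
    show "?A \<subseteq> ?B"
    proof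
      fix e assume "e \<in> ?A"
      then obtain i where i: "e = {(x # y # l) ! i, (x # y # l) ! Suc i}" "Suc i < length (x # y # l)" by blast
      then show "e \<in> ?B" by (cases i) auto
    qed
    show "?B \<subseteq> ?A"
    proof
      fix e assume "e \<in> ?B"
      then consider "e = {x, y}" | i where "e = {(y # l) ! i, (y # l) ! Suc i}" "Suc i < length (y # l)" by blast
      then show "e \<in> ?A"
      proof cases
        case 1
        then show ?thesis by (intro CollectI exI[of _ 0]) auto
      next
        case 2
        then show ?thesis by (intro CollectI exI[of _ "Suc i"]) auto
      qed
    qed
  qed
  then show ?case using 1 by simp
qed auto

lemma edge_set_append: "edge_set (l1 @ x # l2) = edge_set (l1 @ [x]) \<union> edge_set (x # l2)"
proof (induction l1)
  case (Cons a l1)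
  then show ?case by (cases l1) auto
qed simp

lemma edge_set_rev: "edge_set (rev l) = edge_set l"
proof (induction l rule: edge_set.induct)
  case (1 x y l)
  have "edge_set (rev (x # y # l)) = edge_set (rev l @ [y]) \<union> edge_set [y, x]"
    using edge_set_append[of "rev l" y "[x]"] by simp
  then show ?case using 1 by (auto simp: insert_commute)
qed auto

definition star_edges :: "'v \<Rightarrow> 'v list \<Rightarrow> 'v list \<Rightarrow> 'v list \<Rightarrow> 'v set set" where
  "star_edges c xs ys zs = edge_set (c # xs) \<union> edge_set (c # ys) \<union> edge_set (c # zs)"

lemma edge_set_constant:
  assumes "\<And>u v. {u, v} \<in> edge_set l \<Longrightarrow> P u = P v" "v \<in> set l"
  shows "P v = P (hd l)"
  using assms
proof (induction l rule: edge_set.induct)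
  case (1 x y l)
  have "P x = P y" using 1(2)[of x y] by simp
  moreover have "P v = P (hd (y # l))" if "v \<in> set (y # l)"
    using 1(1)[OF 1(2) that] by simp
  ultimately show ?case using 1(3) by auto
qed auto

text \<open>
  An arrow that is not needed for the edges of a spanning star, because its edge is not among them or
  because a second arrow has the same edge, could be deleted without disconnecting the quiver.
\<close>

lemma arcs_bij_star_edges:
  assumes Q: "fin_digraph Q" and s: "star_in Q c xs ys zs" and span: "set (c # xs @ ys @ zs) = verts Q"
    and fin: "finite (indec_dims TYPE('k::field) Q)"
  shows "bij_betw (\<lambda>a. {tail Q a, head Q a}) (arcs Q) (star_edges c xs ys zs)"
proof -
  let ?e = "\<lambda>a. {tail Q a, head Q a}"
  have no_removable: False if a: "a \<in> arcs Q" and edges: "\<forall>e\<in>star_edges c xs ys zs. \<exists>b\<in>arcs Q - {a}. ?e b = e" for a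
  proof -
    have "linked Q (arcs Q - {a})"
      unfolding linked_def
    proof (intro allI impI ballI)
      fix P :: "'a \<Rightarrow> bool" and u v
      assume P: "\<forall>b\<in>arcs Q - {a}. P (tail Q b) = P (head Q b)" and uv: "u \<in> verts Q" "v \<in> verts Q"
      have eq: "P x = P y" if "{x, y} \<in> star_edges c xs ys zs" for x y
      proof -
        from bspec[OF edges that] obtain b where "b \<in> arcs Q - {a}" "?e b = {x, y}" by (rule bexE)
        then show ?thesis using P by (auto simp: doubleton_eq_iff)
      qed
      have "P v = P c" if "v \<in> verts Q" for v
      proof -
        have "v \<in> set (c # xs @ ys @ zs)" using that by (simp only: span)
        then consider "v \<in> set (c # xs)" | "v \<in> set (c # ys)" | "v \<in> set (c # zs)"
          by auto
        then show ?thesis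
        proof cases
          case 1
          show ?thesis using edge_set_constant[of "c # xs" P v] eq 1 by (simp add: star_edges_def)
        next
          case 2
          show ?thesis using edge_set_constant[of "c # ys" P v] eq 2 by (simp add: star_edges_def)
        next
          case 3
          show ?thesis using edge_set_constant[of "c # zs" P v] eq 3 by (simp add: star_edges_def)
        qed
      qed
      then show "P u = P v" using uv by metis
    qed
    then show False using removable_arc_imp_infinite[OF Q a] fin by blast
  qed
  have real: "\<exists>b\<in>arcs Q. ?e b = e" if "e \<in> star_edges c xs ys zs" for e
  proof -
    obtain l where l: "successively (adjacent Q) l" "e \<in> edge_set l"
      using \<open>e \<in> star_edges c xs ys zs\<close> s unfolding star_edges_def star_in_def by blast
    then obtain i where i: "e = {l ! i, l ! Suc i}" "Suc i < length l"
      unfolding edge_set_conv_nth by blast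
    then show ?thesis using successively_nth[OF l(1), of i] by (simp add: adjacent_def)
  qed
  show ?thesis
    unfolding bij_betw_def
  proof
    show "inj_on ?e (arcs Q)"
    proof (rule inj_onI, rule ccontr)
      fix a b assume ab: "a \<in> arcs Q" "b \<in> arcs Q" "?e a = ?e b" "a \<noteq> b"
      have "\<exists>b\<in>arcs Q - {a}. ?e b = e" if "e \<in> star_edges c xs ys zs" for e
        using real[OF that] ab by (cases "e = ?e a") (metis Diff_iff singletonD, metis Diff_iff singletonD)
      then show False using no_removable[OF ab(1)] by blast
    qed
    show "?e ` arcs Q = star_edges c xs ys zs"
    proof
      show "?e ` arcs Q \<subseteq> star_edges c xs ys zs"
      proof (rule image_subsetI, rule ccontr)
        fix a assume a: "a \<in> arcs Q" "?e a \<notin> star_edges c xs ys zs"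
        have "\<exists>b\<in>arcs Q - {a}. ?e b = e" if "e \<in> star_edges c xs ys zs" for e
          using real[OF that] a(2) that by (metis Diff_iff singletonD)
        then show False using no_removable[OF a(1)] by blast
      qed
      show "star_edges c xs ys zs \<subseteq> ?e ` arcs Q" using real by blast
    qed
  qed
qed

lemma underlying_graph_isoI:
  assumes L: "distinct L" "set L = verts Q" and e: "bij_betw (\<lambda>a. {tail Q a, head Q a}) (arcs Q) E'"
    and E': "E' = (\<lambda>e. (!) L ` e) ` E" and E: "\<And>e. e \<in> E \<Longrightarrow> e \<subseteq> {..<length L}"
  shows "underlying_graph_iso Q ({..<length L}, E)"
proof -
  define f where "f = the_inv_into {..<length L} ((!) L)"
  have inj: "inj_on ((!) L) {..<length L}" using L(1) by (simp add: inj_on_nth)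
  have img: "(!) L ` {..<length L} = verts Q" using L(2) by (auto simp: set_conv_nth)
  have fL: "f (L ! i) = i" if "i < length L" for i
    using inj that by (simp add: f_def the_inv_into_f_f)
  have "bij_betw f (verts Q) {..<length L}"
    unfolding f_def using inj img by (intro bij_betw_the_inv_into) (simp add: bij_betw_def)
  moreover have "bij_betw ((`) f) E' E"
  proof (rule bij_betw_byWitness[where f' = "\<lambda>e. (!) L ` e"])
    have fLe: "f ` ((!) L ` e) = e" if "e \<in> E" for e
      using E[OF that] fL by (force simp: image_image subset_eq)
    then show "\<forall>e\<in>E. f ` (!) L ` e = e" by blast
    show "\<forall>e\<in>E'. (!) L ` f ` e = e" using fLe by (auto simp: E')
    show "(`) f ` E' \<subseteq> E" using fLe by (auto simp: E')
    show "(\<lambda>e. (!) L ` e) ` E \<subseteq> E'" by (simp add: E')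
  qed
  then have "bij_betw ((`) f \<circ> (\<lambda>a. {tail Q a, head Q a})) (arcs Q) E"
    by (rule bij_betw_trans[OF e])
  then have "bij_betw (\<lambda>a. {f (tail Q a), f (head Q a)}) (arcs Q) E"
    by (simp add: o_def)
  ultimately show ?thesis unfolding underlying_graph_iso_def by auto
qed

lemma image_consecutive: "(`) h ` {{i, Suc i} | i. P i} = {{h i, h (Suc i)} | i. P i}"
  unfolding setcompr_eq_image image_image by simp

lemma path_graph_iso:
  assumes s: "star_in Q c [] ys zs" and span: "set (c # ys @ zs) = verts Q"
    and e: "bij_betw (\<lambda>a. {tail Q a, head Q a}) (arcs Q) (star_edges c [] ys zs)"
  shows "underlying_graph_iso Q (path_graph (length ys + length zs + 1))"
proof -
  let ?L = "rev ys @ c # zs"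
  have len: "length ?L = length ys + length zs + 1" by simp
  have "star_edges c [] ys zs = edge_set ?L"
    using edge_set_append[of "rev ys" c zs] edge_set_rev[of "c # ys"] by (simp add: star_edges_def)
  also have "\<dots> = (\<lambda>e. (!) ?L ` e) ` snd (path_graph (length ?L))"
    unfolding edge_set_conv_nth path_graph_def snd_conv image_consecutive by (rule refl)
  finally have "underlying_graph_iso Q ({..<length ?L}, snd (path_graph (length ?L)))"
    using s span by (intro underlying_graph_isoI[OF _ _ e]) (auto simp: star_in_def path_graph_def)
  then show ?thesis unfolding len path_graph_def by simp
qed

lemma star_graph_iso:
  assumes s: "star_in Q c xs ys zs" and span: "set (c # xs @ ys @ zs) = verts Q" and "zs \<noteq> []"
    and e: "bij_betw (\<lambda>a. {tail Q a, head Q a}) (arcs Q) (star_edges c xs ys zs)"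
  shows "underlying_graph_iso Q (star_graph (length xs) (length ys) (length zs))"
proof -
  define p q r where "p = length xs" and "q = length ys" and "r = length zs"
  let ?L1 = "rev xs @ c # ys"
  let ?L = "?L1 @ zs"
  have len: "length ?L = Suc (p + q + r)" "length ?L1 = Suc (p + q)" by (simp_all add: p_def q_def r_def)
  have r: "r > 0" using assms(3) by (simp add: r_def)
  have L1: "?L ! i = ?L1 ! i" if "i < Suc (p + q)" for i
    using that len(2) by (subst nth_append) simp
  have L2: "?L ! (Suc (p + q) + i) = zs ! i" for i
    using len(2) nth_append_length_plus[of ?L1 zs i] by (simp only:)
  have Lp: "?L ! p = c" by (simp add: nth_append p_def)
  have zs: "edge_set (c # zs) = insert {c, zs ! 0} (edge_set zs)" using assms(3) by (cases zs) auto
  have "star_edges c xs ys zs = edge_set ?L1 \<union> edge_set zs \<union> {{c, zs ! 0}}"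
    using edge_set_append[of "rev xs" c ys] edge_set_rev[of "c # xs"] zs by (auto simp: star_edges_def)
  also have "edge_set ?L1 = {{?L ! i, ?L ! Suc i} | i. i < p + q}"
    unfolding edge_set_conv_nth len(2) using L1 by (intro Collect_cong) (metis Suc_less_eq less_SucI)
  also have "edge_set zs = {{?L ! i, ?L ! Suc i} | i. p + q < i \<and> i < p + q + r}" (is "_ = ?R")
  proof
    show "edge_set zs \<subseteq> ?R"
    proof
      fix e assume "e \<in> edge_set zs"
      then obtain i where i: "e = {zs ! i, zs ! Suc i}" "Suc i < r" by (auto simp: edge_set_conv_nth r_def)
      then have "e = {?L ! (Suc (p + q) + i), ?L ! Suc (Suc (p + q) + i)}"
        using L2[of i] L2[of "Suc i"] by simp
      then show "e \<in> ?R" using i(2) by (intro CollectI exI[of _ "Suc (p + q) + i"]) simp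
    qed
    show "?R \<subseteq> edge_set zs"
    proof
      fix e assume "e \<in> ?R"
      then obtain i where i: "e = {?L ! i, ?L ! Suc i}" "p + q < i" "i < p + q + r" by blast
      define k where "k = i - Suc (p + q)"
      have "i = Suc (p + q) + k" using i(2) by (simp add: k_def)
      then have "e = {zs ! k, zs ! Suc k}" "Suc k < r"
        using i L2[of k] L2[of "Suc k"] by simp_all
      then show "e \<in> edge_set zs" by (auto simp: edge_set_conv_nth r_def)
    qed
  qed
  also have "{{c, zs ! 0}} = {{?L ! p, ?L ! Suc (p + q)}}" using Lp L2[of 0] by simp
  also have "{{?L ! i, ?L ! Suc i} | i. i < p + q} \<union> {{?L ! i, ?L ! Suc i} | i. p + q < i \<and> i < p + q + r} \<union>
      {{?L ! p, ?L ! Suc (p + q)}} =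
      {{?L ! i, ?L ! Suc i} | i. i < p + q + r \<and> i \<noteq> p + q} \<union> {{?L ! p, ?L ! Suc (p + q)}}"
    by (intro arg_cong2[of _ _ _ _ "(\<union>)"]) (auto, (metis linorder_neqE_nat trans_less_add1)+)
  also have "\<dots> = (\<lambda>e. (!) ?L ` e) ` snd (star_graph p q r)"
    unfolding star_graph_def snd_conv image_Un image_insert image_empty image_consecutive by (rule refl)
  finally have "underlying_graph_iso Q ({..<length ?L}, snd (star_graph p q r))"
    using s span r len(1) by (intro underlying_graph_isoI[OF _ _ e]) (auto simp: star_in_def star_graph_def)
  then show ?thesis unfolding len(1) star_graph_def p_def q_def r_def by (simp add: lessThan_Suc_atMost)
qed

theorem finite_imp_dynkin:
  assumes Q: "fin_digraph Q" "verts Q \<noteq> {}" "linked Q (arcs Q)"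
    and fin: "finite (indec_dims TYPE('k::field) Q)"
  shows "\<exists>G\<in>dynkin_diagrams. underlying_graph_iso Q G"
proof -
  obtain c xs ys zs where s: "star_in Q c xs ys zs" and span: "set (c # xs @ ys @ zs) = verts Q" and
    len: "length xs \<le> length ys" "length ys \<le> length zs"
    using spanning_star_exists[OF Q fin] by metis
  note e = arcs_bij_star_edges[OF Q(1) s span fin]
  have "\<not> (length xs \<ge> 2)"
  proof
    assume "length xs \<ge> 2"
    then have "infinite (indec_dims TYPE('k) Q)"
      using len by (intro E6_tilde_imp_infinite[OF star_in_take[OF s, of 2 2 2]]) auto
    then show False using fin by blast
  qed
  moreover have "\<not> (length xs = 1 \<and> length ys \<ge> 3)"
  proof
    assume "length xs = 1 \<and> length ys \<ge> 3"
    then have "infinite (indec_dims TYPE('k) Q)"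
      using len by (intro E7_tilde_imp_infinite[OF star_in_take[OF s, of 1 3 3]]) auto
    then show False using fin by blast
  qed
  moreover have "\<not> (length xs = 1 \<and> length ys = 2 \<and> length zs \<ge> 5)"
  proof
    assume "length xs = 1 \<and> length ys = 2 \<and> length zs \<ge> 5"
    then have "infinite (indec_dims TYPE('k) Q)"
      using len by (intro E8_tilde_imp_infinite[OF star_in_take[OF s, of 1 2 5]]) auto
    then show False using fin by blast
  qed
  ultimately consider "length xs = 0" | "length xs = 1" "length ys = 1" "length zs \<ge> 1" |
    "length xs = 1" "length ys = 2" "2 \<le> length zs" "length zs \<le> 4"
    using len by linarith
  then show ?thesis
  proof cases
    case 1
    then have "underlying_graph_iso Q (path_graph (length ys + length zs + 1))"
      using path_graph_iso[of Q c ys zs] s span e by simp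
    then show ?thesis unfolding dynkin_diagrams_def by fastforce
  next
    case 2
    then have "underlying_graph_iso Q (star_graph 1 1 (length zs + 3 - 3))"
      using star_graph_iso[OF s span _ e] by force
    moreover have "star_graph 1 1 (length zs + 3 - 3) \<in> dynkin_diagrams"
      unfolding dynkin_diagrams_def using 2(3)
      by (intro UnI1 UnI2 CollectI exI[of _ "length zs + 3"]) simp
    ultimately show ?thesis by blast
  next
    case 3
    then have "underlying_graph_iso Q (star_graph 1 2 (length zs))"
      using star_graph_iso[OF s span _ e] by force
    moreover have "star_graph 1 2 (length zs) \<in> dynkin_diagrams"
    proof -
      have "length zs \<in> {2, 3, 4}" using 3(3,4) by auto
      then show ?thesis unfolding dynkin_diagrams_def by auto
    qed
    ultimately show ?thesis by blast
  qed
qed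

section \<open>Dynkin diagrams have positive definite forms\<close>

lemma tree_in_of_graph_iso:
  assumes Q: "fin_digraph Q" and iso: "underlying_graph_iso Q ({..<n}, (\<lambda>k. {k, par k}) ` {1..<n})"
    and par: "\<And>k. 1 \<le> k \<Longrightarrow> k < n \<Longrightarrow> par k < k"
  obtains f g where "tree_in Q n par f g" "f ` {..<n} = verts Q" "g ` {1..<n} = arcs Q"
proof -
  note wf = arc_ends[OF Q]
  obtain h where h: "bij_betw h (verts Q) {..<n}" and
    e: "bij_betw (\<lambda>a. {h (tail Q a), h (head Q a)}) (arcs Q) ((\<lambda>k. {k, par k}) ` {1..<n})"
    using iso by (auto simp: underlying_graph_iso_def)
  let ?e = "\<lambda>a. {h (tail Q a), h (head Q a)}"
  define f where "f = the_inv_into (verts Q) h"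
  define g where "g k = the_inv_into (arcs Q) ?e {k, par k}" for k
  have f: "bij_betw f {..<n} (verts Q)" unfolding f_def by (rule bij_betw_the_inv_into[OF h])
  have fh: "f (h v) = v" if "v \<in> verts Q" for v
    using h that by (simp add: f_def bij_betw_def the_inv_into_f_f)
  have g: "g k \<in> arcs Q" "?e (g k) = {k, par k}" if "k \<in> {1..<n}" for k
  proof -
    have "bij_betw (the_inv_into (arcs Q) ?e) ((\<lambda>k. {k, par k}) ` {1..<n}) (arcs Q)"
      by (rule bij_betw_the_inv_into[OF e])
    then show "g k \<in> arcs Q" using that unfolding g_def bij_betw_def by blast
    show "?e (g k) = {k, par k}"
      unfolding g_def by (rule f_the_inv_into_f_bij_betw[OF e]) (use that in blast)
  qed
  have ends: "{tail Q (g k), head Q (g k)} = {f k, f (par k)}" if "k \<in> {1..<n}" for k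
  proof -
    have "{tail Q (g k), head Q (g k)} = f ` ?e (g k)"
      using fh wf[OF g(1)[OF that]] by simp
    then show ?thesis using g(2)[OF that] by simp
  qed
  have "tree_in Q n par f g"
    using f g(1) ends par unfolding tree_in_def bij_betw_def by auto
  moreover have "arcs Q \<subseteq> g ` {1..<n}"
  proof
    fix a assume a: "a \<in> arcs Q"
    then obtain k where k: "k \<in> {1..<n}" "?e a = {k, par k}"
      using e unfolding bij_betw_def by blast
    have "inj_on ?e (arcs Q)" using e by (simp add: bij_betw_def)
    then have "a = g k" using g[OF k(1)] k(2) a by (metis (mono_tags, lifting) inj_on_def)
    then show "a \<in> g ` {1..<n}" using k(1) by blast
  qed
  then have "g ` {1..<n} = arcs Q" using g(1) by auto
  ultimately show ?thesis using that f by (simp add: bij_betw_def)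
qed

definition tree_form :: "nat \<Rightarrow> (nat \<Rightarrow> nat) \<Rightarrow> (nat \<Rightarrow> int) \<Rightarrow> int" where
  "tree_form n par y = (\<Sum>k<n. y k * y k) - (\<Sum>k\<in>{1..<n}. y k * y (par k))"

lemma tits_form_tree:
  assumes "tree_in Q n par f g" "f ` {..<n} = verts Q" "g ` {1..<n} = arcs Q"
  shows "tits_form Q x = tree_form n par (\<lambda>k. x (f k))"
proof -
  have inj: "inj_on f {..<n}" using assms(1) by (simp add: tree_in_def)
  have "x (tail Q (g k)) * x (head Q (g k)) = x (f k) * x (f (par k))" if "k \<in> {1..<n}" for k
  proof -
    have "{tail Q (g k), head Q (g k)} = {f k, f (par k)}" using assms(1) that unfolding tree_in_def by blast
    then show ?thesis by (auto simp: doubleton_eq_iff mult.commute)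
  qed
  then have "(\<Sum>k\<in>{1..<n}. x (tail Q (g k)) * x (head Q (g k))) = (\<Sum>k\<in>{1..<n}. x (f k) * x (f (par k)))"
    by (rule sum.cong[OF refl])
  then show ?thesis
    unfolding tits_form_def tree_form_def assms(2,3)[symmetric]
      sum.reindex[OF inj] sum.reindex[OF tree_in_inj[OF assms(1)]] o_apply by (simp only:)
qed

text \<open>
  The contribution to the Tits form of an arm with \<open>m\<close> vertices, where \<open>y 0\<close> is the value at the vertex
  to which the arm is attached.
\<close>

fun arm_form :: "(nat \<Rightarrow> int) \<Rightarrow> nat \<Rightarrow> int" where
  "arm_form y 0 = 0"
| "arm_form y (Suc m) = y 1 * y 1 - y 1 * y 0 + arm_form (\<lambda>i. y (Suc i)) m"

lemma arm_form_conv_sum: "arm_form y m = (\<Sum>i\<in>{1..m}. y i * y i - y i * y (i - 1))"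
proof (induction m arbitrary: y)
  case (Suc m)
  have "(\<Sum>i\<in>{1..Suc m}. y i * y i - y i * y (i - 1)) =
      y 1 * y 1 - y 1 * y 0 + (\<Sum>i\<in>{Suc 1..Suc m}. y i * y i - y i * y (i - 1))"
    by (subst sum.atLeast_Suc_atMost) auto
  also have "(\<Sum>i\<in>{Suc 1..Suc m}. y i * y i - y i * y (i - 1)) =
      (\<Sum>i\<in>{1..m}. y (Suc i) * y (Suc i) - y (Suc i) * y i)"
    by (simp only: sum.shift_bounds_cl_Suc_ivl diff_Suc_1)
  also have "\<dots> = (\<Sum>i\<in>{1..m}. y (Suc i) * y (Suc i) - y (Suc i) * y (Suc (i - 1)))"
    by (rule sum.cong) auto
  finally show ?case using Suc[of "\<lambda>i. y (Suc i)"] by simp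
qed simp

text \<open>
  In a star the first arm is numbered towards the centre, so its sum has to be read backwards.
\<close>

lemma arm_form_reverse: "y p * y p + arm_form (\<lambda>i. y (p - i)) p = y 0 * y 0 + arm_form y p"
proof (induction p)
  case (Suc p)
  have "arm_form y (Suc p) = arm_form y p + (y (Suc p) * y (Suc p) - y (Suc p) * y p)"
    unfolding arm_form_conv_sum by simp
  moreover have "arm_form (\<lambda>i. y (Suc p - i)) (Suc p) = y p * y p - y p * y (Suc p) + arm_form (\<lambda>i. y (p - i)) p"
    by simp
  ultimately show ?case using Suc by (simp add: mult.commute)
qed simp

text \<open>
  Complete the square in \<open>y 1\<close>, after bounding the rest of the arm by induction.
\<close>

lemma arm_form_bound: "- (real m / (2 * (real m + 1))) * (real_of_int (y 0))\<^sup>2 \<le> real_of_int (arm_form y m)"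
proof (induction m arbitrary: y)
  case (Suc m)
  define a b where "a = real_of_int (y 0)" and "b = real_of_int (y 1)"
  define c where "c = (real m + 2) / (2 * (real m + 1))"
  have c: "c > 0" by (simp add: c_def)
  have "0 \<le> c * (b - a / (2 * c))\<^sup>2" using c by simp
  also have "\<dots> = c * b\<^sup>2 - a * b + a\<^sup>2 / (4 * c)"
    using c by (simp add: power2_eq_square field_simps)
  finally have "- (1 / (4 * c)) * a\<^sup>2 \<le> c * b\<^sup>2 - a * b" by simp
  moreover have "1 / (4 * c) = real (Suc m) / (2 * (real (Suc m) + 1))"
    by (simp add: c_def field_simps)
  moreover have "c * b\<^sup>2 = b\<^sup>2 - real m / (2 * (real m + 1)) * b\<^sup>2"
    by (simp add: c_def field_simps)
  moreover have "- (real m / (2 * (real m + 1))) * b\<^sup>2 \<le> real_of_int (arm_form (\<lambda>i. y (Suc i)) m)"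
    using Suc[of "\<lambda>i. y (Suc i)"] by (simp add: b_def)
  moreover have "real_of_int (arm_form y (Suc m)) = b\<^sup>2 - a * b + real_of_int (arm_form (\<lambda>i. y (Suc i)) m)"
    by (simp add: a_def b_def power2_eq_square)
  ultimately show ?case by (simp add: a_def)
qed simp

lemma arm_form_nonneg:
  assumes "y 0 = 0"
  shows "arm_form y m \<ge> 0" and "arm_form y m = 0 \<Longrightarrow> i \<le> m \<Longrightarrow> y i = 0"
proof -
  show nonneg: "arm_form y m \<ge> 0"
    using arm_form_bound[of m y] assms by simp
  show "y i = 0" if "arm_form y m = 0" "i \<le> m"
    using assms that
  proof (induction m arbitrary: y i)
    case (Suc m)
    have bound: "real m / (2 * (real m + 1)) < 1" by (simp add: field_simps)
    have "real_of_int (arm_form (\<lambda>i. y (Suc i)) m) = - (real_of_int (y 1))\<^sup>2"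
    proof -
      have "arm_form (\<lambda>i. y (Suc i)) m = - (y 1 * y 1)" using Suc.prems(1,2) by simp
      then show ?thesis by (simp only: power2_eq_square of_int_minus of_int_mult)
    qed
    then have "(1 - real m / (2 * (real m + 1))) * (real_of_int (y 1))\<^sup>2 \<le> 0"
      using arm_form_bound[of m "\<lambda>i. y (Suc i)"] by (simp add: left_diff_distrib)
    then have "(real_of_int (y 1))\<^sup>2 \<le> 0" using bound by (simp add: mult_le_0_iff)
    then have y1: "y 1 = 0" by simp
    then have "arm_form (\<lambda>i. y (Suc i)) m = 0" using Suc.prems(2) by simp
    then show ?case
      using Suc.IH[of "\<lambda>i. y (Suc i)" "i - 1"] y1 Suc.prems(1,3) by (cases i) auto
  qed simp
qed

lemma tree_form_path: "tree_form (Suc m) (\<lambda>k. k - 1) y = y 0 * y 0 + arm_form y m"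
proof -
  have "(\<Sum>k<Suc m. y k * y k) = y 0 * y 0 + (\<Sum>k\<in>{1..m}. y k * y k)"
    by (simp add: lessThan_Suc_atMost atMost_atLeast0 sum.atLeast_Suc_atMost)
  moreover have "{1..<Suc m} = {1..m}" by auto
  ultimately show ?thesis by (simp add: tree_form_def arm_form_conv_sum sum_subtractf)
qed

definition star_graph_parent :: "nat \<Rightarrow> nat \<Rightarrow> nat \<Rightarrow> nat" where
  "star_graph_parent p q k = (if k = Suc (p + q) then p else k - 1)"

lemma tree_form_star:
  assumes "n = Suc (p + q + r)"
  shows "tree_form n (star_graph_parent p q) y = y p * y p + arm_form (\<lambda>i. y (p - i)) p +
    arm_form (\<lambda>i. y (p + i)) q + arm_form (\<lambda>i. if i = 0 then y p else y (p + q + i)) r"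
proof -
  let ?t = "\<lambda>k. y k * y k - y k * y (star_graph_parent p q k)"
  have "(\<Sum>k<n. y k * y k) = y 0 * y 0 + (\<Sum>k\<in>{1..p + q + r}. y k * y k)"
    unfolding assms by (simp add: lessThan_Suc_atMost atMost_atLeast0 sum.atLeast_Suc_atMost)
  moreover have "{1..<n} = {1..p + q + r}" using assms by auto
  ultimately have "tree_form n (star_graph_parent p q) y = y 0 * y 0 + (\<Sum>k\<in>{1..p + q + r}. ?t k)"
    by (simp add: tree_form_def sum_subtractf)
  also have "(\<Sum>k\<in>{1..p + q + r}. ?t k) = (\<Sum>k\<in>{1..p}. ?t k) + (\<Sum>k\<in>{p + 1..p + q}. ?t k) +
      (\<Sum>k\<in>{p + q + 1..p + q + r}. ?t k)"
  proof -
    have "(\<Sum>k\<in>{1..p + q + r}. ?t k) = (\<Sum>k\<in>{1..p + q}. ?t k) + (\<Sum>k\<in>{p + q + 1..p + q + r}. ?t k)"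
      by (rule sum.ub_add_nat) simp
    moreover have "(\<Sum>k\<in>{1..p + q}. ?t k) = (\<Sum>k\<in>{1..p}. ?t k) + (\<Sum>k\<in>{p + 1..p + q}. ?t k)"
      by (rule sum.ub_add_nat) simp
    ultimately show ?thesis by (simp only:)
  qed
  also have "(\<Sum>k\<in>{1..p}. ?t k) = arm_form y p"
    unfolding arm_form_conv_sum by (rule sum.cong) (auto simp: star_graph_parent_def)
  also have "(\<Sum>k\<in>{p + 1..p + q}. ?t k) = (\<Sum>i\<in>{1..q}. ?t (i + p))"
    using sum.shift_bounds_cl_nat_ivl[of ?t 1 p q] by (simp add: add.commute)
  also have "\<dots> = arm_form (\<lambda>i. y (p + i)) q"
    unfolding arm_form_conv_sum by (rule sum.cong) (auto simp: star_graph_parent_def add.commute)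
  also have "(\<Sum>k\<in>{p + q + 1..p + q + r}. ?t k) = (\<Sum>i\<in>{1..r}. ?t (i + (p + q)))"
    using sum.shift_bounds_cl_nat_ivl[of ?t 1 "p + q" r] by (simp add: add.commute)
  also have "\<dots> = arm_form (\<lambda>i. if i = 0 then y p else y (p + q + i)) r"
    unfolding arm_form_conv_sum by (rule sum.cong) (auto simp: star_graph_parent_def add.commute)
  finally show ?thesis using arm_form_reverse[of y p] by simp
qed

lemma tree_form_path_pos:
  assumes "k \<le> m" "y k \<noteq> 0"
  shows "tree_form (Suc m) (\<lambda>k. k - 1) y > 0"
proof (cases "y 0 = 0")
  case True
  then show ?thesis
  proof -
    have "arm_form y m \<noteq> 0" using arm_form_nonneg(2)[of y m k] True assms by blast
    then show ?thesis unfolding tree_form_path using arm_form_nonneg(1)[of y m] True by simp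
  qed
next
  case False
  have "real m / (2 * (real m + 1)) < 1" by (simp add: field_simps)
  then have "(1 - real m / (2 * (real m + 1))) * (real_of_int (y 0))\<^sup>2 > 0" using False by simp
  also have "\<dots> \<le> real_of_int (y 0 * y 0 + arm_form y m)"
    using arm_form_bound[of m y] by (simp add: left_diff_distrib power2_eq_square)
  finally show ?thesis unfolding tree_form_path by (simp only: of_int_0_less_iff)
qed

text \<open>
  For arms with \<open>p\<close>, \<open>q\<close>, \<open>r\<close> vertices the condition on the weights is equivalent to the familiar
  inequality \<open>1 / (p + 1) + 1 / (q + 1) + 1 / (r + 1) > 1\<close>.
\<close>

lemma tree_form_star_pos:
  assumes n: "n = Suc (p + q + r)"
    and weight: "real p / (2 * (real p + 1)) + real q / (2 * (real q + 1)) + real r / (2 * (real r + 1)) < 1"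
    and k: "k < n" "y k \<noteq> 0"
  shows "tree_form n (star_graph_parent p q) y > 0"
proof -
  let ?u = "\<lambda>i. y (p - i)" and ?v = "\<lambda>i. y (p + i)" and ?w = "\<lambda>i. if i = 0 then y p else y (p + q + i)"
  note form = tree_form_star[OF n, of y]
  show ?thesis
  proof (cases "y p = 0")
    case True
    have nonneg: "arm_form ?u p \<ge> 0" "arm_form ?v q \<ge> 0" "arm_form ?w r \<ge> 0"
      using True arm_form_nonneg(1)[of ?u p] arm_form_nonneg(1)[of ?v q] arm_form_nonneg(1)[of ?w r] by auto
    consider i where "k = p - i" "i \<le> p" | i where "k = p + i" "i \<le> q" | i where "k = p + q + i" "i \<noteq> 0" "i \<le> r"
    proof (cases "k \<le> p")
      case True
      then show ?thesis using that(1)[of "p - k"] by simp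
    next
      case False
      show ?thesis
      proof (cases "k \<le> p + q")
        case True
        then show ?thesis using that(2)[of "k - p"] False by simp
      next
        case False
        then show ?thesis using that(3)[of "k - p - q"] k(1) n by simp
      qed
    qed
    then have "arm_form ?u p \<noteq> 0 \<or> arm_form ?v q \<noteq> 0 \<or> arm_form ?w r \<noteq> 0"
    proof cases
      case 1
      then show ?thesis using arm_form_nonneg(2)[of ?u p i] True k(2) by auto
    next
      case 2
      then show ?thesis using arm_form_nonneg(2)[of ?v q i] True k(2) by auto
    next
      case 3
      then show ?thesis using arm_form_nonneg(2)[of ?w r i] True k(2) by auto
    qed
    then have "arm_form ?u p + arm_form ?v q + arm_form ?w r > 0"
      by (elim disjE) (use nonneg in linarith)+
    then show ?thesis using form True by simp
  next
    case False
    define a where "a = (real_of_int (y p))\<^sup>2"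
    have "a > 0" using False by (simp add: a_def)
    then have "(1 - (real p / (2 * (real p + 1)) + real q / (2 * (real q + 1)) + real r / (2 * (real r + 1)))) * a > 0"
      using weight by simp
    moreover have "- (real p / (2 * (real p + 1))) * a \<le> real_of_int (arm_form ?u p)"
      "- (real q / (2 * (real q + 1))) * a \<le> real_of_int (arm_form ?v q)"
      "- (real r / (2 * (real r + 1))) * a \<le> real_of_int (arm_form ?w r)"
      using arm_form_bound[of p ?u] arm_form_bound[of q ?v] arm_form_bound[of r ?w] by (simp_all add: a_def)
    ultimately have "real_of_int (tree_form n (star_graph_parent p q) y) > 0"
      unfolding form by (simp add: left_diff_distrib distrib_right a_def power2_eq_square)
    then show ?thesis by simp
  qed
qed

lemma pos_def_of_tree:
  assumes Q: "fin_digraph Q" and iso: "underlying_graph_iso Q ({..<n}, (\<lambda>k. {k, par k}) ` {1..<n})"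
    and par: "\<And>k. 1 \<le> k \<Longrightarrow> k < n \<Longrightarrow> par k < k"
    and pos: "\<And>y k. k < n \<Longrightarrow> y k \<noteq> 0 \<Longrightarrow> tree_form n par y > 0"
  shows "pos_def Q \<and> (\<exists>vs. topological_order Q vs)"
proof -
  obtain f g where t: "tree_in Q n par f g" "f ` {..<n} = verts Q" "g ` {1..<n} = arcs Q"
    using tree_in_of_graph_iso[OF Q iso par] by blast
  have "tree_quiver Q n f g = Q" unfolding t(2,3) by simp
  then have "\<exists>vs. topological_order Q vs" using tree_topological_order[OF t(1)] by simp
  moreover have "pos_def Q"
    unfolding pos_def_def
  proof (intro allI impI)
    fix x :: "_ \<Rightarrow> int" assume "\<exists>i\<in>verts Q. x i \<noteq> 0"
    then obtain k where "k < n" "x (f k) \<noteq> 0" unfolding t(2)[symmetric] by auto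
    then show "tits_form Q x > 0" unfolding tits_form_tree[OF t] by (rule pos)
  qed
  ultimately show ?thesis by blast
qed

lemma path_graph_conv_parent: "path_graph n = ({..<n}, (\<lambda>k. {k, k - 1}) ` {1..<n})"
proof -
  have "{{i, Suc i} | i. Suc i < n} = (\<lambda>k. {k, k - 1}) ` {1..<n}" (is "?A = ?B")
  proof
    show "?A \<subseteq> ?B"
    proof
      fix e assume "e \<in> ?A"
      then obtain i where "e = {i, Suc i}" "Suc i < n" by blast
      then show "e \<in> ?B" by (intro image_eqI[of _ _ "Suc i"]) auto
    qed
    show "?B \<subseteq> ?A"
    proof (rule image_subsetI)
      fix k assume "k \<in> {1..<n}"
      then show "{k, k - 1} \<in> ?A" by (intro CollectI exI[of _ "k - 1"]) auto
    qed
  qed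
  then show ?thesis by (simp add: path_graph_def)
qed

lemma star_graph_conv_parent:
  assumes n: "n = Suc (p + q + r)" and r: "r \<ge> 1"
  shows "star_graph p q r = ({..<n}, (\<lambda>k. {k, star_graph_parent p q k}) ` {1..<n})"
proof -
  have "{{i, Suc i} | i. i < p + q + r \<and> i \<noteq> p + q} \<union> {{p, Suc (p + q)}} =
      (\<lambda>k. {k, star_graph_parent p q k}) ` {1..<n}" (is "?A = ?B")
  proof
    show "?A \<subseteq> ?B"
    proof
      fix e assume "e \<in> ?A"
      then consider i where "e = {i, Suc i}" "i < p + q + r" "i \<noteq> p + q" | "e = {p, Suc (p + q)}" by blast
      then show "e \<in> ?B"
      proof cases
        case 1
        then show ?thesis by (intro image_eqI[of _ _ "Suc i"]) (auto simp: star_graph_parent_def n)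
      next
        case 2
        then show ?thesis using r
          by (intro image_eqI[of _ _ "Suc (p + q)"]) (auto simp: star_graph_parent_def n)
      qed
    qed
    show "?B \<subseteq> ?A"
    proof (rule image_subsetI)
      fix k assume k: "k \<in> {1..<n}"
      show "{k, star_graph_parent p q k} \<in> ?A"
      proof (cases "k = Suc (p + q)")
        case False
        then show ?thesis using k n
          by (intro UnI1 CollectI exI[of _ "k - 1"]) (auto simp: star_graph_parent_def)
      qed (auto simp: star_graph_parent_def)
    qed
  qed
  moreover have "{..p + q + r} = {..<n}" using n by auto
  ultimately show ?thesis by (simp add: star_graph_def)
qed

theorem dynkin_imp_pos_def:
  assumes Q: "fin_digraph Q" and G: "G \<in> dynkin_diagrams" "underlying_graph_iso Q G"
  shows "pos_def Q \<and> (\<exists>vs. topological_order Q vs)"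
proof -
  have star: "pos_def Q \<and> (\<exists>vs. topological_order Q vs)"
    if iso: "underlying_graph_iso Q (star_graph p q r)" and r: "r \<ge> 1"
      and w: "real p / (2 * (real p + 1)) + real q / (2 * (real q + 1)) + real r / (2 * (real r + 1)) < 1" for p q r
    by (rule pos_def_of_tree[OF Q iso[unfolded star_graph_conv_parent[OF refl r]]])
      (simp add: star_graph_parent_def, rule tree_form_star_pos[OF refl w])
  consider m where "G = path_graph (Suc m)" | m where "G = star_graph 1 1 (Suc m)" |
    r where "G = star_graph 1 2 r" "r \<in> {2, 3, 4}"
  proof -
    consider n where "n \<ge> 1" "G = path_graph n" | n where "n \<ge> 4" "G = star_graph 1 1 (n - 3)" |
      "G \<in> {star_graph 1 2 2, star_graph 1 2 3, star_graph 1 2 4}"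
      using G(1) unfolding dynkin_diagrams_def by blast
    then show ?thesis
    proof cases
      case 1
      then show ?thesis using that(1)[of "n - 1"] by simp
    next
      case 2
      then have "n - 3 = Suc (n - 4)" by simp
      then show ?thesis using that(2)[of "n - 4"] 2(2) by simp
    next
      case 3
      then show ?thesis using that(3) by blast
    qed
  qed
  then show ?thesis
  proof cases
    case 1
    show ?thesis
      by (rule pos_def_of_tree[OF Q G(2)[unfolded 1 path_graph_conv_parent]])
        (simp, rule tree_form_path_pos, auto)
  next
    case 2
    show ?thesis by (rule star[OF G(2)[unfolded 2]]) (simp_all add: field_simps)
  next
    case 3
    show ?thesis by (rule star[OF G(2)[unfolded 3]]) (use 3(2) in auto)
  qed
qed

section \<open>Linear maps and morphisms of representations\<close>

lemma linear_map_iff: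
  "linear_map K V W f \<longleftrightarrow> vectorspace K V \<and> vectorspace K W \<and>
     (\<forall>x\<in>carrier V. f x \<in> carrier W) \<and>
     (\<forall>x\<in>carrier V. \<forall>y\<in>carrier V. f (x \<oplus>\<^bsub>V\<^esub> y) = f x \<oplus>\<^bsub>W\<^esub> f y) \<and>
     (\<forall>c\<in>carrier K. \<forall>x\<in>carrier V. f (c \<odot>\<^bsub>V\<^esub> x) = c \<odot>\<^bsub>W\<^esub> f x)"
  unfolding linear_map_def mod_hom_def mod_hom_axioms_def module_hom_def vectorspace_def by auto

lemma linear_map_comp:
  assumes "linear_map K V W f" "linear_map K W U g"
  shows "linear_map K V U (\<lambda>x. g (f x))"
  using assms unfolding linear_map_iff by simp

lemma linear_map_zero: "linear_map K V W f \<Longrightarrow> f \<zero>\<^bsub>V\<^esub> = \<zero>\<^bsub>W\<^esub>"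
  unfolding linear_map_def by (blast intro: mod_hom.f0_is_0)

lemma linear_map_inverse:
  assumes f: "linear_map K V W f" "bij_betw f (carrier V) (carrier W)"
  shows "linear_map K W V (the_inv_into (carrier V) f)"
proof -
  let ?g = "the_inv_into (carrier V) f"
  have inj: "inj_on f (carrier V)" using f(2) by (simp add: bij_betw_def)
  have g: "?g y \<in> carrier V" "f (?g y) = y" if "y \<in> carrier W" for y
    using f(2) that by (auto simp: bij_betw_def the_inv_into_into f_the_inv_into_f)
  have gf: "?g (f x) = x" if "x \<in> carrier V" for x using inj that by (rule the_inv_into_f_f)
  have "module K V" using f(1) by (simp add: linear_map_def vectorspace_def)
  then have cl: "\<And>x y. x \<in> carrier V \<Longrightarrow> y \<in> carrier V \<Longrightarrow> x \<oplus>\<^bsub>V\<^esub> y \<in> carrier V"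
    "\<And>c x. c \<in> carrier K \<Longrightarrow> x \<in> carrier V \<Longrightarrow> c \<odot>\<^bsub>V\<^esub> x \<in> carrier V"
    by (auto simp: module.smult_closed module_def abelian_group_def abelian_monoid.a_closed)
  have "?g (x \<oplus>\<^bsub>W\<^esub> y) = ?g x \<oplus>\<^bsub>V\<^esub> ?g y" if "x \<in> carrier W" "y \<in> carrier W" for x y
  proof -
    have "x \<oplus>\<^bsub>W\<^esub> y = f (?g x \<oplus>\<^bsub>V\<^esub> ?g y)" using f(1) g that by (simp add: linear_map_iff)
    then show ?thesis using gf cl(1) g(1) that by simp
  qed
  moreover have "?g (c \<odot>\<^bsub>W\<^esub> x) = c \<odot>\<^bsub>V\<^esub> ?g x" if "c \<in> carrier K" "x \<in> carrier W" for c x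
  proof -
    have "c \<odot>\<^bsub>W\<^esub> x = f (c \<odot>\<^bsub>V\<^esub> ?g x)" using f(1) g that by (simp add: linear_map_iff)
    then show ?thesis using gf cl(2) g(1) that by simp
  qed
  ultimately show ?thesis using f(1) g(1) by (simp add: linear_map_iff)
qed

lemma rep_hom_comp:
  assumes "fin_digraph Q" "\<phi> \<in> rep_hom K Q X Y" "\<psi> \<in> rep_hom K Q Y Z"
  shows "(\<lambda>i x. \<psi> i (\<phi> i x)) \<in> rep_hom K Q X Z"
proof -
  note wf = arc_ends[OF assms(1)]
  have "\<phi> i x \<in> carrier (rep_space Y i)" if "i \<in> verts Q" "x \<in> carrier (rep_space X i)" for i x
    using assms(2) that by (simp add: rep_hom_def linear_map_iff)
  then show ?thesis using assms(2,3) wf unfolding rep_hom_def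
    by (auto intro: linear_map_comp)
qed

lemma rep_hom_inverse:
  assumes Q: "fin_digraph Q" and X: "representation K Q X"
    and \<phi>: "\<phi> \<in> rep_hom K Q X Y" "\<forall>i\<in>verts Q. bij_betw (\<phi> i) (carrier (rep_space X i)) (carrier (rep_space Y i))"
  obtains \<psi> where "\<psi> \<in> rep_hom K Q Y X"
    "\<And>i. i \<in> verts Q \<Longrightarrow> bij_betw (\<psi> i) (carrier (rep_space Y i)) (carrier (rep_space X i))"
    "\<And>i x. i \<in> verts Q \<Longrightarrow> x \<in> carrier (rep_space X i) \<Longrightarrow> \<psi> i (\<phi> i x) = x"
    "\<And>i y. i \<in> verts Q \<Longrightarrow> y \<in> carrier (rep_space Y i) \<Longrightarrow> \<phi> i (\<psi> i y) = y"
proof -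
  note wf = arc_ends[OF Q]
  define \<psi> where "\<psi> i = the_inv_into (carrier (rep_space X i)) (\<phi> i)" for i
  have lin: "linear_map K (rep_space Y i) (rep_space X i) (\<psi> i)" if "i \<in> verts Q" for i
    unfolding \<psi>_def using \<phi> that by (intro linear_map_inverse) (auto simp: rep_hom_def)
  have bij: "bij_betw (\<psi> i) (carrier (rep_space Y i)) (carrier (rep_space X i))" if "i \<in> verts Q" for i
    unfolding \<psi>_def using \<phi>(2) that by (intro bij_betw_the_inv_into) auto
  have \<psi>\<phi>: "\<psi> i (\<phi> i x) = x" if "i \<in> verts Q" "x \<in> carrier (rep_space X i)" for i x
    using \<phi>(2) that unfolding \<psi>_def bij_betw_def by (auto intro: the_inv_into_f_f)
  have \<phi>\<psi>: "\<phi> i (\<psi> i y) = y" if "i \<in> verts Q" "y \<in> carrier (rep_space Y i)" for i y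
    unfolding \<psi>_def by (rule f_the_inv_into_f_bij_betw) (use \<phi>(2) that in auto)
  have "rep_map X a (\<psi> (tail Q a) y) = \<psi> (head Q a) (rep_map Y a y)"
    if a: "a \<in> arcs Q" and y: "y \<in> carrier (rep_space Y (tail Q a))" for a y
  proof -
    let ?x = "\<psi> (tail Q a) y"
    have x: "?x \<in> carrier (rep_space X (tail Q a))"
      using lin[of "tail Q a"] wf[OF a] y by (simp add: linear_map_iff)
    have Xx: "rep_map X a ?x \<in> carrier (rep_space X (head Q a))"
      using X a x by (simp add: representation_def linear_map_iff)
    have "rep_map Y a (\<phi> (tail Q a) ?x) = \<phi> (head Q a) (rep_map X a ?x)"
      using \<phi>(1) a x by (simp add: rep_hom_def)
    then show ?thesis using \<phi>\<psi> \<psi>\<phi> wf[OF a] y Xx by simp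
  qed
  then have "\<psi> \<in> rep_hom K Q Y X" using lin by (simp add: rep_hom_def)
  then show ?thesis using that bij \<psi>\<phi> \<phi>\<psi> by blast
qed

lemma rep_iso_refl: "representation K Q X \<Longrightarrow> rep_iso K Q X X"
  unfolding rep_iso_def
  by (rule bexI[of _ "\<lambda>_ x. x"]) (auto simp: rep_hom_def representation_def linear_map_iff bij_betw_def)

lemma rep_iso_sym:
  assumes "fin_digraph Q" "representation K Q X" "rep_iso K Q X Y"
  shows "rep_iso K Q Y X"
proof -
  obtain \<phi> where \<phi>: "\<phi> \<in> rep_hom K Q X Y"
    "\<forall>i\<in>verts Q. bij_betw (\<phi> i) (carrier (rep_space X i)) (carrier (rep_space Y i))"
    using assms(3) by (auto simp: rep_iso_def)
  obtain \<psi> where "\<psi> \<in> rep_hom K Q Y X"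
    "\<And>i. i \<in> verts Q \<Longrightarrow> bij_betw (\<psi> i) (carrier (rep_space Y i)) (carrier (rep_space X i))"
    using rep_hom_inverse[OF assms(1,2) \<phi>] by metis
  then show ?thesis unfolding rep_iso_def by blast
qed

lemma rep_iso_trans:
  assumes "fin_digraph Q" "rep_iso K Q X Y" "rep_iso K Q Y Z"
  shows "rep_iso K Q X Z"
proof -
  obtain \<phi> \<psi> where \<phi>: "\<phi> \<in> rep_hom K Q X Y"
    "\<forall>i\<in>verts Q. bij_betw (\<phi> i) (carrier (rep_space X i)) (carrier (rep_space Y i))" and
    \<psi>: "\<psi> \<in> rep_hom K Q Y Z"
    "\<forall>i\<in>verts Q. bij_betw (\<psi> i) (carrier (rep_space Y i)) (carrier (rep_space Z i))"
    using assms(2,3) by (auto simp: rep_iso_def)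
  have "bij_betw (\<lambda>x. \<psi> i (\<phi> i x)) (carrier (rep_space X i)) (carrier (rep_space Z i))" if "i \<in> verts Q" for i
    using bij_betw_trans[OF \<phi>(2)[rule_format, OF that] \<psi>(2)[rule_format, OF that]] by (simp add: o_def)
  then show ?thesis
    unfolding rep_iso_def by (intro bexI[OF _ rep_hom_comp[OF assms(1) \<phi>(1) \<psi>(1)]]) simp
qed

section \<open>Matrix representations as representations\<close>

definition coord_space :: "nat \<Rightarrow> ('k::field, nat \<Rightarrow> 'k) module" where
  "coord_space n = \<lparr>carrier = {v. \<forall>r\<ge>n. v r = 0}, mult = (\<lambda>u v. u), one = (\<lambda>_. 0),
     zero = (\<lambda>_. 0), add = (\<lambda>u v r. u r + v r), smult = (\<lambda>c v r. c * v r)\<rparr>"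

lemma coord_space_simps [simp]:
  "carrier (coord_space n) = {v. \<forall>r\<ge>n. v r = 0}"
  "zero (coord_space n) = (\<lambda>_. 0)"
  "add (coord_space n) u v = (\<lambda>r. u r + v r)"
  "smult (coord_space n) c v = (\<lambda>r. c * v r)"
  by (simp_all add: coord_space_def)

lemma field_class_ring: "field (class_ring :: 'k::field ring)"
  by (rule class_field.field_axioms)

lemma vectorspace_coord_space: "vectorspace class_ring (coord_space n :: ('k::field, nat \<Rightarrow> 'k) module)"
proof (rule vs_criteria[OF field_class_ring])
  show "\<forall>v\<in>carrier (coord_space n :: ('k, nat \<Rightarrow> 'k) module). \<exists>neg_v\<in>carrier (coord_space n).
      v \<oplus>\<^bsub>coord_space n\<^esub> neg_v = \<zero>\<^bsub>coord_space n\<^esub>"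
  proof
    fix v :: "nat \<Rightarrow> 'k" assume "v \<in> carrier (coord_space n)"
    then show "\<exists>neg_v\<in>carrier (coord_space n). v \<oplus>\<^bsub>coord_space n\<^esub> neg_v = \<zero>\<^bsub>coord_space n\<^esub>"
      by (intro bexI[of _ "\<lambda>r. - v r"]) auto
  qed
qed (auto simp: algebra_simps)

lemma trunc_id_iff: "app (trunc n) v = v \<longleftrightarrow> v \<in> carrier (coord_space n)"
  by (auto simp: fun_eq_iff)

lemma trunc_in_coord_space: "app (trunc n) v \<in> carrier (coord_space n)"
  by simp

lemma homs_in_coord_space: "f \<in> homs m n \<Longrightarrow> app f v \<in> carrier (coord_space m)"
  using homs_app by fastforce

lemma homs_eqI:
  assumes "f \<in> homs m n" "g \<in> homs m n" "\<And>v. v \<in> carrier (coord_space n) \<Longrightarrow> app f v = app g v"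
  shows "f = g"
proof (rule endo_eqI)
  fix v
  have "app f v = app f (app (trunc n) v)" "app g v = app g (app (trunc n) v)"
    using homs_app_trunc[OF assms(1)] homs_app_trunc[OF assms(2)] by simp_all
  then show "app f v = app g v" using assms(3)[OF trunc_in_coord_space] by metis
qed

lemma linear_map_app:
  assumes "f \<in> homs m (n :: nat)"
  shows "linear_map class_ring (coord_space n) (coord_space m) (app f)"
  unfolding linear_map_iff
proof (intro conjI)
  show "\<forall>v\<in>carrier (coord_space n). app f v \<in> carrier (coord_space m)"
    using homs_in_coord_space[OF assms] by blast
qed (rule vectorspace_coord_space | simp add: app_add app_scale)+

definition matrix_of :: "nat \<Rightarrow> ((nat \<Rightarrow> 'k) \<Rightarrow> nat \<Rightarrow> 'k) \<Rightarrow> 'k::field endo" where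
  "matrix_of n f = Endo (\<lambda>v. f (app (trunc n) v))"

lemma app_matrix_of:
  assumes "linear_map class_ring (coord_space n) (coord_space m) f"
  shows "app (matrix_of n f) v = f (app (trunc n) v)"
proof -
  have "f (app (trunc n) (\<lambda>r. u r + v r)) = (\<lambda>r. f (app (trunc n) u) r + f (app (trunc n) v) r)" for u v
    using assms unfolding linear_map_iff app_add by simp
  moreover have "f (app (trunc n) (\<lambda>r. c * v r)) = (\<lambda>r. c * f (app (trunc n) v) r)" for c v
    using assms unfolding linear_map_iff app_scale by simp
  ultimately show ?thesis unfolding matrix_of_def by (subst Endo_inverse) auto
qed

lemma matrix_of_in_homs:
  assumes "linear_map class_ring (coord_space n) (coord_space m) f"
  shows "matrix_of n f \<in> homs m n"
proof (rule homsI; rule endo_eqI)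
  fix v
  have "f (app (trunc n) v) \<in> carrier (coord_space m)"
    using assms trunc_in_coord_space[of n v] unfolding linear_map_iff by blast
  then show "app (trunc m * matrix_of n f) v = app (matrix_of n f) v"
    unfolding app_times_endo app_matrix_of[OF assms] trunc_id_iff .
  show "app (matrix_of n f * trunc n) v = app (matrix_of n f) v"
    unfolding app_times_endo app_matrix_of[OF assms] by (simp flip: app_times_endo del: app_trunc)
qed

definition matrix_quiver_rep ::
    "('v \<Rightarrow> nat) \<Rightarrow> ('a \<Rightarrow> 'k endo) \<Rightarrow> ('v, 'a, 'k::field, nat \<Rightarrow> 'k) quiver_rep" where
  "matrix_quiver_rep d A = \<lparr>rep_space = (\<lambda>i. coord_space (d i)), rep_map = (\<lambda>a. app (A a))\<rparr>"

lemma matrix_quiver_rep_simps [simp]: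
  "rep_space (matrix_quiver_rep d A) i = coord_space (d i)"
  "rep_map (matrix_quiver_rep d A) a = app (A a)"
  by (simp_all add: matrix_quiver_rep_def)

lemma representation_matrix: "matrix_rep Q d A \<Longrightarrow> representation class_ring Q (matrix_quiver_rep d A)"
  by (simp add: representation_def matrix_rep_def vectorspace_coord_space linear_map_app
      del: coord_space_simps)

lemma rep_hom_of_matrix_hom:
  assumes "matrix_hom Q d A d' A' \<phi>"
  shows "(\<lambda>i. app (\<phi> i)) \<in> rep_hom class_ring Q (matrix_quiver_rep d A) (matrix_quiver_rep d' A')"
  using assms unfolding rep_hom_def matrix_hom_def
  by (simp add: linear_map_app del: coord_space_simps) (metis app_times_endo)

text \<open>
  The morphism and the matrices agree on coordinate vectors only; outside of them a morphism
  is arbitrary.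
\<close>

lemma matrix_hom_of_rep_hom:
  fixes A :: "'a \<Rightarrow> 'k::field endo"
  assumes Q: "fin_digraph Q" and rep: "matrix_rep Q d A" "matrix_rep Q d' A'"
    and \<phi>: "\<phi> \<in> rep_hom class_ring Q (matrix_quiver_rep d A) (matrix_quiver_rep d' A')"
  obtains \<Phi> where "matrix_hom Q d A d' A' \<Phi>"
    "\<And>i v. i \<in> verts Q \<Longrightarrow> v \<in> carrier (coord_space (d i)) \<Longrightarrow> app (\<Phi> i) v = \<phi> i v"
proof -
  note wf = arc_ends[OF Q]
  define \<Phi> where "\<Phi> i = matrix_of (d i) (\<phi> i)" for i
  have lin: "linear_map class_ring (coord_space (d i)) (coord_space (d' i)) (\<phi> i)" if "i \<in> verts Q" for i
    using \<phi> that by (simp add: rep_hom_def del: coord_space_simps)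
  have val: "app (\<Phi> i) v = \<phi> i v" if "i \<in> verts Q" "v \<in> carrier (coord_space (d i))" for i v
    unfolding \<Phi>_def app_matrix_of[OF lin[OF that(1)]] using that(2) by (simp only: trunc_id_iff[THEN iffD2])
  have homs: "\<Phi> i \<in> homs (d' i) (d i)" if "i \<in> verts Q" for i
    unfolding \<Phi>_def by (rule matrix_of_in_homs[OF lin[OF that]])
  have "matrix_hom Q d A d' A' \<Phi>"
    unfolding matrix_hom_def
  proof (intro conjI ballI)
    fix a assume a: "a \<in> arcs Q"
    have A: "A a \<in> homs (d (head Q a)) (d (tail Q a))" "A' a \<in> homs (d' (head Q a)) (d' (tail Q a))"
      using rep a by (simp_all add: matrix_rep_def)
    show "A' a * \<Phi> (tail Q a) = \<Phi> (head Q a) * A a"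
    proof (rule homs_eqI)
      fix v :: "nat \<Rightarrow> 'k" assume v: "v \<in> carrier (coord_space (d (tail Q a)))"
      have "app (A' a) (\<phi> (tail Q a) v) = \<phi> (head Q a) (app (A a) v)"
        using \<phi> a v by (simp add: rep_hom_def)
      then show "app (A' a * \<Phi> (tail Q a)) v = app (\<Phi> (head Q a) * A a) v"
        using val wf[OF a] v homs_in_coord_space[OF A(1)] by (simp only: app_times_endo)
    qed (use A homs wf[OF a] in \<open>blast intro: homs_mult\<close>)+
  qed (use homs in blast)
  then show ?thesis using that val by blast
qed

lemma rep_iso_matrix_iff:
  fixes A :: "'a \<Rightarrow> 'k::field endo"
  assumes Q: "fin_digraph Q" and rep: "matrix_rep Q d A" "matrix_rep Q d' A'"
  shows "rep_iso class_ring Q (matrix_quiver_rep d A) (matrix_quiver_rep d' A') \<longleftrightarrow> matrix_iso Q d A d' A'"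
proof
  assume "rep_iso class_ring Q (matrix_quiver_rep d A) (matrix_quiver_rep d' A')"
  then obtain \<phi> where \<phi>: "\<phi> \<in> rep_hom class_ring Q (matrix_quiver_rep d A) (matrix_quiver_rep d' A')"
    "\<forall>i\<in>verts Q. bij_betw (\<phi> i) (carrier (rep_space (matrix_quiver_rep d A) i)) (carrier (rep_space (matrix_quiver_rep d' A') i))"
    by (auto simp: rep_iso_def)
  obtain \<psi> where \<psi>: "\<psi> \<in> rep_hom class_ring Q (matrix_quiver_rep d' A') (matrix_quiver_rep d A)"
    and inv: "\<And>i x. i \<in> verts Q \<Longrightarrow> x \<in> carrier (coord_space (d i)) \<Longrightarrow> \<psi> i (\<phi> i x) = x"
      "\<And>i y. i \<in> verts Q \<Longrightarrow> y \<in> carrier (coord_space (d' i)) \<Longrightarrow> \<phi> i (\<psi> i y) = y"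
    using rep_hom_inverse[OF Q representation_matrix[OF rep(1)] \<phi>] by (metis matrix_quiver_rep_simps(1))
  obtain \<Phi> where \<Phi>: "matrix_hom Q d A d' A' \<Phi>"
    "\<And>i v. i \<in> verts Q \<Longrightarrow> v \<in> carrier (coord_space (d i)) \<Longrightarrow> app (\<Phi> i) v = \<phi> i v"
    using matrix_hom_of_rep_hom[OF Q rep \<phi>(1)] by blast
  obtain \<Psi> where \<Psi>: "matrix_hom Q d' A' d A \<Psi>"
    "\<And>i v. i \<in> verts Q \<Longrightarrow> v \<in> carrier (coord_space (d' i)) \<Longrightarrow> app (\<Psi> i) v = \<psi> i v"
    using matrix_hom_of_rep_hom[OF Q rep(2,1) \<psi>] by blast
  have "\<Psi> i * \<Phi> i = trunc (d i)" "\<Phi> i * \<Psi> i = trunc (d' i)" if i: "i \<in> verts Q" for i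
  proof -
    have h: "\<Phi> i \<in> homs (d' i) (d i)" "\<Psi> i \<in> homs (d i) (d' i)"
      using \<Phi>(1) \<Psi>(1) i by (simp_all add: matrix_hom_def)
    show "\<Psi> i * \<Phi> i = trunc (d i)"
    proof (rule homs_eqI[OF homs_mult[OF h(2,1)] trunc_in_homs])
      fix v :: "nat \<Rightarrow> 'k" assume v: "v \<in> carrier (coord_space (d i))"
      then show "app (\<Psi> i * \<Phi> i) v = app (trunc (d i)) v"
        using \<Phi>(2)[OF i v] \<Psi>(2)[OF i homs_in_coord_space[OF h(1), of v]] inv(1)[OF i v]
          trunc_id_iff[THEN iffD2, OF v] by (simp only: app_times_endo)
    qed
    show "\<Phi> i * \<Psi> i = trunc (d' i)"
    proof (rule homs_eqI[OF homs_mult[OF h(1,2)] trunc_in_homs])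
      fix v :: "nat \<Rightarrow> 'k" assume v: "v \<in> carrier (coord_space (d' i))"
      then show "app (\<Phi> i * \<Psi> i) v = app (trunc (d' i)) v"
        using \<Psi>(2)[OF i v] \<Phi>(2)[OF i homs_in_coord_space[OF h(2), of v]] inv(2)[OF i v]
          trunc_id_iff[THEN iffD2, OF v] by (simp only: app_times_endo)
    qed
  qed
  then show "matrix_iso Q d A d' A'" unfolding matrix_iso_def using \<Phi>(1) \<Psi>(1) by blast
next
  assume "matrix_iso Q d A d' A'"
  then obtain \<phi> \<psi> where \<phi>: "matrix_hom Q d A d' A' \<phi>" and \<psi>: "matrix_hom Q d' A' d A \<psi>" and
    inv: "\<And>i. i \<in> verts Q \<Longrightarrow> \<psi> i * \<phi> i = trunc (d i)" "\<And>i. i \<in> verts Q \<Longrightarrow> \<phi> i * \<psi> i = trunc (d' i)"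
    unfolding matrix_iso_def by blast
  have "bij_betw (app (\<phi> i)) (carrier (coord_space (d i))) (carrier (coord_space (d' i)))" if i: "i \<in> verts Q" for i
  proof (rule bij_betw_byWitness[where f' = "app (\<psi> i)"])
    have h: "\<phi> i \<in> homs (d' i) (d i)" "\<psi> i \<in> homs (d i) (d' i)"
      using \<phi> \<psi> i by (simp_all add: matrix_hom_def)
    show "\<forall>v\<in>carrier (coord_space (d i)). app (\<psi> i) (app (\<phi> i) v) = v"
      using inv(1)[OF i] trunc_id_iff by (metis app_times_endo)
    show "\<forall>v\<in>carrier (coord_space (d' i)). app (\<phi> i) (app (\<psi> i) v) = v"
      using inv(2)[OF i] trunc_id_iff by (metis app_times_endo)
    show "app (\<phi> i) ` carrier (coord_space (d i)) \<subseteq> carrier (coord_space (d' i))"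
      "app (\<psi> i) ` carrier (coord_space (d' i)) \<subseteq> carrier (coord_space (d i))"
      using homs_in_coord_space[OF h(1)] homs_in_coord_space[OF h(2)] by blast+
  qed
  then show "rep_iso class_ring Q (matrix_quiver_rep d A) (matrix_quiver_rep d' A')"
    unfolding rep_iso_def using rep_hom_of_matrix_hom[OF \<phi>] by (metis matrix_quiver_rep_simps(1))
qed

section \<open>Coordinates and transport\<close>

lemma coordinates_exist:
  assumes V: "vectorspace class_ring (V :: ('k::field, 'w) module)" and fd: "vectorspace.fin_dim class_ring V"
  shows "\<exists>n \<beta>. linear_map class_ring (coord_space n) V \<beta> \<and>
    bij_betw \<beta> (carrier (coord_space n)) (carrier V)"
proof -
  interpret V: vectorspace "class_ring :: 'k ring" V by (rule V)
  obtain B where B: "finite B" "V.basis B" using V.finite_basis_exists[OF fd] by blast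
  have BV: "B \<subseteq> carrier V" using B(2) by (simp add: V.basis_def)
  obtain h where h: "bij_betw h {0..<card B} B" using ex_bij_betw_nat_finite[OF B(1)] by blast
  define n where "n = card B"
  define g where "g = the_inv_into {0..<n} h"
  have g: "g b < n" if "b \<in> B" for b
    using h that bij_betw_the_inv_into[OF h] unfolding g_def n_def bij_betw_def by auto
  have gh: "g (h r) = r" if "r < n" for r
    using h that unfolding g_def n_def bij_betw_def by (simp add: the_inv_into_f_f)
  have hg: "h (g b) = b" if "b \<in> B" for b
    using f_the_inv_into_f_bij_betw[OF h] that unfolding g_def n_def by blast
  define \<beta> where "\<beta> v = V.lincomb (\<lambda>b. v (g b)) B" for v
  have unique: "\<exists>!a. a \<in> B \<rightarrow>\<^sub>E UNIV \<and> V.lincomb a B = w" if "w \<in> carrier V" for w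
    using V.basis_criterion[OF B(1) BV] B(2) that by simp
  have restrict: "V.lincomb (restrict a B) B = V.lincomb a B" for a
    unfolding V.lincomb_def using BV by (intro V.finsum_cong') (auto intro: V.smult_closed)
  have "linear_map class_ring (coord_space n) V \<beta>"
    unfolding linear_map_iff
  proof (intro conjI ballI)
    show "\<beta> v \<in> carrier V" for v unfolding \<beta>_def using BV by (intro V.lincomb_closed) auto
    show "\<beta> (u \<oplus>\<^bsub>coord_space n\<^esub> v) = \<beta> u \<oplus>\<^bsub>V\<^esub> \<beta> v" for u v
      using V.lincomb_sum[OF B(1) BV, of "\<lambda>b. u (g b)" "\<lambda>b. v (g b)"] by (simp add: \<beta>_def)
    show "\<beta> (c \<odot>\<^bsub>coord_space n\<^esub> v) = c \<odot>\<^bsub>V\<^esub> \<beta> v" for c v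
      using V.lincomb_smult[OF BV, of "\<lambda>b. v (g b)" c] by (simp add: \<beta>_def)
  qed (rule vectorspace_coord_space V)+
  moreover have "bij_betw \<beta> (carrier (coord_space n)) (carrier V)"
    unfolding bij_betw_def
  proof
    show "inj_on \<beta> (carrier (coord_space n))"
    proof (rule inj_onI, rule ext)
      fix u v r assume uv: "u \<in> carrier (coord_space n)" "v \<in> carrier (coord_space n)" "\<beta> u = \<beta> v"
      have "V.lincomb (\<lambda>b. v (g b)) B \<in> carrier V" using BV by (intro V.lincomb_closed) auto
      from unique[OF this] have "restrict (\<lambda>b. u (g b)) B = restrict (\<lambda>b. v (g b)) B"
        using uv(3) restrict unfolding \<beta>_def by (metis (no_types, lifting) UNIV_I restrict_PiE_iff)
      then have *: "u (g b) = v (g b)" if "b \<in> B" for b using that by (metis restrict_apply')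
      show "u r = v r"
      proof (cases "r < n")
        case True
        then have "h r \<in> B" using h by (auto simp: n_def bij_betw_def)
        then show ?thesis using *[of "h r"] gh[OF True] by simp
      qed (use uv in simp)
    qed
    show "\<beta> ` carrier (coord_space n) = carrier V"
    proof
      show "\<beta> ` carrier (coord_space n) \<subseteq> carrier V"
        unfolding \<beta>_def using BV by (auto intro!: V.lincomb_closed)
      show "carrier V \<subseteq> \<beta> ` carrier (coord_space n)"
      proof
        fix w assume "w \<in> carrier V"
        then obtain a where a: "V.lincomb a B = w" using unique by blast
        define v where "v r = (if r < n then a (h r) else 0)" for r
        have "\<beta> v = V.lincomb a B"
          unfolding \<beta>_def V.lincomb_def using BV g hg
          by (intro V.finsum_cong') (auto simp: v_def intro: V.smult_closed)
        then show "w \<in> \<beta> ` carrier (coord_space n)"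
          using a by (intro image_eqI[of _ _ v]) (auto simp: v_def)
      qed
    qed
  qed
  ultimately show ?thesis by blast
qed

lemma fin_dim_of_coordinates:
  assumes \<beta>: "linear_map class_ring (coord_space n) V \<beta>" "carrier V \<subseteq> \<beta> ` carrier (coord_space n)"
  shows "vectorspace.fin_dim class_ring (V :: ('k::field, 'w) module)"
proof -
  have V: "vectorspace class_ring V" using \<beta>(1) by (simp add: linear_map_iff)
  interpret V: vectorspace "class_ring :: 'k ring" V by (rule V)
  let ?e = "unit_at :: nat \<Rightarrow> nat \<Rightarrow> 'k"
  let ?U = "(\<lambda>r. \<beta> (?e r)) ` {..<n}"
  have U: "?U \<subseteq> carrier V" using \<beta>(1) by (auto simp: linear_map_iff unit_at_def)
  have sub: "submodule class_ring (V.span ?U) V" by (rule V.span_is_submodule[OF U])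
  have span: "\<beta> (app (trunc m) v) \<in> V.span ?U" if "m \<le> n" for m v
    using that
  proof (induction m)
    case 0
    have "\<beta> (\<lambda>_. 0) = \<zero>\<^bsub>V\<^esub>" using linear_map_zero[OF \<beta>(1)] by simp
    then show ?case using submodule.zero_closed[OF sub] by simp
  next
    case (Suc m)
    have "app (trunc (Suc m)) v = (\<lambda>r. app (trunc m) v r + v m * ?e m r)"
      by (simp only: trunc_Suc app_plus_endo app_outer)
    moreover have "app (trunc m) v \<in> carrier (coord_space n)" "?e m \<in> carrier (coord_space n)"
      "(\<lambda>r. v m * ?e m r) \<in> carrier (coord_space n)"
      using Suc.prems by (auto simp: unit_at_def)
    ultimately have "\<beta> (app (trunc (Suc m)) v) = \<beta> (app (trunc m) v) \<oplus>\<^bsub>V\<^esub> v m \<odot>\<^bsub>V\<^esub> \<beta> (?e m)"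
      using \<beta>(1) unfolding linear_map_iff by (simp del: app_trunc) 
    moreover have "\<beta> (?e m) \<in> V.span ?U" using V.in_own_span[OF U] Suc.prems by auto
    ultimately show ?case
      using Suc submodule.m_closed[OF sub] submodule.smult_closed[OF sub] by simp
  qed
  have "carrier V \<subseteq> V.span ?U"
  proof
    fix w assume "w \<in> carrier V"
    then obtain v where "v \<in> carrier (coord_space n)" "w = \<beta> v" using \<beta>(2) by blast
    then show "w \<in> V.span ?U" using span[of n v] trunc_id_iff[of n v] by simp
  qed
  then have "V.span ?U = carrier V" using V.span_is_subset2[OF U] by blast
  then show ?thesis unfolding V.fin_dim_def using U by blast
qed

definition transport_space :: "('b \<Rightarrow> 'w) \<Rightarrow> ('k, 'b) module \<Rightarrow> ('k, 'w) module" where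
  "transport_space f V = (let g = the_inv_into (carrier V) f in
     \<lparr>carrier = f ` carrier V, mult = (\<lambda>x y. x), one = f \<zero>\<^bsub>V\<^esub>, zero = f \<zero>\<^bsub>V\<^esub>,
      add = (\<lambda>x y. f (g x \<oplus>\<^bsub>V\<^esub> g y)), smult = (\<lambda>c x. f (c \<odot>\<^bsub>V\<^esub> g x))\<rparr>)"

lemma linear_map_transport:
  assumes V: "vectorspace K V" and inj: "inj_on f (carrier V)"
  shows "linear_map K V (transport_space f V) f"
proof -
  interpret V: vectorspace K V by (rule V)
  have g [simp]: "the_inv_into (carrier V) f (f x) = x" if "x \<in> carrier V" for x
    using inj that by (rule the_inv_into_f_f)
  have car [simp]: "carrier (transport_space f V) = f ` carrier V"
    "zero (transport_space f V) = f \<zero>\<^bsub>V\<^esub>"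
    by (simp_all add: transport_space_def Let_def)
  have ops [simp]: "f x \<oplus>\<^bsub>transport_space f V\<^esub> f y = f (x \<oplus>\<^bsub>V\<^esub> y)"
    "c \<odot>\<^bsub>transport_space f V\<^esub> f x = f (c \<odot>\<^bsub>V\<^esub> x)"
    if "x \<in> carrier V" "y \<in> carrier V" for x y c
    using that by (simp_all add: transport_space_def Let_def)
  have "vectorspace K (transport_space f V)"
  proof (rule vs_criteria)
    show "field K" by (rule V.field_axioms)
    show "\<forall>v\<in>carrier (transport_space f V). \<exists>neg_v\<in>carrier (transport_space f V).
      v \<oplus>\<^bsub>transport_space f V\<^esub> neg_v = \<zero>\<^bsub>transport_space f V\<^esub>"
    proof
      fix v assume "v \<in> carrier (transport_space f V)"
      then obtain x where x: "x \<in> carrier V" "v = f x" by auto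
      then show "\<exists>neg_v\<in>carrier (transport_space f V).
          v \<oplus>\<^bsub>transport_space f V\<^esub> neg_v = \<zero>\<^bsub>transport_space f V\<^esub>"
        by (intro bexI[of _ "f (\<ominus>\<^bsub>V\<^esub> x)"]) (auto simp: V.r_neg)
    qed
  qed (auto simp: V.smult_l_distr V.smult_r_distr V.smult_assoc1 V.a_ac)
  then show ?thesis using V by (simp add: linear_map_iff)
qed

section \<open>Representations over a field in matrix form\<close>

lemma matrix_form_exists:
  assumes Q: "fin_digraph Q" and X: "representation class_ring Q X" "fin_dim_rep class_ring Q X"
  obtains d and A :: "'a \<Rightarrow> 'k::field endo" where "matrix_rep Q d A" "\<And>i. i \<notin> verts Q \<Longrightarrow> d i = 0"
    "rep_iso class_ring Q (matrix_quiver_rep d A) (X :: ('v, 'a, 'k::field, 'w) quiver_rep)"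
proof -
  note wf = arc_ends[OF Q]
  have "\<exists>n \<beta>. linear_map class_ring (coord_space n) (rep_space X i) \<beta> \<and>
      bij_betw \<beta> (carrier (coord_space n)) (carrier (rep_space X i))" if "i \<in> verts Q" for i
    using X that by (intro coordinates_exist) (auto simp: representation_def fin_dim_rep_def)
  then obtain n \<beta> where \<beta>: "\<And>i. i \<in> verts Q \<Longrightarrow> linear_map class_ring (coord_space (n i)) (rep_space X i) (\<beta> i)"
    "\<And>i. i \<in> verts Q \<Longrightarrow> bij_betw (\<beta> i) (carrier (coord_space (n i))) (carrier (rep_space X i))"
    by metis
  define d where "d i = (if i \<in> verts Q then n i else 0)" for i
  define \<gamma> where "\<gamma> i = the_inv_into (carrier (coord_space (n i))) (\<beta> i)" for i
  have \<gamma>: "linear_map class_ring (rep_space X i) (coord_space (n i)) (\<gamma> i)" if "i \<in> verts Q" for i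
    unfolding \<gamma>_def by (rule linear_map_inverse[OF \<beta>[OF that]])
  have \<beta>\<gamma>: "\<beta> i (\<gamma> i x) = x" if "i \<in> verts Q" "x \<in> carrier (rep_space X i)" for i x
    unfolding \<gamma>_def by (rule f_the_inv_into_f_bij_betw[OF \<beta>(2)[OF that(1)]]) (use that(2) in blast)
  define A where "A a = matrix_of (n (tail Q a)) (\<lambda>v. \<gamma> (head Q a) (rep_map X a (\<beta> (tail Q a) v)))" for a
  have lin: "linear_map class_ring (coord_space (n (tail Q a))) (coord_space (n (head Q a)))
      (\<lambda>v. \<gamma> (head Q a) (rep_map X a (\<beta> (tail Q a) v)))" if a: "a \<in> arcs Q" for a
  proof -
    have "linear_map class_ring (rep_space X (tail Q a)) (rep_space X (head Q a)) (rep_map X a)"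
      using X(1) a by (simp add: representation_def)
    from linear_map_comp[OF linear_map_comp[OF \<beta>(1) this] \<gamma>] wf[OF a] show ?thesis by blast
  qed
  have rep: "matrix_rep Q d A"
    unfolding matrix_rep_def using matrix_of_in_homs[OF lin] wf by (simp add: A_def d_def)
  have "\<beta> \<in> rep_hom class_ring Q (matrix_quiver_rep d A) X"
    unfolding rep_hom_def matrix_quiver_rep_simps
  proof (intro CollectI conjI ballI)
    show "linear_map class_ring (coord_space (d i)) (rep_space X i) (\<beta> i)" if "i \<in> verts Q" for i
      using \<beta>(1)[OF that] that by (simp add: d_def del: coord_space_simps)
    fix a and v :: "nat \<Rightarrow> 'k" assume a: "a \<in> arcs Q" and "v \<in> carrier (coord_space (d (tail Q a)))"
    then have v: "v \<in> carrier (coord_space (n (tail Q a)))"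
      using wf[OF a] by (simp add: d_def del: coord_space_simps)
    have "\<beta> (tail Q a) v \<in> carrier (rep_space X (tail Q a))"
      using \<beta>(1)[of "tail Q a"] wf[OF a] v unfolding linear_map_iff by blast
    then have "rep_map X a (\<beta> (tail Q a) v) \<in> carrier (rep_space X (head Q a))"
      using X(1) a unfolding representation_def linear_map_iff by blast
    moreover have "app (A a) v = \<gamma> (head Q a) (rep_map X a (\<beta> (tail Q a) v))"
      unfolding A_def app_matrix_of[OF lin[OF a]] using trunc_id_iff[THEN iffD2, OF v] by simp
    ultimately show "rep_map X a (\<beta> (tail Q a) v) = \<beta> (head Q a) (app (A a) v)"
      using \<beta>\<gamma> wf[OF a] by simp
  qed
  moreover have "bij_betw (\<beta> i) (carrier (rep_space (matrix_quiver_rep d A) i)) (carrier (rep_space X i))"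
    if "i \<in> verts Q" for i
    using \<beta>(2)[OF that] that by (simp add: d_def del: coord_space_simps)
  ultimately have "rep_iso class_ring Q (matrix_quiver_rep d A) X" unfolding rep_iso_def by blast
  then show ?thesis using that rep by (simp add: d_def)
qed

text \<open>
  This is where the size of the type \<open>'w\<close> enters: coordinate vectors are coded as lists and embedded.
\<close>

lemma matrix_rep_realized:
  assumes Q: "fin_digraph Q" and rep: "matrix_rep Q d (A :: 'a \<Rightarrow> 'k::field endo)"
    and emb: "inj (emb :: 'k::field list \<Rightarrow> 'w)"
  obtains X :: "('v, 'a, 'k::field, 'w) quiver_rep" where "representation class_ring Q X"
    "fin_dim_rep class_ring Q X" "rep_iso class_ring Q (matrix_quiver_rep d A) X"
proof -
  define \<eta> :: "'v \<Rightarrow> (nat \<Rightarrow> 'k) \<Rightarrow> 'w" where "\<eta> i v = emb (map v [0..<d i])" for i v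
  have inj: "inj_on (\<eta> i) (carrier (coord_space (d i)))" for i
  proof (rule inj_onI, rule ext)
    fix u v r assume uv: "u \<in> carrier (coord_space (d i))" "v \<in> carrier (coord_space (d i))" "\<eta> i u = \<eta> i v"
    then have "map u [0..<d i] = map v [0..<d i]" using emb by (simp add: \<eta>_def inj_eq)
    then show "u r = v r" using uv(1,2) by (cases "r < d i") auto
  qed
  define V where "V i = transport_space (\<eta> i) (coord_space (d i))" for i
  define \<epsilon> where "\<epsilon> i = the_inv_into (carrier (coord_space (d i))) (\<eta> i)" for i
  have \<eta>: "linear_map class_ring (coord_space (d i)) (V i) (\<eta> i)" for i
    unfolding V_def by (rule linear_map_transport[OF vectorspace_coord_space inj])
  have car: "carrier (V i) = \<eta> i ` carrier (coord_space (d i))" for i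
    by (simp add: V_def transport_space_def Let_def)
  have bij: "bij_betw (\<eta> i) (carrier (coord_space (d i))) (carrier (V i))" for i
    using inj by (simp add: car bij_betw_def)
  have \<epsilon>: "linear_map class_ring (V i) (coord_space (d i)) (\<epsilon> i)" for i
    unfolding \<epsilon>_def by (rule linear_map_inverse[OF \<eta> bij])
  have \<epsilon>\<eta>: "\<epsilon> i (\<eta> i v) = v" if "v \<in> carrier (coord_space (d i))" for i v
    unfolding \<epsilon>_def using inj that by (rule the_inv_into_f_f)
  define X where "X = \<lparr>rep_space = V, rep_map = (\<lambda>a x. \<eta> (head Q a) (app (A a) (\<epsilon> (tail Q a) x)))\<rparr>"
  have "representation class_ring Q X"
    unfolding representation_def
  proof (intro conjI ballI)
    show "vectorspace class_ring (rep_space X i)" for i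
      using \<eta>[of i] by (simp add: X_def linear_map_iff)
    fix a assume "a \<in> arcs Q"
    then have "linear_map class_ring (coord_space (d (tail Q a))) (coord_space (d (head Q a))) (app (A a))"
      using rep by (intro linear_map_app) (simp add: matrix_rep_def)
    then show "linear_map class_ring (rep_space X (tail Q a)) (rep_space X (head Q a)) (rep_map X a)"
      unfolding X_def quiver_rep.simps
      by (rule linear_map_comp[OF linear_map_comp[OF \<epsilon>] \<eta>])
  qed
  moreover have "fin_dim_rep class_ring Q X"
    unfolding fin_dim_rep_def X_def quiver_rep.simps
    using fin_dim_of_coordinates[OF \<eta>] car by blast
  moreover have "\<eta> \<in> rep_hom class_ring Q (matrix_quiver_rep d A) X"
    unfolding rep_hom_def X_def matrix_quiver_rep_simps quiver_rep.simps using \<eta> \<epsilon>\<eta> by simp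
  then have "rep_iso class_ring Q (matrix_quiver_rep d A) X"
    unfolding rep_iso_def using bij by (intro bexI[of _ \<eta>]) (simp_all add: X_def del: coord_space_simps)
  ultimately show ?thesis using that by blast
qed

section \<open>Indecomposability and idempotents\<close>

text \<open>
  An idempotent endomorphism \<open>\<phi>\<close> decomposes \<open>X\<close> into the images of \<open>\<phi>\<close> and \<open>1 - \<phi>\<close>, which are
  subrepresentations of \<open>X\<close> and so have their elements in the same type.
\<close>

lemma matrix_indec_of_indecomposable:
  assumes Q: "fin_digraph Q" and rep: "matrix_rep Q d (A :: 'a \<Rightarrow> 'k::field endo)"
    and X: "representation class_ring Q X" "indecomposable_rep class_ring Q (X :: ('v, 'a, 'k::field, 'w) quiver_rep)"
    and iso: "rep_iso class_ring Q (matrix_quiver_rep d A) X"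
  shows "matrix_indec Q d A"
proof -
  note wf = arc_ends[OF Q]
  obtain \<beta> where \<beta>: "\<beta> \<in> rep_hom class_ring Q (matrix_quiver_rep d A) X"
    "\<forall>i\<in>verts Q. bij_betw (\<beta> i) (carrier (rep_space (matrix_quiver_rep d A) i)) (carrier (rep_space X i))"
    using iso by (auto simp: rep_iso_def)
  obtain \<gamma> where \<gamma>: "\<gamma> \<in> rep_hom class_ring Q X (matrix_quiver_rep d A)"
    and \<gamma>\<beta>: "\<And>i v. i \<in> verts Q \<Longrightarrow> v \<in> carrier (coord_space (d i)) \<Longrightarrow> \<gamma> i (\<beta> i v) = v"
    and \<beta>\<gamma>: "\<And>i x. i \<in> verts Q \<Longrightarrow> x \<in> carrier (rep_space X i) \<Longrightarrow> \<beta> i (\<gamma> i x) = x"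
    using rep_hom_inverse[OF Q representation_matrix[OF rep] \<beta>] by (metis matrix_quiver_rep_simps(1))
  have lin\<beta>: "linear_map class_ring (coord_space (d i)) (rep_space X i) (\<beta> i)"
    and lin\<gamma>: "linear_map class_ring (rep_space X i) (coord_space (d i)) (\<gamma> i)" if "i \<in> verts Q" for i
    using \<beta>(1) \<gamma> that by (simp_all add: rep_hom_def del: coord_space_simps)
  have \<beta>_car: "\<beta> i v \<in> carrier (rep_space X i)" if "i \<in> verts Q" "v \<in> carrier (coord_space (d i))" for i v
    using lin\<beta>[OF that(1)] that(2) unfolding linear_map_iff by blast
  have \<gamma>_car: "\<gamma> i x \<in> carrier (coord_space (d i))" if "i \<in> verts Q" "x \<in> carrier (rep_space X i)" for i x
    using lin\<gamma>[OF that(1)] that(2) unfolding linear_map_iff by blast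
  have "\<exists>i\<in>verts Q. d i \<noteq> 0"
  proof (rule ccontr)
    assume "\<not> ?thesis"
    then have 0: "d i = 0" if "i \<in> verts Q" for i using that by blast
    have "carrier (rep_space X i) = {\<zero>\<^bsub>rep_space X i\<^esub>}" if i: "i \<in> verts Q" for i
    proof -
      have "carrier (coord_space (d i)) = {\<lambda>_. 0 :: 'k}" using 0[OF i] by auto
      then have "carrier (rep_space X i) = {\<beta> i (\<lambda>_. 0)}"
        using \<beta>(2) i unfolding bij_betw_def matrix_quiver_rep_simps by (metis image_empty image_insert)
      moreover have "\<beta> i (\<lambda>_. 0) = \<zero>\<^bsub>rep_space X i\<^esub>" using linear_map_zero[OF lin\<beta>[OF i]] by simp
      ultimately show ?thesis by simp
    qed
    then show False using X(2) by (simp add: indecomposable_rep_def zero_rep_def)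
  qed
  moreover have "(\<forall>i\<in>verts Q. \<phi> i = 0) \<or> (\<forall>i\<in>verts Q. \<phi> i = trunc (d i))"
    if \<phi>: "matrix_hom Q d A d A \<phi>" and idem: "\<forall>i\<in>verts Q. \<phi> i * \<phi> i = \<phi> i" for \<phi>
  proof -
    define \<phi>' where "\<phi>' i = trunc (d i) - \<phi> i" for i
    have h: "\<phi> i \<in> homs (d i) (d i)" if "i \<in> verts Q" for i using \<phi> that by (simp add: matrix_hom_def)
    have \<phi>': "matrix_hom Q d A d A \<phi>'"
      unfolding matrix_hom_def
    proof (intro conjI ballI)
      show "\<phi>' i \<in> homs (d i) (d i)" if "i \<in> verts Q" for i
        unfolding \<phi>'_def using h[OF that] by (intro homs_diff) auto
      fix a assume a: "a \<in> arcs Q"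
      then have "A a \<in> homs (d (head Q a)) (d (tail Q a))" using rep by (simp add: matrix_rep_def)
      then show "A a * \<phi>' (tail Q a) = \<phi>' (head Q a) * A a"
        using \<phi> a by (simp add: \<phi>'_def matrix_hom_def left_diff_distrib right_diff_distrib homs_left homs_right)
    qed
    define image where "image \<psi> = (\<lparr>rep_space = (\<lambda>i. rep_space X i\<lparr>carrier :=
        (\<lambda>x. \<beta> i (app (\<psi> i) (\<gamma> i x))) ` carrier (rep_space X i)\<rparr>),
      rep_map = rep_map X\<rparr> :: ('v, 'a, 'k, 'w) quiver_rep)" for \<psi>
    have conj: "(\<lambda>i x. \<beta> i (app (\<psi> i) (\<gamma> i x))) \<in> rep_hom class_ring Q X X" if "matrix_hom Q d A d A \<psi>" for \<psi>
      using rep_hom_comp[OF Q rep_hom_comp[OF Q \<gamma> rep_hom_of_matrix_hom[OF that]] \<beta>(1)] .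
    have rep_image: "representation class_ring Q (image \<psi>)" if \<psi>: "matrix_hom Q d A d A \<psi>" for \<psi>
    proof -
      let ?e = "\<lambda>i x. \<beta> i (app (\<psi> i) (\<gamma> i x))"
      have lin: "linear_map class_ring (rep_space X i) (rep_space X i) (?e i)" if "i \<in> verts Q" for i
        using conj[OF \<psi>] that by (simp add: rep_hom_def)
      have vs: "vectorspace class_ring (rep_space (image \<psi>) i)" if i: "i \<in> verts Q" for i
      proof -
        interpret e: linear_map class_ring "rep_space X i" "rep_space X i" "?e i" by (rule lin[OF i])
        show ?thesis
          using vectorspace.subspace_is_vs[OF _ e.imT_is_subspace] lin[OF i]
          by (simp add: image_def e.im_def linear_map_iff)
      qed
      have "rep_map X a (?e (tail Q a) x) \<in> ?e (head Q a) ` carrier (rep_space X (head Q a))"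
        if a: "a \<in> arcs Q" and x: "x \<in> carrier (rep_space X (tail Q a))" for a x
      proof -
        have "rep_map X a x \<in> carrier (rep_space X (head Q a))"
          using X(1) a x unfolding representation_def linear_map_iff by blast
        moreover have "rep_map X a (?e (tail Q a) x) = ?e (head Q a) (rep_map X a x)"
          using conj[OF \<psi>] a x by (simp add: rep_hom_def)
        ultimately show ?thesis by blast
      qed
      moreover have "?e i x \<in> carrier (rep_space X i)" if "i \<in> verts Q" "x \<in> carrier (rep_space X i)" for i x
        using lin[OF that(1)] that(2) unfolding linear_map_iff by blast
      ultimately have "linear_map class_ring (rep_space (image \<psi>) (tail Q a)) (rep_space (image \<psi>) (head Q a)) (rep_map (image \<psi>) a)"
        if a: "a \<in> arcs Q" for a
        using X(1) a vs wf[OF a] unfolding representation_def linear_map_iff by (auto simp: image_def)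
      then show ?thesis using vs by (simp add: representation_def)
    qed
    let ?X1 = "image \<phi>" and ?X2 = "image \<phi>'"
    define \<theta> where "\<theta> i x = (\<beta> i (app (\<phi> i) (\<gamma> i x)), \<beta> i (app (\<phi>' i) (\<gamma> i x)))" for i x
    have "rep_iso class_ring Q X (rep_direct_sum ?X1 ?X2)"
      unfolding rep_iso_def
    proof (intro bexI[of _ \<theta>] ballI)
      show "\<theta> \<in> rep_hom class_ring Q X (rep_direct_sum ?X1 ?X2)"
        unfolding rep_hom_def
      proof (intro CollectI conjI ballI)
        fix i assume i: "i \<in> verts Q"
        have "vectorspace class_ring (direct_sum (rep_space ?X1 i) (rep_space ?X2 i))"
          using rep_image[OF \<phi>] rep_image[OF \<phi>'] i by (intro direct_sum_is_vs) (auto simp: representation_def)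
        then show "linear_map class_ring (rep_space X i) (rep_space (rep_direct_sum ?X1 ?X2) i) (\<theta> i)"
          using conj[OF \<phi>] conj[OF \<phi>'] i X(1)
          unfolding linear_map_iff rep_hom_def representation_def rep_direct_sum_def
          by (simp add: direct_sum_def \<theta>_def image_def)
      next
        fix a x assume "a \<in> arcs Q" "x \<in> carrier (rep_space X (tail Q a))"
        then show "rep_map (rep_direct_sum ?X1 ?X2) a (\<theta> (tail Q a) x) = \<theta> (head Q a) (rep_map X a x)"
          using conj[OF \<phi>] conj[OF \<phi>'] by (simp add: rep_hom_def rep_direct_sum_def \<theta>_def image_def)
      qed
      fix i assume i: "i \<in> verts Q"
      have sum: "(\<lambda>r. app (\<phi> i) v r + app (\<phi>' i) v r) = app (trunc (d i)) v" for v
        by (simp add: \<phi>'_def)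
      have h': "\<phi>' i \<in> homs (d i) (d i)" using \<phi>' i by (simp add: matrix_hom_def)
      have zero: "\<phi> i * \<phi>' i = 0" "\<phi>' i * \<phi> i = 0" "\<phi>' i * \<phi>' i = \<phi>' i"
        using idem i h[OF i] by (simp_all add: \<phi>'_def left_diff_distrib right_diff_distrib homs_left homs_right)
      show "bij_betw (\<theta> i) (carrier (rep_space X i)) (carrier (rep_space (rep_direct_sum ?X1 ?X2) i))"
        unfolding bij_betw_def
      proof
        show "inj_on (\<theta> i) (carrier (rep_space X i))"
        proof (rule inj_onI)
          fix x y assume x: "x \<in> carrier (rep_space X i)" and y: "y \<in> carrier (rep_space X i)" and "\<theta> i x = \<theta> i y"
          then have "\<beta> i (app (\<phi> i) (\<gamma> i x)) = \<beta> i (app (\<phi> i) (\<gamma> i y))"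
            "\<beta> i (app (\<phi>' i) (\<gamma> i x)) = \<beta> i (app (\<phi>' i) (\<gamma> i y))" by (simp_all add: \<theta>_def)
          then have eqs: "app (\<phi> i) (\<gamma> i x) = app (\<phi> i) (\<gamma> i y)" "app (\<phi>' i) (\<gamma> i x) = app (\<phi>' i) (\<gamma> i y)"
            using \<gamma>\<beta>[OF i] homs_in_coord_space[OF h[OF i]] homs_in_coord_space[OF h'] by metis+
          have "app (trunc (d i)) (\<gamma> i x) = app (trunc (d i)) (\<gamma> i y)" unfolding sum[symmetric] eqs by (rule refl)
          then have "\<gamma> i x = \<gamma> i y"
            using trunc_id_iff[THEN iffD2, OF \<gamma>_car[OF i x]] trunc_id_iff[THEN iffD2, OF \<gamma>_car[OF i y]] by metis
          then show "x = y" using \<beta>\<gamma>[OF i x] \<beta>\<gamma>[OF i y] by metis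
        qed
        let ?D = "carrier (rep_space (rep_direct_sum ?X1 ?X2) i)"
        have D: "?D = (\<lambda>x. \<beta> i (app (\<phi> i) (\<gamma> i x))) ` carrier (rep_space X i) \<times>
            (\<lambda>x. \<beta> i (app (\<phi>' i) (\<gamma> i x))) ` carrier (rep_space X i)"
          by (simp add: rep_direct_sum_def direct_sum_def image_def)
        show "\<theta> i ` carrier (rep_space X i) = ?D"
        proof
          show "\<theta> i ` carrier (rep_space X i) \<subseteq> ?D" unfolding D \<theta>_def by blast
          show "?D \<subseteq> \<theta> i ` carrier (rep_space X i)"
          proof
            fix p assume "p \<in> ?D"
            then obtain x y where p: "p = (\<beta> i (app (\<phi> i) (\<gamma> i x)), \<beta> i (app (\<phi>' i) (\<gamma> i y)))"
              unfolding D by blast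
            define v where "v = (\<lambda>r. app (\<phi> i) (\<gamma> i x) r + app (\<phi>' i) (\<gamma> i y) r)"
            have v: "v \<in> carrier (coord_space (d i))"
              using homs_app[OF h[OF i]] homs_app[OF h'] by (simp add: v_def)
            have "app (\<phi> i) v = app (\<phi> i * \<phi> i) (\<gamma> i x)" "app (\<phi>' i) v = app (\<phi>' i * \<phi>' i) (\<gamma> i y)"
              using arg_cong[OF zero(1), of "\<lambda>f. app f (\<gamma> i y)"] arg_cong[OF zero(2), of "\<lambda>f. app f (\<gamma> i x)"]
              unfolding v_def app_add by simp_all
            then have "\<theta> i (\<beta> i v) = p"
              using idem i zero(3) \<gamma>\<beta>[OF i v] by (simp add: \<theta>_def p)
            then show "p \<in> \<theta> i ` carrier (rep_space X i)" using \<beta>_car[OF i v] by blast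
          qed
        qed
      qed
    qed
    then have "zero_rep Q ?X1 \<or> zero_rep Q ?X2"
      using X(2) rep_image[OF \<phi>] rep_image[OF \<phi>'] unfolding indecomposable_rep_def by blast
    moreover have "\<psi> i = 0" if \<psi>: "matrix_hom Q d A d A \<psi>" and zero: "zero_rep Q (image \<psi>)" and i: "i \<in> verts Q" for \<psi> i
    proof (rule homs_eqI)
      show h: "\<psi> i \<in> homs (d i) (d i)" using \<psi> i by (simp add: matrix_hom_def)
      fix v :: "nat \<Rightarrow> 'k" assume v: "v \<in> carrier (coord_space (d i))"
      have "\<beta> i (app (\<psi> i) (\<gamma> i (\<beta> i v))) = \<zero>\<^bsub>rep_space X i\<^esub>"
        using zero i \<beta>_car[OF i v] unfolding zero_rep_def image_def by auto
      also have "\<dots> = \<beta> i (\<lambda>_. 0)" using linear_map_zero[OF lin\<beta>[OF i]] by simp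
      finally have "\<gamma> i (\<beta> i (app (\<psi> i) v)) = \<gamma> i (\<beta> i (\<lambda>_. 0))" using \<gamma>\<beta>[OF i v] by simp
      then have "app (\<psi> i) v = (\<lambda>_. 0)"
        using \<gamma>\<beta>[OF i homs_in_coord_space[OF h]] \<gamma>\<beta>[OF i, of "\<lambda>_. 0"] by simp
      then show "app (\<psi> i) v = app 0 v" by simp
    qed simp
    ultimately show ?thesis using \<phi> \<phi>' unfolding \<phi>'_def by (metis (no_types, lifting) eq_iff_diff_eq_0)
  qed
  ultimately show ?thesis using rep by (simp add: matrix_indec_def)
qed

text \<open>
  A decomposition of \<open>X\<close> gives the projection to the first summand. In coordinates it is an idempotent matrix
  endomorphism; if it is \<open>0\<close>, the first summand vanishes, and if it is the identity, the second one
  does.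
\<close>

lemma indecomposable_of_matrix_indec:
  assumes Q: "fin_digraph Q" and A: "matrix_indec Q d (A :: 'a \<Rightarrow> 'k::field endo)"
    and iso: "rep_iso class_ring Q (matrix_quiver_rep d A) (X :: ('v, 'a, 'k::field, 'w) quiver_rep)"
  shows "indecomposable_rep class_ring Q X"
proof -
  have rep: "matrix_rep Q d A" using A by (simp add: matrix_indec_def)
  have "\<not> zero_rep Q X"
  proof
    assume zero: "zero_rep Q X"
    obtain \<beta> where \<beta>: "\<forall>i\<in>verts Q. bij_betw (\<beta> i) (carrier (coord_space (d i) :: ('k, _) module)) (carrier (rep_space X i))"
      using iso by (auto simp: rep_iso_def)
    obtain i where i: "i \<in> verts Q" "d i \<noteq> 0" using A by (auto simp: matrix_indec_def)
    have "(\<lambda>_. 0) \<in> carrier (coord_space (d i))" "unit_at 0 \<in> carrier (coord_space (d i))"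
      using i(2) by (auto simp: unit_at_def)
    then have "\<beta> i (\<lambda>_. 0) \<in> carrier (rep_space X i)" "\<beta> i (unit_at 0) \<in> carrier (rep_space X i)"
      "\<beta> i (\<lambda>_. 0) = \<beta> i (unit_at 0) \<longrightarrow> (\<lambda>_. 0) = (unit_at 0 :: nat \<Rightarrow> 'k)"
      using \<beta> i(1) unfolding bij_betw_def inj_on_def by blast+
    then have "(\<lambda>_. 0) = (unit_at 0 :: nat \<Rightarrow> 'k)" using zero i(1) by (simp add: zero_rep_def)
    then have "(0 :: 'k) = unit_at 0 0" by metis
    then show False by (simp add: unit_at_def)
  qed
  moreover have "zero_rep Q X1 \<or> zero_rep Q X2"
    if X12: "representation class_ring Q X1" "representation class_ring Q X2"
      "rep_iso class_ring Q X (rep_direct_sum X1 X2)" for X1 X2 :: "('v, 'a, 'k, 'w) quiver_rep"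
  proof -
    let ?S = "rep_direct_sum X1 X2" and ?M = "matrix_quiver_rep d A"
    have "rep_iso class_ring Q ?M ?S" by (rule rep_iso_trans[OF Q iso X12(3)])
    then obtain \<theta> where \<theta>: "\<theta> \<in> rep_hom class_ring Q ?M ?S"
      "\<forall>i\<in>verts Q. bij_betw (\<theta> i) (carrier (rep_space ?M i)) (carrier (rep_space ?S i))"
      by (auto simp: rep_iso_def)
    obtain \<mu> where \<mu>: "\<mu> \<in> rep_hom class_ring Q ?S ?M"
      and \<mu>\<theta>: "\<And>i v. i \<in> verts Q \<Longrightarrow> v \<in> carrier (coord_space (d i)) \<Longrightarrow> \<mu> i (\<theta> i v) = v"
      and \<theta>\<mu>: "\<And>i x. i \<in> verts Q \<Longrightarrow> x \<in> carrier (rep_space ?S i) \<Longrightarrow> \<theta> i (\<mu> i x) = x"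
      using rep_hom_inverse[OF Q representation_matrix[OF rep] \<theta>] by (metis matrix_quiver_rep_simps(1))
    have S: "rep_space ?S i = direct_sum (rep_space X1 i) (rep_space X2 i)"
      "rep_map ?S a = map_prod (rep_map X1 a) (rep_map X2 a)" for i a
      by (simp_all add: rep_direct_sum_def)
    have vs: "vectorspace class_ring (rep_space X1 i)" "vectorspace class_ring (rep_space X2 i)"
      "vectorspace class_ring (rep_space ?S i)" if "i \<in> verts Q" for i
    proof -
      show v: "vectorspace class_ring (rep_space X1 i)" "vectorspace class_ring (rep_space X2 i)"
        using X12(1,2) that by (simp_all add: representation_def)
      show "vectorspace class_ring (rep_space ?S i)" unfolding S by (rule direct_sum_is_vs[OF v])
    qed
    have ab: "abelian_group (rep_space X1 i)" "abelian_group (rep_space X2 i)"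
      "module class_ring (rep_space X2 i)" if "i \<in> verts Q" for i
      using vs(1,2)[OF that] by (simp_all add: vectorspace_def module_def)
    define p where "p i z = (fst z, \<zero>\<^bsub>rep_space X2 i\<^esub>)" for i and z :: "'w \<times> 'w"
    have p: "p \<in> rep_hom class_ring Q ?S ?S"
      unfolding rep_hom_def
    proof (intro CollectI conjI ballI)
      fix i assume i: "i \<in> verts Q"
      interpret X2: module "class_ring :: 'k ring" "rep_space X2 i" by (rule ab(3)[OF i])
      show "linear_map class_ring (rep_space ?S i) (rep_space ?S i) (p i)"
        using vs(3)[OF i] unfolding linear_map_iff S by (auto simp: direct_sum_def p_def)
    next
      fix a x assume a: "a \<in> arcs Q" and "x \<in> carrier (rep_space ?S (tail Q a))"
      have "linear_map class_ring (rep_space X2 (tail Q a)) (rep_space X2 (head Q a)) (rep_map X2 a)"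
        using X12(2) a by (simp add: representation_def)
      then show "rep_map ?S a (p (tail Q a) x) = p (head Q a) (rep_map ?S a x)"
        using linear_map_zero by (simp add: S p_def)
    qed
    obtain \<phi> where \<phi>: "matrix_hom Q d A d A \<phi>"
      "\<And>i v. i \<in> verts Q \<Longrightarrow> v \<in> carrier (coord_space (d i)) \<Longrightarrow> app (\<phi> i) v = \<mu> i (p i (\<theta> i v))"
      using matrix_hom_of_rep_hom[OF Q rep rep rep_hom_comp[OF Q rep_hom_comp[OF Q \<theta>(1) p] \<mu>]] by blast
    have \<theta>_car: "\<theta> i v \<in> carrier (rep_space ?S i)" if "i \<in> verts Q" "v \<in> carrier (coord_space (d i))" for i v
      using \<theta>(1) that unfolding rep_hom_def linear_map_iff by simp
    have p_car: "p i z \<in> carrier (rep_space ?S i)" if "i \<in> verts Q" "z \<in> carrier (rep_space ?S i)" for i z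
      using p that unfolding rep_hom_def linear_map_iff by blast
    have \<mu>_car: "\<mu> i z \<in> carrier (coord_space (d i))" if "i \<in> verts Q" "z \<in> carrier (rep_space ?S i)" for i z
      using \<mu> that unfolding rep_hom_def linear_map_iff by simp
    have \<phi>\<mu>: "app (\<phi> i) (\<mu> i z) = \<mu> i (p i z)" if "i \<in> verts Q" "z \<in> carrier (rep_space ?S i)" for i z
      using \<phi>(2)[OF that(1) \<mu>_car[OF that]] \<theta>\<mu>[OF that] by simp
    have inj\<mu>: "z = z'" if "i \<in> verts Q" "z \<in> carrier (rep_space ?S i)" "z' \<in> carrier (rep_space ?S i)" "\<mu> i z = \<mu> i z'" for i z z'
      using \<theta>\<mu> that by metis
    have "\<phi> i * \<phi> i = \<phi> i" if i: "i \<in> verts Q" for i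
    proof -
      have h: "\<phi> i \<in> homs (d i) (d i)" using \<phi>(1) i by (simp add: matrix_hom_def)
      show ?thesis
      proof (rule homs_eqI[OF homs_mult[OF h h] h])
        fix v :: "nat \<Rightarrow> 'k" assume v: "v \<in> carrier (coord_space (d i))"
        have "app (\<phi> i) (\<mu> i (p i (\<theta> i v))) = \<mu> i (p i (p i (\<theta> i v)))"
          by (rule \<phi>\<mu>[OF i p_car[OF i \<theta>_car[OF i v]]])
        then show "app (\<phi> i * \<phi> i) v = app (\<phi> i) v"
          using \<phi>(2)[OF i v] by (simp add: p_def)
      qed
    qed
    then have "(\<forall>i\<in>verts Q. \<phi> i = 0) \<or> (\<forall>i\<in>verts Q. \<phi> i = trunc (d i))"
      using A \<phi>(1) unfolding matrix_indec_def by blast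
    moreover have S_car: "(x, y) \<in> carrier (rep_space ?S i)"
      if "x \<in> carrier (rep_space X1 i)" "y \<in> carrier (rep_space X2 i)" for i x y
      using that by (simp add: S direct_sum_def)
    have zeros: "\<zero>\<^bsub>rep_space X1 i\<^esub> \<in> carrier (rep_space X1 i)" "\<zero>\<^bsub>rep_space X2 i\<^esub> \<in> carrier (rep_space X2 i)"
      if "i \<in> verts Q" for i
      using ab(1,2)[OF that] by (auto simp: abelian_group_def abelian_monoid.zero_closed)
    have \<mu>0: "\<mu> i (\<zero>\<^bsub>rep_space X1 i\<^esub>, \<zero>\<^bsub>rep_space X2 i\<^esub>) = (\<lambda>_. 0)" if "i \<in> verts Q" for i
      using linear_map_zero[of class_ring "rep_space ?S i" "coord_space (d i)" "\<mu> i"] \<mu> that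
      by (simp add: rep_hom_def S direct_sum_def)
    have "zero_rep Q X1" if 0: "\<forall>i\<in>verts Q. \<phi> i = 0"
      unfolding zero_rep_def
    proof (intro ballI subset_antisym subsetI)
      fix i x assume i: "i \<in> verts Q" and x: "x \<in> carrier (rep_space X1 i)"
      have "\<mu> i (x, \<zero>\<^bsub>rep_space X2 i\<^esub>) = (\<lambda>_. 0)"
        using \<phi>\<mu>[OF i S_car[OF x zeros(2)[OF i]]] 0 i by (simp add: p_def)
      then have "(x, \<zero>\<^bsub>rep_space X2 i\<^esub>) = (\<zero>\<^bsub>rep_space X1 i\<^esub>, \<zero>\<^bsub>rep_space X2 i\<^esub>)"
        using inj\<mu>[OF i S_car[OF x zeros(2)[OF i]] S_car[OF zeros[OF i]]] \<mu>0[OF i] by simp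
      then show "x \<in> {\<zero>\<^bsub>rep_space X1 i\<^esub>}" by simp
    qed (use zeros in auto)
    moreover have "zero_rep Q X2" if 1: "\<forall>i\<in>verts Q. \<phi> i = trunc (d i)"
      unfolding zero_rep_def
    proof (intro ballI subset_antisym subsetI)
      fix i y assume i: "i \<in> verts Q" and y: "y \<in> carrier (rep_space X2 i)"
      let ?z = "(\<zero>\<^bsub>rep_space X1 i\<^esub>, y)"
      have z: "?z \<in> carrier (rep_space ?S i)" by (rule S_car[OF zeros(1)[OF i] y])
      have "\<mu> i ?z = app (trunc (d i)) (\<mu> i ?z)"
        using trunc_id_iff[THEN iffD2, OF \<mu>_car[OF i z]] by simp
      also have "\<dots> = (\<lambda>_. 0)" using \<phi>\<mu>[OF i z] 1 i \<mu>0[OF i] by (simp add: p_def)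
      finally have "?z = (\<zero>\<^bsub>rep_space X1 i\<^esub>, \<zero>\<^bsub>rep_space X2 i\<^esub>)"
        using inj\<mu>[OF i z S_car[OF zeros[OF i]]] \<mu>0[OF i] by simp
      then show "y \<in> {\<zero>\<^bsub>rep_space X2 i\<^esub>}" by simp
    qed (use zeros in auto)
    ultimately show ?thesis by blast
  qed
  ultimately show ?thesis unfolding indecomposable_rep_def by blast
qed

section \<open>Gabriel's theorem\<close>

lemma linked_of_connected:
  assumes "fin_digraph Q" "Digraph_Component.connected Q"
  shows "linked Q (arcs Q)"
  unfolding linked_def
proof (intro allI impI ballI)
  fix P :: "'a \<Rightarrow> bool" and u v
  assume P: "\<forall>b\<in>arcs Q. P (tail Q b) = P (head Q b)" and uv: "u \<in> verts Q" "v \<in> verts Q"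
  have "u \<rightarrow>\<^sup>*\<^bsub>mk_symmetric Q\<^esub> v"
    using assms(2) uv by (simp add: Digraph_Component.connected_def strongly_connected_def)
  then have "(u, v) \<in> (arcs_ends (mk_symmetric Q))\<^sup>*" by (rule reachable_rtranclI)
  then show "P u = P v"
  proof (induction rule: rtrancl_induct)
    case (step y z)
    then have "(y, z) \<in> parcs (mk_symmetric Q)" by simp
    then show ?case using P step.IH by (auto simp: parcs_mk_symmetric)
  qed simp
qed

text \<open>
  Isomorphism classes of indecomposables are compared with their dimension vectors. In the Dynkin case the
  dimension vector determines the class. In general different dimension vectors give
  different classes, so finitely many classes force finitely many dimension vectors.
\<close>

theorem corollary5p3p3:
  fixes Q :: "('v, 'a) pre_digraph"
  assumes "fin_digraph Q"
    and "Digraph_Component.connected Q"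
    and \<comment> \<open>The type \<open>'w\<close> from which the elements of the vector spaces are taken is large enough
      to contain a copy of every \<open>k^n\<close>.\<close>
      "\<exists>emb :: 'k list \<Rightarrow> 'w. inj emb"
  shows "finite ((indecomposables class_ring Q :: ('v, 'a, 'k::field, 'w) quiver_rep set)
                   // rep_iso_rel class_ring Q)
         \<longleftrightarrow> (\<exists>G\<in>dynkin_diagrams. underlying_graph_iso Q G)"
proof -
  note Q = assms(1) and conn = assms(2)
  let ?I = "indecomposables class_ring Q :: ('v, 'a, 'k, 'w) quiver_rep set"
  let ?R = "rep_iso_rel class_ring Q :: (('v, 'a, 'k, 'w) quiver_rep \<times> ('v, 'a, 'k, 'w) quiver_rep) set"
  have ne: "verts Q \<noteq> {}"
    using conn by (auto simp: Digraph_Component.connected_def strongly_connected_def)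
  have R_rep: "representation class_ring Q X" if "X \<in> ?I" for X using that by (simp add: indecomposables_def)
  have classes: "?R `` {X} = ?R `` {Y}" if X: "X \<in> ?I" and Y: "Y \<in> ?I" and iso: "rep_iso class_ring Q X Y" for X Y
    using R_rep[OF X] R_rep[OF Y] iso rep_iso_sym[OF Q] rep_iso_trans[OF Q]
    unfolding rep_iso_rel_def by blast
  have form: "\<exists>d\<in>indec_dims TYPE('k) Q. \<exists>A :: 'a \<Rightarrow> 'k endo. matrix_indec Q d A \<and>
      rep_iso class_ring Q (matrix_quiver_rep d A) X" if X: "X \<in> ?I" for X
  proof -
    have X': "representation class_ring Q X" "fin_dim_rep class_ring Q X" "indecomposable_rep class_ring Q X"
      using X by (simp_all add: indecomposables_def)
    obtain d and A :: "'a \<Rightarrow> 'k endo" where "matrix_rep Q d A" "\<And>i. i \<notin> verts Q \<Longrightarrow> d i = 0"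
      "rep_iso class_ring Q (matrix_quiver_rep d A) X"
      using matrix_form_exists[OF Q X'(1,2)] by blast
    then show ?thesis
      using matrix_indec_of_indecomposable[OF Q _ X'(1,3)] unfolding indec_dims_def by blast
  qed
  show ?thesis
  proof
    assume "\<exists>G\<in>dynkin_diagrams. underlying_graph_iso Q G"
    then obtain vs where pd: "pos_def Q" "topological_order Q vs" using dynkin_imp_pos_def[OF Q] by blast
    note unique = pos_def_indec(2)[OF Q pd(2,1), where 'k = 'k]
    define P where "P d X \<longleftrightarrow> X \<in> ?I \<and> (\<exists>A :: 'a \<Rightarrow> 'k endo. matrix_indec Q d A \<and>
      rep_iso class_ring Q (matrix_quiver_rep d A) X)" for d X
    have "?I // ?R \<subseteq> (\<lambda>d. ?R `` {SOME X. P d X}) ` indec_dims TYPE('k) Q"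
    proof
      fix C assume "C \<in> ?I // ?R"
      then obtain X where X: "X \<in> ?I" "C = ?R `` {X}" by (auto elim: quotientE)
      obtain d where d: "d \<in> indec_dims TYPE('k) Q" "P d X" using form[OF X(1)] X(1) by (auto simp: P_def)
      define Y where "Y = (SOME X. P d X)"
      have "P d Y" unfolding Y_def using d(2) by (rule someI)
      then obtain A B :: "'a \<Rightarrow> 'k endo" where A: "matrix_indec Q d A" "rep_iso class_ring Q (matrix_quiver_rep d A) X"
        and B: "matrix_indec Q d B" "rep_iso class_ring Q (matrix_quiver_rep d B) Y" and Y: "Y \<in> ?I"
        using d(2) by (auto simp: P_def)
      have rep: "matrix_rep Q d A" "matrix_rep Q d B" using A(1) B(1) by (simp_all add: matrix_indec_def)
      have "rep_iso class_ring Q (matrix_quiver_rep d A) (matrix_quiver_rep d B)"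
        using unique[OF d(1) A(1) B(1)] rep_iso_matrix_iff[OF Q rep] by blast
      from rep_iso_trans[OF Q rep_iso_sym[OF Q representation_matrix[OF rep(1)] A(2)]
          rep_iso_trans[OF Q this B(2)]]
      have "rep_iso class_ring Q X Y" .
      then show "C \<in> (\<lambda>d. ?R `` {SOME X. P d X}) ` indec_dims TYPE('k) Q"
        using classes[OF X(1) Y] X(2) d(1) unfolding Y_def by blast
    qed
    then show "finite (?I // ?R)"
      using finite_subset pos_def_indec(1)[OF Q pd(2,1), where 'k = 'k] by blast
  next
    assume fin: "finite (?I // ?R)"
    obtain emb :: "'k list \<Rightarrow> 'w" where emb: "inj emb" using assms(3) by blast
    have "\<exists>X \<in> ?I. \<exists>A :: 'a \<Rightarrow> 'k endo. matrix_rep Q d A \<and> rep_iso class_ring Q (matrix_quiver_rep d A) X"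
      if "d \<in> indec_dims TYPE('k) Q" for d
    proof -
      from that have "\<exists>A :: 'a \<Rightarrow> 'k endo. matrix_indec Q d A" by (simp add: indec_dims_def)
      then obtain A :: "'a \<Rightarrow> 'k endo" where A: "matrix_indec Q d A" by blast
      then have rep: "matrix_rep Q d A" by (simp add: matrix_indec_def)
      obtain X :: "('v, 'a, 'k, 'w) quiver_rep" where X: "representation class_ring Q X"
        "fin_dim_rep class_ring Q X" "rep_iso class_ring Q (matrix_quiver_rep d A) X"
        using matrix_rep_realized[OF Q rep emb] by blast
      then have "X \<in> ?I"
        using indecomposable_of_matrix_indec[OF Q A X(3)] by (simp add: indecomposables_def)
      then show ?thesis using rep X(3) by blast
    qed
    then obtain X where X: "\<And>d. d \<in> indec_dims TYPE('k) Q \<Longrightarrow> X d \<in> ?I \<and> (\<exists>A :: 'a \<Rightarrow> 'k endo.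
        matrix_rep Q d A \<and> rep_iso class_ring Q (matrix_quiver_rep d A) (X d))"
      by metis
    have "inj_on (\<lambda>d. ?R `` {X d}) (indec_dims TYPE('k) Q)"
    proof (rule inj_onI)
      fix d e assume d: "d \<in> indec_dims TYPE('k) Q" and e: "e \<in> indec_dims TYPE('k) Q"
        and eq: "?R `` {X d} = ?R `` {X e}"
      have "(X e, X e) \<in> ?R" using R_rep X[OF e] rep_iso_refl by (auto simp: rep_iso_rel_def)
      then have iso: "rep_iso class_ring Q (X d) (X e)" using eq by (auto simp: rep_iso_rel_def)
      obtain A B :: "'a \<Rightarrow> 'k endo" where A: "matrix_rep Q d A" "rep_iso class_ring Q (matrix_quiver_rep d A) (X d)"
        and B: "matrix_rep Q e B" "rep_iso class_ring Q (matrix_quiver_rep e B) (X e)"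
        using X[OF d] X[OF e] by blast
      have "rep_iso class_ring Q (matrix_quiver_rep d A) (matrix_quiver_rep e B)"
        by (rule rep_iso_trans[OF Q A(2) rep_iso_trans[OF Q iso rep_iso_sym[OF Q representation_matrix[OF B(1)] B(2)]]])
      then have "matrix_iso Q d A e B" using rep_iso_matrix_iff[OF Q A(1) B(1)] by blast
      then show "d = e"
        using matrix_iso_dim d e unfolding indec_dims_def by fastforce
    qed
    moreover have "(\<lambda>d. ?R `` {X d}) ` indec_dims TYPE('k) Q \<subseteq> ?I // ?R"
      using X by (auto intro: quotientI)
    ultimately have "finite (indec_dims TYPE('k) Q)" using fin inj_on_finite by blast
    then show "\<exists>G\<in>dynkin_diagrams. underlying_graph_iso Q G"
      by (rule finite_imp_dynkin[OF Q ne linked_of_connected[OF Q conn]])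
  qed
qed

end
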